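(* Let $W = \{W(t) : t \ge 0\}$ be a standard one-dimensional Brownian motion started at $0$ and let $B = \{B(t) : t \in [0,1]\}$ be a standard one-dimensional Brownian bridge started at $0$, with $W$ and $B$ independent. Let $\mathsf{T}$ be the $[0,1]$-valued random variable representing the time at which the combined maximum of $W$ (on $[0,1]$) and $B$ is attained, i.e. $$\max\{W(\mathsf{T}), B(\mathsf{T})\} = \max\left\{\max_{0\le s\le 1} W(s),\ \max_{0 \le s \le 1} B(s)\right\}.$$ Then the probability density function $\rho$ of $\mathsf{T}$ is $$\rho(t) = \frac{4\sqrt{t}}{\pi(4t+1)\sqrt{1-t}} + \frac{2}{\pi}\left(\frac{\sqrt{t(1-t)}}{1+t-t^2} + \arctan\sqrt{t(1-t)}\right), \qquad t \in (0,1).$$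
   Context: A standard one-dimensional Brownian bridge on $[0,1]$ is the process corresponding to standard one-dimensional Brownian motion started at $0$ and conditioned to return to $0$ at time $1$. The time $\mathsf{T}$ is understood as the (almost surely uniquely determined) time satisfying the displayed equation; it is not known a priori at which of the two processes the maximum is achieved. *)

theory Defs
  imports "HOL-Probability.Probability"
begin

text \<open>Processes are functions of time with values in random variables; only the values at times in
  the stated time set matter. The initial value and path continuity are required almost surely.\<close>

definition standard_brownian_motion :: "'a measure \<Rightarrow> (real \<Rightarrow> 'a \<Rightarrow> real) \<Rightarrow> bool" where
  "standard_brownian_motion M W \<longleftrightarrow>
     (\<forall>t\<ge>0. W t \<in> borel_measurable M) \<and>
     (AE \<omega> in M. W 0 \<omega> = 0) \<and>
     (\<forall>n t. 0 \<le> t 0 \<and> (\<forall>i<n. t i \<le> t (Suc i)) \<longrightarrow>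
        prob_space.indep_vars M (\<lambda>_. borel) (\<lambda>i \<omega>. W (t (Suc i)) \<omega> - W (t i) \<omega>) {..<n::nat}) \<and>
     (\<forall>s t. 0 \<le> s \<and> s < t \<longrightarrow>
        distributed M lborel (\<lambda>\<omega>. W t \<omega> - W s \<omega>)
          (\<lambda>x. ennreal (normal_density 0 (sqrt (t - s)) x))) \<and>
     (AE \<omega> in M. continuous_on {0..} (\<lambda>t. W t \<omega>))"

text \<open>For \<open>0 = t 0 < \<dots> < t n\<close> and \<open>x 0 = 0\<close>, this is the joint density at \<open>(x 1, \<dots>, x n)\<close> of a standard
  Brownian motion observed at the times \<open>t 1, \<dots>, t n\<close>, by independence and normality of the
  increments.\<close>

definition brownian_joint_density :: "nat \<Rightarrow> (nat \<Rightarrow> real) \<Rightarrow> (nat \<Rightarrow> real) \<Rightarrow> real" where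
  "brownian_joint_density n t x =
     (\<Prod>i<n. normal_density 0 (sqrt (t (Suc i) - t i)) (x (Suc i) - x i))"

text \<open>The event that Brownian motion is at \<open>0\<close> at time \<open>1\<close> has probability zero, so conditioning on it
  is by conditional densities: at interior times \<open>t 1 < \<dots> < t n\<close> the density of the bridge is the joint
  density of Brownian motion at \<open>t 1, \<dots>, t n, 1\<close>, evaluated at \<open>(x 1, \<dots>, x n, 0)\<close>, divided by the
  density of its time-\<open>1\<close> value at \<open>0\<close>.\<close>

definition standard_brownian_bridge :: "'a measure \<Rightarrow> (real \<Rightarrow> 'a \<Rightarrow> real) \<Rightarrow> bool" where
  "standard_brownian_bridge M B \<longleftrightarrow>
     (\<forall>t\<in>{0..1}. B t \<in> borel_measurable M) \<and>
     (AE \<omega> in M. B 0 \<omega> = 0) \<and>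
     (AE \<omega> in M. B 1 \<omega> = 0) \<and>
     (\<forall>n t. t 0 = 0 \<and> t (Suc n) = 1 \<and> (\<forall>i\<le>n. t i < t (Suc i)) \<longrightarrow>
        distributed M (\<Pi>\<^sub>M i\<in>{1..n}. lborel) (\<lambda>\<omega>. \<lambda>i\<in>{1..n}. B (t i) \<omega>)
          (\<lambda>x. ennreal (brownian_joint_density (Suc n) t (x(0 := 0, Suc n := 0))
                         / normal_density 0 1 0))) \<and>
     (AE \<omega> in M. continuous_on {0..1} (\<lambda>t. B t \<omega>))"

end

theory Submission
  imports Defs "HOL-Real_Asymp.Real_Asymp"
begin

text \<open>
  If \<open>A\<close> and \<open>C\<close> denote the maxima of \<open>W\<close> or \<open>B\<close> over \<open>[0, t]\<close> and \<open>[t, 1]\<close>, then up to null sets the combined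
  maximum is attained before \<open>t\<close> iff one of the two processes has \<open>C \<le> A\<close> and its \<open>A\<close> exceeds the total
  maximum of the other, independent process. Hence it suffices to know, for each process, the law of its
  maximum and the law of \<open>A\<close> on the event \<open>C \<le> A\<close>.

  For \<open>W\<close>, the reflection principle gives the joint density of the maximum over \<open>[0, t]\<close> and \<open>W t\<close>, and the
  increments after \<open>t\<close> are independent of these. On events before a time \<open>r < 1\<close> the bridge is \<open>W\<close> weighted by
  \<open>heat (1 - r) (W r) / heat 1 0\<close>; letting \<open>r\<close> tend to \<open>1\<close> turns this weight into a condition on the
  endpoint. The density of \<open>A\<close> on \<open>C \<le> A\<close> comes out as \<open>4 \<phi>(a) (1 - \<Phi>(a \<surd>((1 - t) / t)))\<close> for \<open>W\<close> and
  \<open>4 a exp (- 2 a\<^sup>2) (1 - \<Phi>(a (1 - 2 t) / \<surd>(t (1 - t))))\<close> for \<open>B\<close>. Differentiating in \<open>t\<close> and integrating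
  against the distribution functions \<open>1 - exp (- 2 a\<^sup>2)\<close> and \<open>2 \<Phi>(a) - 1\<close> of the other maximum yields the
  two summands of the density.
\<close>

subsection \<open>Reflection at discrete times\<close>

text \<open>The first passage of a level is never treated as a stopping time: reflection is done on
  dyadic grids, where a path may overshoot the level, and uniform continuity removes the overshoot
  in the limit. For the bridge only densities at interior times are given, so its law is compared
  with that of \<open>W\<close> up to \<open>r < 1\<close>. At \<open>r = 1\<close> the weight would
  become a point mass; before the limit it is paired with the killed heat kernel
  \<open>heat s x - heat s (2 * u - x)\<close>, which is bounded and continuous, so the weight may
  concentrate. Ties are the other obstacle: \<open>T\<close> is an arbitrary measurable choice of a
  maximizing time, and its distribution function is determined only once ties of the early and late
  maxima, and of the two total maxima, are known to have probability zero. Differentiating in time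
  before integrating over the level makes the answer explicit: time enters the two early laws only
  through the argument of \<open>Phi\<close>, so the derivatives are elementary. The density is
  never integrated over the whole interval; its total mass is 1 because no mass of \<open>T\<close>
  sits at the endpoints.\<close>

lemma finite_borel_measure_eqI_atMost:
  fixes M N :: "'a::ordered_euclidean_space measure"
  assumes "finite_measure M" and "sets M = sets borel" "sets N = sets borel"
    and eq: "\<And>a. emeasure M {..a} = emeasure N {..a}"
  shows "M = N"
proof (rule measure_eqI_generator_eq[where E = "range atMost" and \<Omega> = UNIV
      and A = "\<lambda>n::nat. {..real n *\<^sub>R One}"])
  interpret finite_measure M by fact
  show "Int_stable (range (atMost :: 'a \<Rightarrow> 'a set))"
  proof (rule Int_stableI_image)
    fix a b :: 'a
    show "\<exists>c\<in>UNIV. {..a} \<inter> {..b} = {..c}"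
      by (intro bexI[of _ "inf a b"]) auto
  qed
  have "sets (borel :: 'a measure) = sigma_sets UNIV (range atMost)"
    by (subst borel_eq_atMost) simp
  with assms show "sets M = sigma_sets UNIV (range atMost)" "sets N = sigma_sets UNIV (range atMost)"
    by simp_all
  show "(\<Union>n::nat. {..real n *\<^sub>R One :: 'a}) = UNIV"
  proof safe
    fix x :: 'a
    obtain n :: nat where "norm x \<le> real n"
      using real_arch_simple by blast
    moreover have "x \<bullet> b \<le> norm x" if "b \<in> Basis" for b
      using Basis_le_norm[OF that, of x] by simp
    ultimately show "x \<in> (\<Union>n::nat. {..real n *\<^sub>R One})"
      by (auto simp: eucl_le[where 'a='a] intro!: exI[of _ n]) (meson order_trans)
  qed simp
  \<comment> \<open>Finiteness is asked of \<open>M\<close> alone, so \<open>N\<close> may be a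
    density whose total mass is not known beforehand.\<close>
  show "emeasure M {..real n *\<^sub>R One} \<noteq> \<infinity>" for n
    using finite_measure.emeasure_finite[OF assms(1)] by simp
qed (auto simp: eq)

lemma atMost_Pair: "{..(a, b)} = {..a} \<times> {..b}"
  by auto

text \<open>Unlike \<open>indep_var\<close>, this allows the two variables to have different types.\<close>

definition (in prob_space) indep_pair ::
    "'b measure \<Rightarrow> ('a \<Rightarrow> 'b) \<Rightarrow> 'c measure \<Rightarrow> ('a \<Rightarrow> 'c) \<Rightarrow> bool" where
  "indep_pair S X T Y \<longleftrightarrow> X \<in> measurable M S \<and> Y \<in> measurable M T \<and>
     distr M (S \<Otimes>\<^sub>M T) (\<lambda>\<omega>. (X \<omega>, Y \<omega>)) = distr M S X \<Otimes>\<^sub>M distr M T Y"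

context prob_space
begin

lemma indep_var_imp_indep_pair: "indep_var S X T Y \<Longrightarrow> indep_pair S X T Y"
  by (auto simp: indep_var_distribution_eq indep_pair_def)

lemma indep_pair_compose:
  assumes "indep_pair S X T Y" and f: "f \<in> measurable S S'" and g: "g \<in> measurable T T'"
  shows "indep_pair S' (\<lambda>\<omega>. f (X \<omega>)) T' (\<lambda>\<omega>. g (Y \<omega>))"
proof -
  from assms have X[measurable]: "X \<in> measurable M S" and Y[measurable]: "Y \<in> measurable M T"
    and eq: "distr M (S \<Otimes>\<^sub>M T) (\<lambda>\<omega>. (X \<omega>, Y \<omega>)) = distr M S X \<Otimes>\<^sub>M distr M T Y"
    by (auto simp: indep_pair_def)
  note [measurable] = f g
  interpret Y': prob_space "distr (distr M T Y) T' g"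
    by (intro prob_space.prob_space_distr prob_space_distr) auto
  have "distr M S' (\<lambda>\<omega>. f (X \<omega>)) \<Otimes>\<^sub>M distr M T' (\<lambda>\<omega>. g (Y \<omega>))
      = distr (distr M S X) S' f \<Otimes>\<^sub>M distr (distr M T Y) T' g"
    by (simp add: distr_distr comp_def)
  also have "\<dots> = distr (distr M S X \<Otimes>\<^sub>M distr M T Y) (S' \<Otimes>\<^sub>M T') (\<lambda>(x, y). (f x, g y))"
    by (rule pair_measure_distr) (auto intro: Y'.sigma_finite_measure_axioms)
  also have "\<dots> = distr M (S' \<Otimes>\<^sub>M T') (\<lambda>\<omega>. (f (X \<omega>), g (Y \<omega>)))"
    by (subst eq[symmetric], subst distr_distr) (auto simp: comp_def)
  finally show ?thesis
    by (simp add: indep_pair_def)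
qed

text \<open>Orthants of a product type are products of orthants, so the joint law and the product of
  the marginals are compared by their distribution functions. With pairs as values this covers
  events given by four inequalities.\<close>

lemma indep_pair_atMostI:
  fixes X :: "'a \<Rightarrow> 'b :: ordered_euclidean_space" and Y :: "'a \<Rightarrow> 'c :: ordered_euclidean_space"
  assumes X[measurable]: "X \<in> borel_measurable M" and Y[measurable]: "Y \<in> borel_measurable M"
    and boxes: "\<And>p q. prob {\<omega>\<in>space M. X \<omega> \<le> p \<and> Y \<omega> \<le> q} = prob {\<omega>\<in>space M. X \<omega> \<le> p} * prob {\<omega>\<in>space M. Y \<omega> \<le> q}"
  shows "indep_pair borel X borel Y"
proof -
  interpret X: prob_space "distr M borel X" by (rule prob_space_distr) simp
  interpret Y: prob_space "distr M borel Y" by (rule prob_space_distr) simp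
  have "distr M borel (\<lambda>\<omega>. (X \<omega>, Y \<omega>)) = distr M borel X \<Otimes>\<^sub>M distr M borel Y"
  proof (rule finite_borel_measure_eqI_atMost)
    have XY[measurable]: "(\<lambda>\<omega>. (X \<omega>, Y \<omega>)) \<in> borel_measurable M"
      by (subst borel_prod[symmetric]) measurable
    show "finite_measure (distr M borel (\<lambda>\<omega>. (X \<omega>, Y \<omega>)))"
      by (intro finite_measure_distr XY)
    show "sets (distr M borel X \<Otimes>\<^sub>M distr M borel Y) = sets borel"
      by (simp add: borel_prod[symmetric] cong: sets_pair_measure_cong)
    fix r :: "'b \<times> 'c"
    obtain p q where r: "r = (p, q)" by (cases r)
    have "emeasure (distr M borel X \<Otimes>\<^sub>M distr M borel Y) {..r} =
       emeasure (distr M borel X) {..p} * emeasure (distr M borel Y) {..q}"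
      unfolding r atMost_Pair by (rule Y.emeasure_pair_measure_Times) auto
    also have "emeasure (distr M borel X) {..p} = prob {\<omega>\<in>space M. X \<omega> \<le> p}"
      by (subst emeasure_distr) (auto simp: emeasure_eq_measure intro!: arg_cong[where f=prob])
    also have "emeasure (distr M borel Y) {..q} = prob {\<omega>\<in>space M. Y \<omega> \<le> q}"
      by (subst emeasure_distr) (auto simp: emeasure_eq_measure intro!: arg_cong[where f=prob])
    finally have 1: "emeasure (distr M borel X \<Otimes>\<^sub>M distr M borel Y) {..r} = prob {\<omega>\<in>space M. X \<omega> \<le> p \<and> Y \<omega> \<le> q}"
      unfolding boxes by (simp only: ennreal_mult measure_nonneg)
    have "emeasure (distr M borel (\<lambda>\<omega>. (X \<omega>, Y \<omega>))) {..r} = prob {\<omega>\<in>space M. X \<omega> \<le> p \<and> Y \<omega> \<le> q}"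
      by (subst emeasure_distr) (auto simp: r emeasure_eq_measure intro!: arg_cong[where f=prob])
    with 1 show "emeasure (distr M borel (\<lambda>\<omega>. (X \<omega>, Y \<omega>))) {..r} =
      emeasure (distr M borel X \<Otimes>\<^sub>M distr M borel Y) {..r}" by simp
  qed simp
  then show ?thesis
    by (simp add: indep_pair_def borel_prod)
qed

text \<open>Fubini for the product law: the second variable becomes an independent copy, evaluated
  at \<open>\<omega>'\<close>. Conditioning on one of two independent variables takes this form from
  here on.\<close>

lemma indep_pair_nn_integral:
  assumes "indep_pair S X T Y" and h: "h \<in> borel_measurable (S \<Otimes>\<^sub>M T)"
  shows "(\<integral>\<^sup>+\<omega>. h (X \<omega>, Y \<omega>) \<partial>M) = (\<integral>\<^sup>+\<omega>. (\<integral>\<^sup>+\<omega>'. h (X \<omega>, Y \<omega>') \<partial>M) \<partial>M)"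
proof -
  from assms have [measurable]: "X \<in> measurable M S" "Y \<in> measurable M T"
    and eq: "distr M (S \<Otimes>\<^sub>M T) (\<lambda>\<omega>. (X \<omega>, Y \<omega>)) = distr M S X \<Otimes>\<^sub>M distr M T Y"
    by (auto simp: indep_pair_def)
  note [measurable] = h
  interpret Y': prob_space "distr M T Y" by (rule prob_space_distr) auto
  have "(\<integral>\<^sup>+\<omega>. h (X \<omega>, Y \<omega>) \<partial>M) = (\<integral>\<^sup>+p. h p \<partial>(distr M S X \<Otimes>\<^sub>M distr M T Y))"
    by (subst eq[symmetric], subst nn_integral_distr) auto
  also have "\<dots> = (\<integral>\<^sup>+x. \<integral>\<^sup>+y. h (x, y) \<partial>distr M T Y \<partial>distr M S X)"
    by (rule Y'.nn_integral_fst[symmetric]) simp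
  also have "\<dots> = (\<integral>\<^sup>+\<omega>. (\<integral>\<^sup>+y. h (X \<omega>, y) \<partial>distr M T Y) \<partial>M)"
    by (rule nn_integral_distr) simp_all
  also have "\<dots> = (\<integral>\<^sup>+\<omega>. (\<integral>\<^sup>+\<omega>'. h (X \<omega>, Y \<omega>') \<partial>M) \<partial>M)"
    by (intro nn_integral_cong nn_integral_distr) (auto intro: measurable_compose[OF _ h])
  finally show ?thesis .
qed

end

text \<open>Initial value and continuity are required at every \<open>\<omega>\<close>, so running
  maxima are attained and comparable without exceptional sets. The main theorem reaches this
  situation by setting the paths to zero off a set of full measure.\<close>

locale continuous_brownian = prob_space M for M :: "'a measure" +
  fixes W :: "real \<Rightarrow> 'a \<Rightarrow> real"
  assumes measurable_W: "\<And>t. 0 \<le> t \<Longrightarrow> W t \<in> borel_measurable M"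
    and W_0: "\<And>\<omega>. W 0 \<omega> = 0"
    and indep_increments: "\<And>n t. 0 \<le> t 0 \<Longrightarrow> (\<And>i. i < n \<Longrightarrow> t i \<le> t (Suc i)) \<Longrightarrow>
        indep_vars (\<lambda>_. borel) (\<lambda>i \<omega>. W (t (Suc i)) \<omega> - W (t i) \<omega>) {..<n::nat}"
    and normal_increments: "\<And>s t. 0 \<le> s \<Longrightarrow> s < t \<Longrightarrow>
        distributed M lborel (\<lambda>\<omega>. W t \<omega> - W s \<omega>) (\<lambda>x. ennreal (normal_density 0 (sqrt (t - s)) x))"
    and continuous_W: "\<And>\<omega>. continuous_on {0..} (\<lambda>t. W t \<omega>)"
begin

lemma grid_mono:
  fixes t :: "nat \<Rightarrow> real"
  assumes "\<And>i. i < n \<Longrightarrow> t i \<le> t (Suc i)" "i \<le> j" "j \<le> n"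
  shows "t i \<le> t j"
  using assms(2,3)
proof (induction rule: dec_induct)
  case (step k)
  then show ?case using assms(1)[of k] by simp
qed simp

text \<open>Values up to index \<open>k\<close> are partial sums of the first \<open>k\<close>
  increments and later displacements are partial sums of the others; disjoint blocks of independent
  increments are independent.\<close>

lemma indep_past_future:
  fixes t :: "nat \<Rightarrow> real"
  assumes t0: "t 0 = 0" and mono: "\<And>i. i < n \<Longrightarrow> t i \<le> t (Suc i)" and k: "k \<le> n"
  shows "indep_var (\<Pi>\<^sub>M i\<in>{..k}. borel) (\<lambda>\<omega>. \<lambda>i\<in>{..k}. W (t i) \<omega>)
     (\<Pi>\<^sub>M i\<in>{k..n}. borel) (\<lambda>\<omega>. \<lambda>i\<in>{k..n}. W (t i) \<omega> - W (t k) \<omega>)"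
proof -
  let ?D = "\<lambda>i \<omega>. W (t (Suc i)) \<omega> - W (t i) \<omega>"
  have "indep_vars (\<lambda>_. borel) ?D {..<n}"
    by (rule indep_increments) (use t0 mono in auto)
  then have "indep_var (\<Pi>\<^sub>M i\<in>{..<k}. borel) (\<lambda>\<omega>. restrict (\<lambda>i. ?D i \<omega>) {..<k})
      (\<Pi>\<^sub>M i\<in>{k..<n}. borel) (\<lambda>\<omega>. restrict (\<lambda>i. ?D i \<omega>) {k..<n})"
    by (rule indep_var_restrict) (use k in auto)
  then have "indep_var (\<Pi>\<^sub>M i\<in>{..k}. borel)
      ((\<lambda>x. \<lambda>i\<in>{..k}. \<Sum>j<i. x j :: real) \<circ> (\<lambda>\<omega>. restrict (\<lambda>i. ?D i \<omega>) {..<k}))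
      (\<Pi>\<^sub>M i\<in>{k..n}. borel)
      ((\<lambda>x. \<lambda>i\<in>{k..n}. \<Sum>j\<in>{k..<i}. x j) \<circ> (\<lambda>\<omega>. restrict (\<lambda>i. ?D i \<omega>) {k..<n}))"
    by (rule indep_var_compose)
       (auto intro!: measurable_restrict borel_measurable_sum measurable_component_singleton)
  moreover have "(\<Sum>j<i. restrict (\<lambda>i. ?D i \<omega>) {..<k} j) = W (t i) \<omega>" if "i \<le> k" for i \<omega>
  proof -
    have "(\<Sum>j<i. restrict (\<lambda>i. ?D i \<omega>) {..<k} j) = (\<Sum>j<i. ?D j \<omega>)"
      using that by (intro sum.cong) auto
    then show ?thesis
      using sum_lessThan_telescope[of "\<lambda>i. W (t i) \<omega>" i] by (simp add: t0 W_0)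
  qed
  moreover have "(\<Sum>j\<in>{k..<i}. restrict (\<lambda>i. ?D i \<omega>) {k..<n} j) = W (t i) \<omega> - W (t k) \<omega>"
    if "i \<in> {k..n}" for i \<omega>
  proof -
    have "(\<Sum>j\<in>{k..<i}. restrict (\<lambda>i. ?D i \<omega>) {k..<n} j) = (\<Sum>j\<in>{k..<i}. ?D j \<omega>)"
      using that by (intro sum.cong) auto
    then show ?thesis
      using sum_Suc_diff'[of k i "\<lambda>i. W (t i) \<omega>"] that by simp
  qed
  ultimately show ?thesis
    by (simp add: comp_def cong: restrict_cong)
qed

lemma increment_symmetric:
  assumes "0 \<le> s" "s \<le> t"
  shows "distr M borel (\<lambda>\<omega>. W t \<omega> - W s \<omega>) = distr M borel (\<lambda>\<omega>. W s \<omega> - W t \<omega>)"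
proof (cases "s = t")
  case False
  then have st: "s < t" using assms by simp
  have 1: "distributed M lborel (\<lambda>\<omega>. W t \<omega> - W s \<omega>) (\<lambda>x. ennreal (normal_density 0 (sqrt (t - s)) x))"
    using normal_increments st assms by simp
  from normal_density_affine[OF 1, of "-1" 0] st
  have 2: "distributed M lborel (\<lambda>\<omega>. W s \<omega> - W t \<omega>) (\<lambda>x. ennreal (normal_density 0 (sqrt (t - s)) x))"
    by simp
  have "distr M borel (\<lambda>\<omega>. W t \<omega> - W s \<omega>) = distr M lborel (\<lambda>\<omega>. W t \<omega> - W s \<omega>)"
    "distr M borel (\<lambda>\<omega>. W s \<omega> - W t \<omega>) = distr M lborel (\<lambda>\<omega>. W s \<omega> - W t \<omega>)"
    by (auto intro: distr_cong)
  then show ?thesis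
    using distributed_distr_eq_density[OF 1] distributed_distr_eq_density[OF 2] by simp
qed simp

text \<open>\<open>E a\<close> says that \<open>k\<close> is the first index above level
  \<open>a\<close>, which depends on the past alone. The later displacement is independent of the
  past and symmetric, so flipping its sign keeps the joint law; the flip sends
  \<open>W (t n)\<close> to its mirror image in the level \<open>W (t k)\<close>.\<close>

lemma reflect_after_first_passage:
  fixes t :: "nat \<Rightarrow> real"
  assumes t0: "t 0 = 0" and mono: "\<And>i. i < n \<Longrightarrow> t i \<le> t (Suc i)" and k: "k \<le> n"
  defines "E a \<equiv> {\<omega>\<in>space M. W (t k) \<omega> > a \<and> (\<forall>j<k. W (t j) \<omega> \<le> a)}"
  shows "prob {\<omega>\<in>E a. W (t n) \<omega> \<le> y} = prob {\<omega>\<in>E a. 2 * W (t k) \<omega> - W (t n) \<omega> \<le> y}"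
proof -
  let ?X = "\<lambda>\<omega>. \<lambda>i\<in>{..k}. W (t i) \<omega>"
  let ?S = "\<Pi>\<^sub>M i\<in>{..k}. borel :: real measure"
  have ge0: "0 \<le> t i" if "i \<le> n" for i
    using grid_mono[of n t 0 i] mono that t0 by simp
  have XR: "indep_pair ?S ?X (\<Pi>\<^sub>M i\<in>{k..n}. borel) (\<lambda>\<omega>. \<lambda>i\<in>{k..n}. W (t i) \<omega> - W (t k) \<omega>)"
    using indep_var_imp_indep_pair[OF indep_past_future] t0 mono k by blast
  have 1: "indep_pair ?S ?X borel (\<lambda>\<omega>. W (t n) \<omega> - W (t k) \<omega>)"
    using indep_pair_compose[OF XR measurable_ident measurable_component_singleton[of n]] k by simp
  have 2: "indep_pair ?S ?X borel (\<lambda>\<omega>. W (t k) \<omega> - W (t n) \<omega>)"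
    using indep_pair_compose[OF 1 measurable_ident borel_measurable_uminus[OF measurable_ident]] by simp
  have "distr M borel (\<lambda>\<omega>. W (t n) \<omega> - W (t k) \<omega>) = distr M borel (\<lambda>\<omega>. W (t k) \<omega> - W (t n) \<omega>)"
    by (rule increment_symmetric) (use ge0 k grid_mono[of n t k n] mono in auto)
  then have eq: "distr M (?S \<Otimes>\<^sub>M borel) (\<lambda>\<omega>. (?X \<omega>, W (t n) \<omega> - W (t k) \<omega>))
      = distr M (?S \<Otimes>\<^sub>M borel) (\<lambda>\<omega>. (?X \<omega>, W (t k) \<omega> - W (t n) \<omega>))"
    using 1 2 by (simp add: indep_pair_def)
  \<comment> \<open>One set serves both sides: inserting the displacement or its negative as
    \<open>snd p\<close> gives the original or the reflected event.\<close>
  let ?Z = "{p \<in> space (?S \<Otimes>\<^sub>M borel). fst p k > a \<and> (\<forall>j<k. fst p j \<le> a) \<and> fst p k + snd p \<le> y}"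
  have [measurable]: "(\<lambda>p. fst p j) \<in> borel_measurable (?S \<Otimes>\<^sub>M borel)" if "j \<le> k" for j
    using measurable_compose[OF measurable_fst[of ?S "borel :: real measure"]
        measurable_component_singleton[of j "{..k}" "\<lambda>_. borel"]] that by simp
  have Z: "?Z \<in> sets (?S \<Otimes>\<^sub>M borel)"
  proof -
    have "?Z = {p \<in> space (?S \<Otimes>\<^sub>M borel). fst p k > a} \<inter>
       {p \<in> space (?S \<Otimes>\<^sub>M borel). \<forall>j\<in>{..<k}. fst p j \<le> a} \<inter>
       {p \<in> space (?S \<Otimes>\<^sub>M borel). fst p k + snd p \<le> y}" by auto
    also have "\<dots> \<in> sets (?S \<Otimes>\<^sub>M borel)"
    proof (intro sets.Int sets.sets_Collect_finite_All)
      show "{p \<in> space (?S \<Otimes>\<^sub>M borel). fst p k > a} \<in> sets (?S \<Otimes>\<^sub>M borel)"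
        by (intro borel_measurable_less) auto
      show "{p \<in> space (?S \<Otimes>\<^sub>M borel). fst p j \<le> a} \<in> sets (?S \<Otimes>\<^sub>M borel)" if "j \<in> {..<k}" for j
        using that by (intro borel_measurable_le) auto
      show "{p \<in> space (?S \<Otimes>\<^sub>M borel). fst p k + snd p \<le> y} \<in> sets (?S \<Otimes>\<^sub>M borel)"
        by (intro borel_measurable_le borel_measurable_add) auto
    qed auto
    finally show ?thesis .
  qed
  have rv: "random_variable (?S \<Otimes>\<^sub>M borel) (\<lambda>\<omega>. (?X \<omega>, W (t n) \<omega> - W (t k) \<omega>))"
    "random_variable (?S \<Otimes>\<^sub>M borel) (\<lambda>\<omega>. (?X \<omega>, W (t k) \<omega> - W (t n) \<omega>))"
    using 1 2 by (auto simp: indep_pair_def)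
  from arg_cong[OF eq, of "\<lambda>N. measure N ?Z"]
  have "prob ((\<lambda>\<omega>. (?X \<omega>, W (t n) \<omega> - W (t k) \<omega>)) -` ?Z \<inter> space M)
     = prob ((\<lambda>\<omega>. (?X \<omega>, W (t k) \<omega> - W (t n) \<omega>)) -` ?Z \<inter> space M)"
    using rv Z by (simp add: measure_distr)
  also have "(\<lambda>\<omega>. (?X \<omega>, W (t n) \<omega> - W (t k) \<omega>)) -` ?Z \<inter> space M = {\<omega>\<in>E a. W (t n) \<omega> \<le> y}"
    by (auto simp: E_def space_pair_measure space_PiM)
  also have "(\<lambda>\<omega>. (?X \<omega>, W (t k) \<omega> - W (t n) \<omega>)) -` ?Z \<inter> space M
      = {\<omega>\<in>E a. 2 * W (t k) \<omega> - W (t n) \<omega> \<le> y}"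
    by (auto simp: E_def space_pair_measure space_PiM)
  finally show ?thesis .
qed

text \<open>On a grid the level is overshot, so reflecting in \<open>W (t k)\<close> rather than in
  \<open>a\<close> yields two inequalities. \<open>W (t k) > a\<close> gives the upper bound; if no
  single increment exceeds \<open>e\<close>, then \<open>W (t k) \<le> a + e\<close>, which gives
  the lower bound up to the probability of a large increment.\<close>

lemma discrete_reflection:
  fixes t :: "nat \<Rightarrow> real"
  assumes t0: "t 0 = 0" and mono: "\<And>i. i < n \<Longrightarrow> t i \<le> t (Suc i)" and a: "0 \<le> a" "y \<le> a"
    and e: "0 < e"
  defines "P \<equiv> prob {\<omega>\<in>space M. (\<exists>k\<le>n. W (t k) \<omega> > a) \<and> W (t n) \<omega> \<le> y}"
  shows "P \<le> prob {\<omega>\<in>space M. W (t n) \<omega> > 2 * a - y}"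
    and "prob {\<omega>\<in>space M. W (t n) \<omega> \<ge> 2 * a - y + 2 * e}
      \<le> P + prob {\<omega>\<in>space M. \<exists>k<n. W (t (Suc k)) \<omega> - W (t k) \<omega> > e}"
proof -
  have ge0: "0 \<le> t i" if "i \<le> n" for i
    using grid_mono[of n t 0 i] mono that t0 by simp
  have [measurable]: "W (t i) \<in> borel_measurable M" if "i \<le> n" for i
    using measurable_W ge0 that by simp
  define E where "E k = {\<omega>\<in>space M. W (t k) \<omega> > a \<and> (\<forall>j<k. W (t j) \<omega> \<le> a)}" for k
  have E_sets[measurable]: "E k \<in> events" if "k \<le> n" for k
  proof -
    have "E k = {\<omega>\<in>space M. W (t k) \<omega> > a} \<inter> {\<omega>\<in>space M. \<forall>j\<in>{..<k}. W (t j) \<omega> \<le> a}"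
      by (auto simp: E_def)
    also have "\<dots> \<in> events"
      using that by (intro sets.Int sets.sets_Collect_finite_All) measurable
    finally show ?thesis .
  qed
  have disj: "disjoint_family_on E {..n}"
    by (auto simp: disjoint_family_on_def E_def) (metis linorder_neqE_nat not_le)
  have sets1: "{\<omega>\<in>E k. W (t n) \<omega> \<le> y} \<in> events" if "k \<le> n" for k
  proof -
    have "{\<omega>\<in>E k. W (t n) \<omega> \<le> y} = E k \<inter> {\<omega>\<in>space M. W (t n) \<omega> \<le> y}"
      by (auto simp: E_def)
    also have "\<dots> \<in> events" using that by measurable
    finally show ?thesis .
  qed
  have sets2: "{\<omega>\<in>E k. 2 * W (t k) \<omega> - W (t n) \<omega> \<le> y} \<in> events" if "k \<le> n" for k
  proof -
    have "{\<omega>\<in>E k. 2 * W (t k) \<omega> - W (t n) \<omega> \<le> y} = E k \<inter> {\<omega>\<in>space M. 2 * W (t k) \<omega> - W (t n) \<omega> \<le> y}"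
      by (auto simp: E_def)
    also have "\<dots> \<in> events" using that by measurable
    finally show ?thesis .
  qed
  \<comment> \<open>The mirror level depends on \<open>k\<close>, so each first-passage event is
    reflected separately; the events are disjoint and their probabilities add up.\<close>
  define Z where "Z = (\<Union>k\<le>n. {\<omega>\<in>E k. 2 * W (t k) \<omega> - W (t n) \<omega> \<le> y})"
  have first: "\<exists>k\<le>n. \<omega> \<in> E k" if "\<omega> \<in> space M" "W (t k) \<omega> > a" "k \<le> n" for k \<omega>
  proof -
    define m where "m = (LEAST k. W (t k) \<omega> > a)"
    have "W (t m) \<omega> > a" unfolding m_def by (rule LeastI) fact
    moreover have "m \<le> k" unfolding m_def by (rule Least_le) fact
    moreover have "W (t j) \<omega> \<le> a" if "j < m" for j
      using not_less_Least[of j "\<lambda>k. W (t k) \<omega> > a"] that by (simp add: m_def)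
    ultimately show ?thesis using that by (intro exI[of _ m]) (auto simp: E_def)
  qed
  have "{\<omega>\<in>space M. (\<exists>k\<le>n. W (t k) \<omega> > a) \<and> W (t n) \<omega> \<le> y} = (\<Union>k\<le>n. {\<omega>\<in>E k. W (t n) \<omega> \<le> y})"
  proof safe
    fix \<omega> k assume "\<omega> \<in> space M" "W (t n) \<omega> \<le> y" "k \<le> n" "W (t k) \<omega> > a"
    then show "\<omega> \<in> (\<Union>k\<le>n. {\<omega>\<in>E k. W (t n) \<omega> \<le> y})" using first[of \<omega> k] by auto
  qed (auto simp: E_def)
  then have "P = prob (\<Union>k\<le>n. {\<omega>\<in>E k. W (t n) \<omega> \<le> y})" by (simp add: P_def)
  also have "\<dots> = (\<Sum>k\<le>n. prob {\<omega>\<in>E k. W (t n) \<omega> \<le> y})"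
    using sets1 disj by (intro finite_measure_finite_Union) (auto simp: disjoint_family_on_def)
  also have "\<dots> = (\<Sum>k\<le>n. prob {\<omega>\<in>E k. 2 * W (t k) \<omega> - W (t n) \<omega> \<le> y})"
    unfolding E_def using t0 mono by (intro sum.cong reflect_after_first_passage) auto
  also have "\<dots> = prob Z"
    unfolding Z_def using sets2 disj
    by (intro finite_measure_finite_Union[symmetric]) (auto simp: disjoint_family_on_def)
  finally have PZ: "P = prob Z" .
  have Z_sets[measurable]: "Z \<in> events"
    unfolding Z_def using sets2 by auto
  show "P \<le> prob {\<omega>\<in>space M. W (t n) \<omega> > 2 * a - y}"
    unfolding PZ by (rule finite_measure_mono) (auto simp: Z_def E_def)
  have J: "{\<omega>\<in>space M. \<exists>k\<in>{..<n}. W (t (Suc k)) \<omega> - W (t k) \<omega> > e} \<in> events"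
    by (intro sets.sets_Collect_finite_Ex) auto
  have "{\<omega>\<in>space M. W (t n) \<omega> \<ge> 2 * a - y + 2 * e} \<subseteq>
     Z \<union> {\<omega>\<in>space M. \<exists>k\<in>{..<n}. W (t (Suc k)) \<omega> - W (t k) \<omega> > e}"
  proof
    fix \<omega> assume *: "\<omega> \<in> {\<omega>\<in>space M. W (t n) \<omega> \<ge> 2 * a - y + 2 * e}"
    then have "W (t n) \<omega> > a" using a e by simp
    then obtain k where k: "k \<le> n" "\<omega> \<in> E k" using first[of \<omega> n] * by auto
    show "\<omega> \<in> Z \<union> {\<omega>\<in>space M. \<exists>k\<in>{..<n}. W (t (Suc k)) \<omega> - W (t k) \<omega> > e}"
    proof (cases "\<exists>k\<in>{..<n}. W (t (Suc k)) \<omega> - W (t k) \<omega> > e")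
      case False
      \<comment> \<open>The walk starts at 0, which is not above \<open>a\<close>. Hence the first
        passage has a predecessor \<open>j\<close>, and the overshoot is at most the increment from
        \<open>j\<close> to \<open>k\<close>.\<close>
      have "k \<noteq> 0" using k a by (intro notI) (simp add: E_def t0 W_0)
      then obtain j where j: "k = Suc j" by (cases k) auto
      have "W (t j) \<omega> \<le> a" using k j by (auto simp: E_def)
      moreover have "W (t (Suc j)) \<omega> - W (t j) \<omega> \<le> e"
        using False k(1) j by (simp add: not_less)
      ultimately have "2 * W (t k) \<omega> - W (t n) \<omega> \<le> y" using * j by auto
      then show ?thesis using k by (auto simp: Z_def)
    qed (use * in auto)
  qed
  then have "prob {\<omega>\<in>space M. W (t n) \<omega> \<ge> 2 * a - y + 2 * e} \<le>
    prob (Z \<union> {\<omega>\<in>space M. \<exists>k\<in>{..<n}. W (t (Suc k)) \<omega> - W (t k) \<omega> > e})"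
    using J by (intro finite_measure_mono) auto
  also have "\<dots> \<le> prob Z + prob {\<omega>\<in>space M. \<exists>k\<in>{..<n}. W (t (Suc k)) \<omega> - W (t k) \<omega> > e}"
    using J by (intro measure_Un_le) auto
  finally show "prob {\<omega>\<in>space M. W (t n) \<omega> \<ge> 2 * a - y + 2 * e}
      \<le> P + prob {\<omega>\<in>space M. \<exists>k<n. W (t (Suc k)) \<omega> - W (t k) \<omega> > e}"
    by (simp add: PZ Bex_def)
qed

end

subsection \<open>The reflection principle\<close>

definition running_max :: "(real \<Rightarrow> real) \<Rightarrow> real \<Rightarrow> real \<Rightarrow> real" where
  "running_max x s t = (SUP r\<in>{s..t}. x r)"

definition dyadic :: "real \<Rightarrow> real \<Rightarrow> nat \<Rightarrow> nat \<Rightarrow> real" where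
  "dyadic s t n k = s + (t - s) * (real k / 2 ^ n)"

lemma running_max_upper:
  assumes "continuous_on {s..t} x" "r \<in> {s..t}"
  shows "x r \<le> running_max x s t"
proof -
  have "bdd_above (x ` {s..t})"
    by (intro compact_imp_bounded bounded_imp_bdd_above compact_continuous_image assms) simp
  then show ?thesis
    unfolding running_max_def using assms by (intro cSUP_upper)
qed

lemma running_max_le_iff:
  assumes "continuous_on {s..t} x" "s \<le> t"
  shows "running_max x s t \<le> a \<longleftrightarrow> (\<forall>r\<in>{s..t}. x r \<le> a)"
proof
  show "running_max x s t \<le> a \<Longrightarrow> \<forall>r\<in>{s..t}. x r \<le> a"
    using running_max_upper[OF assms(1)] order_trans by blast
next
  show "\<forall>r\<in>{s..t}. x r \<le> a \<Longrightarrow> running_max x s t \<le> a"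
    unfolding running_max_def using assms(2) by (intro cSUP_least) auto
qed

lemma running_max_attained:
  assumes "continuous_on {s..t} x" "s \<le> t"
  obtains r where "r \<in> {s..t}" "running_max x s t = x r"
proof -
  obtain r where "r \<in> {s..t}" "\<And>u. u \<in> {s..t} \<Longrightarrow> x u \<le> x r"
    using continuous_attains_sup[of "{s..t}" x] assms by auto
  moreover from this have "running_max x s t = x r"
    using running_max_upper[OF assms(1), of r] running_max_le_iff[OF assms, of "x r"] by auto
  ultimately show ?thesis using that by blast
qed

lemma running_max_split:
  assumes "continuous_on {s..u} x" "s \<le> t" "t \<le> u"
  shows "running_max x s u = max (running_max x s t) (running_max x t u)"
proof -
  have c: "continuous_on {s..t} x" "continuous_on {t..u} x"
    using assms by (auto intro: continuous_on_subset)
  have "running_max x s u \<le> a \<longleftrightarrow> max (running_max x s t) (running_max x t u) \<le> a" for a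
    using assms c by (auto simp: running_max_le_iff)
  then show ?thesis by (meson order_antisym order_refl)
qed

lemma running_max_subset:
  assumes "continuous_on {s..u} x" "s \<le> t" "t \<le> u"
  shows "running_max x s t \<le> running_max x s u"
  using running_max_split[OF assms] by simp

text \<open>A weak inequality passes from a set to its closure by continuity, so countably many
  times decide the event. \<open>Q\<close> will be a union of dyadic grids or a set of
  rationals.\<close>

lemma running_max_le_iff_closure:
  assumes "continuous_on {s..t} x" "s \<le> t" "closure Q = {s..t}"
  shows "running_max x s t \<le> a \<longleftrightarrow> (\<forall>q\<in>Q. x q \<le> a)"
  unfolding running_max_le_iff[OF assms(1,2)]
  using continuous_le_on_closure[of Q x _ a] closure_subset[of Q] assms by (auto simp: subset_iff)

text \<open>Leaving out the endpoints keeps the rational times strictly inside the interval, as the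
  finite-dimensional laws of the bridge require.\<close>

lemma closure_rat_Ioo:
  fixes s t :: real
  assumes "s < t"
  shows "closure (\<rat> \<inter> {s<..<t}) = {s..t}"
  using closure_open_Int_superset[of "{s<..<t}" \<rat>] assms
  by (simp add: Rats_closure_real Int_commute)

lemma dyadic_0: "dyadic s t n 0 = s"
  and dyadic_last: "dyadic s t n (2 ^ n) = t"
  by (simp_all add: dyadic_def)

lemma dyadic_Suc_le: "s \<le> t \<Longrightarrow> dyadic s t n k \<le> dyadic s t n (Suc k)"
  by (simp add: dyadic_def mult_left_mono divide_right_mono)

lemma dyadic_in:
  assumes "s \<le> t" "k \<le> 2 ^ n"
  shows "dyadic s t n k \<in> {s..t}"
proof -
  have "real k / 2 ^ n \<le> 1"
    using of_nat_mono[OF assms(2), where 'a=real] by simp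
  then have "(t - s) * (real k / 2 ^ n) \<le> (t - s) * 1"
    using assms(1) by (intro mult_left_mono) auto
  then show ?thesis using assms(1) by (auto simp: dyadic_def)
qed

lemma dyadic_near:
  assumes "s \<le> t" "r \<in> {s..t}"
  obtains k where "k \<le> 2 ^ n" "\<bar>dyadic s t n k - r\<bar> \<le> (t - s) / 2 ^ n"
proof (cases "s = t")
  case True
  with assms show ?thesis by (intro that[of 0]) (auto simp: dyadic_def)
next
  case False
  define u where "u = (r - s) / (t - s) * 2 ^ n"
  have u: "0 \<le> u" "u \<le> 2 ^ n" using assms False by (auto simp: u_def field_simps)
  define k where "k = nat \<lfloor>u\<rfloor>"
  have k: "real k \<le> u" "u < real k + 1"
    unfolding k_def using u by linarith+
  have "real k \<le> 2 ^ n" using k u by linarith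
  then have "k \<le> 2 ^ n" by (metis of_nat_le_iff of_nat_numeral of_nat_power)
  moreover have "dyadic s t n k - r = (t - s) / 2 ^ n * (real k - u)"
    using False by (simp add: dyadic_def u_def field_simps)
  then have "\<bar>dyadic s t n k - r\<bar> \<le> (t - s) / 2 ^ n * 1"
    using k assms(1) by (simp only: abs_mult) (intro mult_mono, auto)
  ultimately show ?thesis using that by simp
qed

lemma closure_dyadic:
  assumes "s \<le> t"
  shows "closure (\<Union>n. dyadic s t n ` {..2 ^ n}) = {s..t}"
proof
  show "closure (\<Union>n. dyadic s t n ` {..2 ^ n}) \<subseteq> {s..t}"
    using dyadic_in[OF assms] by (intro closure_minimal) auto
  show "{s..t} \<subseteq> closure (\<Union>n. dyadic s t n ` {..2 ^ n})"
  proof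
    fix r assume r: "r \<in> {s..t}"
    have lim: "(\<lambda>n. (t - s) / 2 ^ n) \<longlonglongrightarrow> 0"
        by (rule LIMSEQ_divide_realpow_zero) simp
    show "r \<in> closure (\<Union>n. dyadic s t n ` {..2 ^ n})"
      unfolding closure_approachable
    proof safe
      fix e :: real assume "0 < e"
      then obtain n where "(t - s) / 2 ^ n < e"
        using lim order_tendstoD(2)[OF lim] by (meson eventually_sequentially order_refl)
      moreover obtain k where "k \<le> 2 ^ n" "\<bar>dyadic s t n k - r\<bar> \<le> (t - s) / 2 ^ n"
        using dyadic_near[OF assms r] by blast
      ultimately show "\<exists>y\<in>\<Union>n. dyadic s t n ` {..2 ^ n}. dist y r < e"
        by (intro bexI[of _ "dyadic s t n k"]) (auto simp: dist_real_def)
    qed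
  qed
qed

lemma dyadic_refine: "dyadic s t n k = dyadic s t (n + m) (k * 2 ^ m)"
  by (simp add: dyadic_def power_add)

text \<open>Dyadic grids are nested, so events asking for some grid point with a property increase
  with the level and those asking it of all grid points decrease.\<close>

lemma dyadic_mono_ex:
  assumes "n \<le> m" "k \<le> 2 ^ n" "P (dyadic s t n k)"
  shows "\<exists>j\<le>2 ^ m. P (dyadic s t m j)"
proof -
  obtain d where d: "m = n + d" using assms(1) le_Suc_ex by blast
  have "k * 2 ^ d \<le> 2 ^ m" using assms(2) by (simp add: d power_add)
  then show ?thesis
    using assms(3) dyadic_refine[of s t n k d] d by auto
qed

text \<open>The uncountable supremum is controlled by the dyadic times. The degenerate case
  \<open>s = t\<close> is included.\<close>

lemma measurable_running_max:
  assumes c: "\<And>\<omega>. continuous_on {s..t} (\<lambda>r. X r \<omega>)" and st: "s \<le> t"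
    and m: "\<And>r. r \<in> {s..t} \<Longrightarrow> X r \<in> borel_measurable M"
  shows "(\<lambda>\<omega>. running_max (\<lambda>r. X r \<omega>) s t) \<in> borel_measurable M"
proof (rule borel_measurableI_le)
  fix a
  let ?Q = "\<Union>n. dyadic s t n ` {..2 ^ n}"
  have Q: "?Q \<subseteq> {s..t}" using closure_dyadic[OF st] closure_subset[of ?Q] by simp
  have "{\<omega> \<in> space M. running_max (\<lambda>r. X r \<omega>) s t \<le> a} = {\<omega> \<in> space M. \<forall>q\<in>?Q. X q \<omega> \<le> a}"
    using running_max_le_iff_closure[OF c st closure_dyadic[OF st]] by simp
  also have "\<dots> \<in> sets M"
  proof (rule sets.sets_Collect_countable_All'[rotated])
    show "countable ?Q" by auto
    fix q assume "q \<in> ?Q"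
    then have "X q \<in> borel_measurable M" using Q m by blast
    then show "{\<omega> \<in> space M. X q \<omega> \<le> a} \<in> sets M" by measurable
  qed
  finally show "{\<omega> \<in> space M. running_max (\<lambda>r. X r \<omega>) s t \<le> a} \<in> sets M" .
qed

section \<open>From dyadic grids to continuous time\<close>

context continuous_brownian
begin

abbreviation "max_W s t \<omega> \<equiv> running_max (\<lambda>r. W r \<omega>) s t"

lemma continuous_path: "0 \<le> s \<Longrightarrow> continuous_on {s..t} (\<lambda>t. W t \<omega>)"
  using continuous_W by (rule continuous_on_subset) auto

lemma measurable_max[measurable]:
  "0 \<le> s \<Longrightarrow> s \<le> t \<Longrightarrow> (\<lambda>\<omega>. max_W s t \<omega>) \<in> borel_measurable M"
  by (rule measurable_running_max) (auto intro: continuous_path measurable_W)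

text \<open>Each path is uniformly continuous on \<open>{0..t}\<close>, so the bad event excludes
  any given \<open>\<omega>\<close> from some level on; dominated convergence then applies to the
  indicators.\<close>

lemma dyadic_increments_small:
  assumes "0 \<le> t" "0 < e"
  shows "(\<lambda>n. prob {\<omega>\<in>space M. \<exists>k<2 ^ n. W (dyadic 0 t n (Suc k)) \<omega> - W (dyadic 0 t n k) \<omega> > e}) \<longlonglongrightarrow> 0"
proof -
  let ?B = "\<lambda>n. {\<omega>\<in>space M. \<exists>k\<in>{..<2 ^ n}. W (dyadic 0 t n (Suc k)) \<omega> - W (dyadic 0 t n k) \<omega> > e}"
  have B: "?B n \<in> events" for n
  proof (rule sets.sets_Collect_finite_Ex)
    fix k :: nat assume "k \<in> {..<2 ^ n}"
    then have "0 \<le> dyadic 0 t n k" "0 \<le> dyadic 0 t n (Suc k)"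
      using dyadic_in[of 0 t] assms by auto
    then show "{\<omega>\<in>space M. W (dyadic 0 t n (Suc k)) \<omega> - W (dyadic 0 t n k) \<omega> > e} \<in> events"
      by (intro borel_measurable_less borel_measurable_diff measurable_W) auto
  qed simp
  have "(\<lambda>n. \<integral>\<omega>. indicator (?B n) \<omega> \<partial>M) \<longlonglongrightarrow> (\<integral>\<omega>. (0::real) \<partial>M)"
  proof (rule integral_dominated_convergence[where w = "\<lambda>_. 1"])
    show "AE \<omega> in M. (\<lambda>n. indicator (?B n) \<omega> :: real) \<longlonglongrightarrow> 0"
    proof (rule AE_I2)
      fix \<omega>
      have "uniformly_continuous_on {0..t} (\<lambda>t. W t \<omega>)"
        by (intro compact_uniformly_continuous continuous_path) auto
      then obtain d where d: "d > 0" "\<And>x y. x \<in> {0..t} \<Longrightarrow> y \<in> {0..t} \<Longrightarrow> dist y x < d \<Longrightarrow> dist (W y \<omega>) (W x \<omega>) < e"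
        using assms(2) by (rule uniformly_continuous_onE) (use that in blast)
      have "(\<lambda>n. t / 2 ^ n) \<longlonglongrightarrow> 0"
        by (rule LIMSEQ_divide_realpow_zero) simp
      then have "eventually (\<lambda>n. t / 2 ^ n < d) sequentially"
        using d(1) by (rule order_tendstoD)
      then have "eventually (\<lambda>n. indicator (?B n) \<omega> = (0::real)) sequentially"
      proof eventually_elim
        case (elim n)
        have "W (dyadic 0 t n (Suc k)) \<omega> - W (dyadic 0 t n k) \<omega> \<le> e" if "k < 2 ^ n" for k
        proof -
          have "dyadic 0 t n (Suc k) - dyadic 0 t n k = t / 2 ^ n"
            by (simp add: dyadic_def field_simps)
          then have "dist (dyadic 0 t n (Suc k)) (dyadic 0 t n k) < d"
            using elim assms(1) by (simp add: dist_real_def)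
          then have "dist (W (dyadic 0 t n (Suc k)) \<omega>) (W (dyadic 0 t n k) \<omega>) < e"
            using that assms(1) by (intro d dyadic_in) auto
          then show ?thesis by (simp add: dist_real_def)
        qed
        then have "\<omega> \<notin> ?B n" by (auto simp: not_less)
        then show ?case by simp
      qed
      then show "(\<lambda>n. indicator (?B n) \<omega> :: real) \<longlonglongrightarrow> 0"
        by (rule tendsto_eventually)
    qed
    show "(\<lambda>\<omega>. indicator (?B n) \<omega> :: real) \<in> borel_measurable M" for n
      using B by (rule borel_measurable_indicator)
    show "AE \<omega> in M. norm (indicator (?B n) \<omega> :: real) \<le> 1" for n
      by (rule AE_I2) (simp add: indicator_def)
  qed simp_all
  moreover have "(\<integral>\<omega>. indicator (?B n) \<omega> \<partial>M) = prob (?B n)" for n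
    using B[of n] sets.sets_into_space[OF B] by (simp add: Int_absorb2)
  ultimately have "(\<lambda>n. prob (?B n)) \<longlonglongrightarrow> 0"
    by (simp only: integral_zero)
  then show ?thesis by (simp only: Bex_def lessThan_iff)
qed

text \<open>The grid is refined first with \<open>e\<close> fixed, which kills the probability of a
  large increment, and only then does \<open>e\<close> tend to 0. A maximum above \<open>a\<close>
  is already seen at some dyadic time, since the inequality is strict.\<close>

theorem reflection_principle:
  assumes t: "0 \<le> t" and a: "0 \<le> a" "y \<le> a"
  shows "prob {\<omega>\<in>space M. max_W 0 t \<omega> > a \<and> W t \<omega> \<le> y}
    = prob {\<omega>\<in>space M. W t \<omega> > 2 * a - y}"
proof -
  let ?A = "\<lambda>n. {\<omega>\<in>space M. (\<exists>k\<le>2 ^ n. W (dyadic 0 t n k) \<omega> > a) \<and> W t \<omega> \<le> y}"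
  let ?R = "\<lambda>e. {\<omega>\<in>space M. W t \<omega> \<ge> 2 * a - y + 2 * e}"
  let ?L = "prob {\<omega>\<in>space M. max_W 0 t \<omega> > a \<and> W t \<omega> \<le> y}"
  note [measurable] = measurable_W[OF t]
  have d0: "0 \<le> dyadic 0 t n k" if "k \<le> 2 ^ n" for n k
    using dyadic_in[OF t that] by simp
  have A: "?A n \<in> events" for n
  proof -
    have "?A n = {\<omega>\<in>space M. \<exists>k\<in>{..2 ^ n}. W (dyadic 0 t n k) \<omega> > a} \<inter> {\<omega>\<in>space M. W t \<omega> \<le> y}"
      by auto
    also have "\<dots> \<in> events"
      using d0 by (intro sets.Int sets.sets_Collect_finite_Ex borel_measurable_less measurable_W) auto
    finally show ?thesis .
  qed
  have inc: "incseq ?A"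
  proof (unfold incseq_def, safe)
    fix n m k :: nat and \<omega> assume "n \<le> m" "k \<le> 2 ^ n" "W (dyadic 0 t n k) \<omega> > a"
    then show "\<exists>j\<le>2 ^ m. W (dyadic 0 t m j) \<omega> > a"
      by (rule dyadic_mono_ex)
  qed
  have Un: "(\<Union>n. ?A n) = {\<omega>\<in>space M. max_W 0 t \<omega> > a \<and> W t \<omega> \<le> y}"
  proof -
    have "max_W 0 t \<omega> > a \<longleftrightarrow> (\<exists>n. \<exists>k\<le>2 ^ n. W (dyadic 0 t n k) \<omega> > a)" for \<omega>
      using running_max_le_iff_closure[OF continuous_path[of 0 t \<omega>] t closure_dyadic[OF t], of a]
      by (auto simp: not_le[symmetric])
    then show ?thesis by auto
  qed
  have lim: "(\<lambda>n. prob (?A n)) \<longlonglongrightarrow> ?L"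
    unfolding Un[symmetric] by (rule finite_Lim_measure_incseq[OF _ inc]) (use A in blast)
  have disc1: "prob (?A n) \<le> prob {\<omega>\<in>space M. W t \<omega> > 2 * a - y}" for n
    using discrete_reflection(1)[of "dyadic 0 t n" "2 ^ n" a y 1, OF dyadic_0 dyadic_Suc_le[OF t] a zero_less_one]
    by (simp only: dyadic_last)
  have disc2: "prob (?R e) \<le> prob (?A n) +
       prob {\<omega>\<in>space M. \<exists>k<2 ^ n. W (dyadic 0 t n (Suc k)) \<omega> - W (dyadic 0 t n k) \<omega> > e}" if "e > 0" for n e
    using discrete_reflection(2)[of "dyadic 0 t n" "2 ^ n" a y e, OF dyadic_0 dyadic_Suc_le[OF t] a that]
    by (simp only: dyadic_last)
  have upper: "?L \<le> prob {\<omega>\<in>space M. W t \<omega> > 2 * a - y}"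
    using disc1 by (intro LIMSEQ_le_const2[OF lim]) auto
  have lower: "prob (?R e) \<le> ?L" if "e > 0" for e
  proof -
    have "(\<lambda>n. prob (?A n) + prob {\<omega>\<in>space M. \<exists>k<2 ^ n. W (dyadic 0 t n (Suc k)) \<omega> - W (dyadic 0 t n k) \<omega> > e}) \<longlonglongrightarrow> ?L + 0"
      by (intro tendsto_add lim dyadic_increments_small t that)
    then have "prob (?R e) \<le> ?L + 0"
      by (rule LIMSEQ_le_const) (use disc2[OF that] in blast)
    then show ?thesis by simp
  qed
  \<comment> \<open>The weak thresholds \<open>2 * a - y + 2 * e\<close> increase, as
    \<open>e\<close> decreases to 0, exactly to the strict event, so the lower bound meets the upper
    one.\<close>
  have "(\<lambda>n. prob (?R (inverse (real (Suc n))))) \<longlonglongrightarrow> prob (\<Union>n. ?R (inverse (real (Suc n))))"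
  proof (rule finite_Lim_measure_incseq)
    show "incseq (\<lambda>n. ?R (inverse (real (Suc n))))"
    proof (rule incseq_SucI, safe)
      fix n \<omega> assume "2 * a - y + 2 * inverse (real (Suc n)) \<le> W t \<omega>"
      moreover have "inverse (real (Suc (Suc n))) \<le> inverse (real (Suc n))"
        by (intro le_imp_inverse_le) auto
      ultimately show "2 * a - y + 2 * inverse (real (Suc (Suc n))) \<le> W t \<omega>" by linarith
    qed
  qed (auto simp: image_subset_iff)
  also have "(\<Union>n. ?R (inverse (real (Suc n)))) = {\<omega>\<in>space M. W t \<omega> > 2 * a - y}"
  proof safe
    fix \<omega> assume "2 * a - y < W t \<omega>" "\<omega> \<in> space M"
    then obtain n where "inverse (real (Suc n)) < (W t \<omega> - (2 * a - y)) / 2"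
      using reals_Archimedean[of "(W t \<omega> - (2 * a - y)) / 2"] by auto
    then show "\<omega> \<in> (\<Union>n. ?R (inverse (real (Suc n))))"
      using \<open>\<omega> \<in> space M\<close> by (auto intro!: exI[of _ n])
  next
    fix \<omega> n assume "2 * a - y + 2 * inverse (real (Suc n)) \<le> W t \<omega>"
    then show "2 * a - y < W t \<omega>"
      using positive_imp_inverse_positive[of "real (Suc n)"] by linarith
  qed
  finally have "prob {\<omega>\<in>space M. W t \<omega> > 2 * a - y} \<le> ?L"
    using lower by (intro LIMSEQ_le_const2) auto
  with upper show ?thesis by simp
qed

end

subsection \<open>Joint law of the maximum and the endpoint\<close>

abbreviation heat :: "real \<Rightarrow> real \<Rightarrow> real" where
  "heat t \<equiv> normal_density 0 (sqrt t)"

text \<open>Joint density of the maximum over \<open>[0, t]\<close> (first argument) and the value at \<open>t\<close> (second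
  argument) of a Brownian motion started at \<open>0\<close>.\<close>

definition max_end_density :: "real \<Rightarrow> real \<Rightarrow> real \<Rightarrow> real" where
  "max_end_density t m x =
     (if 0 \<le> m \<and> x \<le> m then 2 * (2 * m - x) / t * heat t (2 * m - x) else 0)"

lemma measurable_max_end_density[measurable]:
  "(\<lambda>p. max_end_density t (fst p) (snd p)) \<in> borel_measurable borel"
  "(\<lambda>p. max_end_density t (fst p) (snd p)) \<in> borel_measurable (borel \<Otimes>\<^sub>M borel)"
  "(\<lambda>m. max_end_density t m x) \<in> borel_measurable borel"
  "(\<lambda>x. max_end_density t m x) \<in> borel_measurable borel"
proof -
  show *: "(\<lambda>p. max_end_density t (fst p) (snd p)) \<in> borel_measurable (borel \<Otimes>\<^sub>M borel)"
    unfolding max_end_density_def by measurable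
  then show "(\<lambda>p. max_end_density t (fst p) (snd p)) \<in> borel_measurable borel"
    by (simp add: borel_prod)
qed (unfold max_end_density_def, measurable)

lemma heat_eq: "0 < t \<Longrightarrow> heat t x = exp (- x\<^sup>2 / (2 * t)) / sqrt (2 * pi * t)"
  by (simp add: normal_density_def)

lemma heat_minus: "heat t (- x) = heat t x"
  by (simp add: normal_density_def)

lemma heat_antimono: "\<bar>x\<bar> \<le> \<bar>y\<bar> \<Longrightarrow> heat t y \<le> heat t x"
  by (cases "t = 0") (auto simp: normal_density_def divide_right_mono abs_le_square_iff
      intro!: mult_left_mono)

lemma DERIV_heat:
  assumes "0 < t"
  shows "(heat t has_real_derivative - (x / t) * heat t x) (at x)"
proof -
  have "((\<lambda>x. exp (- x\<^sup>2 / (2 * t)) / sqrt (2 * pi * t)) has_real_derivative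
      - (x / t) * (exp (- x\<^sup>2 / (2 * t)) / sqrt (2 * pi * t))) (at x)"
    using assms by (auto intro!: derivative_eq_intros simp: field_simps)
  then show ?thesis
    by (simp only: heat_eq[OF assms, abs_def])
qed

text \<open>The integrand is the \<open>m\<close>-derivative of \<open>- heat t (2 * m - x)\<close>.
  The lower limit is \<open>max 0 x\<close>, where \<open>2 * m - x\<close> is \<open>x\<close> or
  \<open>- x\<close>, so evenness leaves \<open>heat t x\<close> in both cases. The result is the
  heat kernel killed at level \<open>a\<close>, given by the method of images.\<close>

lemma integral_max_end_density:
  assumes t: "0 < t"
  shows "(\<integral>\<^sup>+m. ennreal (max_end_density t m x) * indicator {..a} m \<partial>lborel)
    = ennreal (if 0 \<le> a \<and> x \<le> a then heat t x - heat t (2 * a - x) else 0)"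
proof (cases "0 \<le> a \<and> x \<le> a")
  case True
  have "(\<integral>\<^sup>+m. ennreal (max_end_density t m x) * indicator {..a} m \<partial>lborel)
    = (\<integral>\<^sup>+m. ennreal (2 * (2 * m - x) / t * heat t (2 * m - x)) * indicator {max 0 x..a} m \<partial>lborel)"
    by (intro nn_integral_cong) (auto simp: max_end_density_def indicator_def)
  also have "\<dots> = (- heat t (2 * a - x)) - (- heat t (2 * max 0 x - x))"
  proof (rule nn_integral_FTC_Icc)
    fix m assume "m \<in> {max 0 x..a}"
    show "((\<lambda>m. - heat t (2 * m - x)) has_real_derivative
        2 * (2 * m - x) / t * heat t (2 * m - x)) (at m)"
      using t by (auto intro!: derivative_eq_intros DERIV_chain2[OF DERIV_heat] simp: field_simps)
    show "0 \<le> 2 * (2 * m - x) / t * heat t (2 * m - x)"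
      using t \<open>m \<in> {max 0 x..a}\<close> by auto
  qed (use True in auto)
  also have "heat t (2 * max 0 x - x) = heat t x"
    using heat_minus[of t x] by (auto simp: max_def)
  finally show ?thesis using True by simp
next
  case False
  then have "(\<lambda>m. ennreal (max_end_density t m x) * indicator {..a} m) = (\<lambda>m. 0)"
    by (auto simp: max_end_density_def indicator_def fun_eq_iff)
  then show ?thesis using False by (simp only: if_False nn_integral_const) simp
qed

context continuous_brownian
begin

lemma distributed_W: "0 < t \<Longrightarrow> distributed M lborel (W t) (\<lambda>x. ennreal (heat t x))"
  using normal_increments[of 0 t] by (simp add: W_0)

lemma emeasure_W:
  assumes "0 < t" "S \<in> sets borel"
  shows "emeasure M {\<omega>\<in>space M. W t \<omega> \<in> S} = (\<integral>\<^sup>+x. ennreal (heat t x) * indicator S x \<partial>lborel)"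
  using distributed_emeasure[OF distributed_W[OF assms(1)], of S] assms(2)
  by (simp add: vimage_def Int_def conj_commute)

text \<open>Both sides are compared on lower orthants. The killed kernel is a Gaussian density minus
  its mirror image, and the reflection principle identifies the mass of the mirror image with the
  probability of having crossed the level.\<close>

lemma max_end_law:
  assumes t: "0 < t"
  shows "distr M borel (\<lambda>\<omega>. (max_W 0 t \<omega>, W t \<omega>))
    = density lborel (\<lambda>p. ennreal (max_end_density t (fst p) (snd p)))" (is "distr M borel ?X = ?D")
proof (rule finite_borel_measure_eqI_atMost)
  have [measurable]: "W t \<in> borel_measurable M" using t by (intro measurable_W) simp
  have [measurable]: "(\<lambda>\<omega>. max_W 0 t \<omega>) \<in> borel_measurable M"
    using t by (intro measurable_max) simp_all
  have X[measurable]: "?X \<in> borel_measurable M"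
    unfolding borel_prod[symmetric] by measurable
  show "finite_measure (distr M borel ?X)"
    by (intro finite_measure_distr X)
  fix p :: "real \<times> real"
  obtain a y where p: "p = (a, y)" by (cases p)
  \<comment> \<open>The endpoint never exceeds the maximum, so replacing \<open>y\<close> by
    \<open>z\<close> leaves the event unchanged and secures \<open>z \<le> a\<close>, as reflection
    requires.\<close>
  define z where "z = min a y"
  have "emeasure (distr M borel ?X) {..p} = emeasure M {\<omega>\<in>space M. max_W 0 t \<omega> \<le> a \<and> W t \<omega> \<le> y}"
    by (subst emeasure_distr) (auto simp: p intro!: arg_cong[where f="emeasure M"])
  also have "\<dots> = emeasure M {\<omega>\<in>space M. max_W 0 t \<omega> \<le> a \<and> W t \<omega> \<le> z}"
    using order_trans[OF running_max_upper[OF continuous_path, of 0 t t]] t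
    by (intro arg_cong[where f="emeasure M"]) (auto simp: z_def)
  finally have L: "emeasure (distr M borel ?X) {..p} =
    prob {\<omega>\<in>space M. max_W 0 t \<omega> \<le> a \<and> W t \<omega> \<le> z}"
    by (simp add: emeasure_eq_measure)
  have "emeasure ?D {..p} = (\<integral>\<^sup>+q. ennreal (max_end_density t (fst q) (snd q)) * indicator {..p} q \<partial>lborel)"
    by (rule emeasure_density) auto
  also have "\<dots> = (\<integral>\<^sup>+q. ennreal (max_end_density t (fst q) (snd q)) * indicator ({..a} \<times> {..y}) q \<partial>(lborel \<Otimes>\<^sub>M lborel))"
    by (simp only: lborel_prod p atMost_Pair)
  also have "\<dots> = (\<integral>\<^sup>+x. \<integral>\<^sup>+m. ennreal (max_end_density t m x) * indicator ({..a} \<times> {..y}) (m, x) \<partial>lborel \<partial>lborel)"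
    by (subst lborel_pair.nn_integral_snd[symmetric]) auto
  also have "\<dots> = (\<integral>\<^sup>+x. (\<integral>\<^sup>+m. ennreal (max_end_density t m x) * indicator {..a} m \<partial>lborel) * indicator {..y} x \<partial>lborel)"
    by (intro nn_integral_cong, subst nn_integral_multc[symmetric])
       (auto simp: indicator_def intro!: nn_integral_cong)
  also have "\<dots> = (\<integral>\<^sup>+x. ennreal (if 0 \<le> a \<and> x \<le> a then heat t x - heat t (2 * a - x) else 0) * indicator {..y} x \<partial>lborel)"
    by (simp add: integral_max_end_density[OF t])
  finally have R: "emeasure ?D {..p} = \<dots>" .
  show "emeasure (distr M borel ?X) {..p} = emeasure ?D {..p}"
  proof (cases "0 \<le> a")
    case False
    have none: "{\<omega>\<in>space M. max_W 0 t \<omega> \<le> a \<and> W t \<omega> \<le> z} = {}"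
      using order_trans[OF running_max_upper[OF continuous_path, of 0 0 t]] t False by (auto simp: W_0)
    show ?thesis unfolding L R none using False by simp
  next
    case True
    let ?I = "\<integral>\<^sup>+x. ennreal (heat t x - heat t (2 * a - x)) * indicator {..z} x \<partial>lborel"
    let ?J = "\<integral>\<^sup>+x. ennreal (heat t (2 * a - x)) * indicator {..z} x \<partial>lborel"
    have za: "z \<le> a" by (simp add: z_def)
    have R': "emeasure ?D {..p} = ?I"
      unfolding R by (intro nn_integral_cong) (use True in \<open>auto simp: z_def indicator_def\<close>)
    \<comment> \<open>Subtraction in \<open>ennreal\<close> is avoided: the mirror term
      \<open>?J\<close> is added to both sides and cancelled at the end, being finite.\<close>
    have "?I + ?J = (\<integral>\<^sup>+x. ennreal (heat t x - heat t (2 * a - x)) * indicator {..z} x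
        + ennreal (heat t (2 * a - x)) * indicator {..z} x \<partial>lborel)"
      by (rule nn_integral_add[symmetric]) auto
    also have "\<dots> = (\<integral>\<^sup>+x. ennreal (heat t x) * indicator {..z} x \<partial>lborel)"
    proof (intro nn_integral_cong)
      fix x
      show "ennreal (heat t x - heat t (2 * a - x)) * indicator {..z} x
        + ennreal (heat t (2 * a - x)) * indicator {..z} x = ennreal (heat t x) * indicator {..z} x"
        using heat_antimono[of x "2 * a - x" t] True za
        by (auto simp: indicator_def ennreal_plus[symmetric] simp del: ennreal_plus)
    qed
    also have "\<dots> = emeasure M {\<omega>\<in>space M. W t \<omega> \<le> z}"
      using emeasure_W[OF t, of "{..z}"] by simp
    finally have IJ: "?I + ?J = prob {\<omega>\<in>space M. W t \<omega> \<le> z}"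
      by (simp add: emeasure_eq_measure)
    have "?J = (\<integral>\<^sup>+x. ennreal (heat t (2 * a - (2 * a + (-1) * x))) * indicator {..z} (2 * a + (-1) * x) \<partial>lborel)"
      by (subst nn_integral_real_affine[where c="-1" and t="2 * a"]) auto
    \<comment> \<open>The substitution produces the closed half-line from \<open>2 * a - z\<close>,
      while the reflection principle has a strict inequality; the two differ in one point.\<close>
    also have "\<dots> = (\<integral>\<^sup>+x. ennreal (heat t x) * indicator {2 * a - z<..} x \<partial>lborel)"
    proof (rule nn_integral_cong_AE)
      show "AE x in lborel. ennreal (heat t (2 * a - (2 * a + (-1) * x))) * indicator {..z} (2 * a + (-1) * x)
          = ennreal (heat t x) * indicator {2 * a - z<..} x"
        using AE_lborel_singleton[of "2 * a - z"]
      proof eventually_elim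
        case (elim x)
        then have "2 * a + (-1) * x \<in> {..z} \<longleftrightarrow> x \<in> {2 * a - z<..}" by auto
        then show ?case by (simp add: indicator_def)
      qed
    qed
    also have "\<dots> = emeasure M {\<omega>\<in>space M. W t \<omega> > 2 * a - z}"
      using emeasure_W[OF t borel_open[OF open_greaterThan], of "2 * a - z"] by simp
    also have "\<dots> = prob {\<omega>\<in>space M. max_W 0 t \<omega> > a \<and> W t \<omega> \<le> z}"
      using reflection_principle[OF less_imp_le[OF t] True za] by (simp only: emeasure_eq_measure)
    finally have J: "?J = prob {\<omega>\<in>space M. max_W 0 t \<omega> > a \<and> W t \<omega> \<le> z}" .
    let ?P = "{\<omega>\<in>space M. max_W 0 t \<omega> \<le> a \<and> W t \<omega> \<le> z}"
    let ?Q = "{\<omega>\<in>space M. max_W 0 t \<omega> > a \<and> W t \<omega> \<le> z}"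
    have "{\<omega>\<in>space M. W t \<omega> \<le> z} = ?P \<union> ?Q"
      using linorder_not_le by blast
    moreover have "prob (?P \<union> ?Q) = prob ?P + prob ?Q"
      by (rule finite_measure_Union) auto
    ultimately have "prob {\<omega>\<in>space M. W t \<omega> \<le> z} = prob ?P + prob ?Q"
      by (simp only:)
    then have "ennreal (prob {\<omega>\<in>space M. W t \<omega> \<le> z}) = ennreal (prob ?P) + ennreal (prob ?Q)"
      by (simp only: ennreal_plus measure_nonneg)
    then have "ennreal (prob ?P) + ?J = ?I + ?J"
      using IJ J by (simp only:)
    then have "ennreal (prob ?P) = ?I"
      unfolding J add.commute[of _ "ennreal (prob ?Q)"] by (simp only: ennreal_add_left_cancel ennreal_neq_top simp_thms infinity_ennreal_def)
    then show ?thesis unfolding L R' .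
  qed
qed auto

lemma nn_integral_max_end:
  assumes t: "0 < t" and f: "f \<in> borel_measurable borel"
  shows "(\<integral>\<^sup>+\<omega>. f (max_W 0 t \<omega>, W t \<omega>) \<partial>M)
    = (\<integral>\<^sup>+m. \<integral>\<^sup>+x. ennreal (max_end_density t m x) * f (m, x) \<partial>lborel \<partial>lborel)"
proof -
  have [measurable]: "W t \<in> borel_measurable M" using t by (intro measurable_W) simp
  have [measurable]: "(\<lambda>\<omega>. max_W 0 t \<omega>) \<in> borel_measurable M"
    using t by (intro measurable_max) simp_all
  have X[measurable]: "(\<lambda>\<omega>. (max_W 0 t \<omega>, W t \<omega>)) \<in> borel_measurable M"
    unfolding borel_prod[symmetric] by measurable
  note [measurable] = f
  have f'[measurable]: "f \<in> borel_measurable (borel \<Otimes>\<^sub>M borel)" using f by (simp add: borel_prod)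
  have "(\<integral>\<^sup>+\<omega>. f (max_W 0 t \<omega>, W t \<omega>) \<partial>M)
      = (\<integral>\<^sup>+p. f p \<partial>distr M borel (\<lambda>\<omega>. (max_W 0 t \<omega>, W t \<omega>)))"
    by (subst nn_integral_distr) auto
  also have "\<dots> = (\<integral>\<^sup>+p. ennreal (max_end_density t (fst p) (snd p)) * f p \<partial>(lborel \<Otimes>\<^sub>M lborel))"
    unfolding max_end_law[OF t] by (subst nn_integral_density) (auto simp: lborel_prod)
  also have "\<dots> = (\<integral>\<^sup>+m. \<integral>\<^sup>+x. ennreal (max_end_density t m x) * f (m, x) \<partial>lborel \<partial>lborel)"
    by (subst lborel.nn_integral_fst[symmetric]) auto
  finally show ?thesis .
qed

text \<open>The motion restarted at time \<open>s\<close> satisfies the same locale, so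
  interpretations of it transfer every law proved so far to the part of the path after
  \<open>s\<close>.\<close>

lemma brownian_shift:
  assumes s: "0 \<le> s"
  shows "continuous_brownian M (\<lambda>h \<omega>. W (s + h) \<omega> - W s \<omega>)"
proof unfold_locales
  fix t :: real assume "0 \<le> t"
  then show "(\<lambda>\<omega>. W (s + t) \<omega> - W s \<omega>) \<in> borel_measurable M"
    using s by (intro borel_measurable_diff measurable_W) auto
next
  fix n and t :: "nat \<Rightarrow> real" assume "0 \<le> t 0" "\<And>i. i < n \<Longrightarrow> t i \<le> t (Suc i)"
  then show "indep_vars (\<lambda>_. borel) (\<lambda>i \<omega>. W (s + t (Suc i)) \<omega> - W s \<omega> - (W (s + t i) \<omega> - W s \<omega>)) {..<n}"
    using indep_increments[of "\<lambda>i. s + t i" n] s by simp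
next
  fix u t :: real assume "0 \<le> u" "u < t"
  then show "distributed M lborel (\<lambda>\<omega>. W (s + t) \<omega> - W s \<omega> - (W (s + u) \<omega> - W s \<omega>))
     (\<lambda>x. ennreal (heat (t - u) x))"
    using normal_increments[of "s + u" "s + t"] s by simp
next
  fix \<omega>
  show "continuous_on {0..} (\<lambda>t. W (s + t) \<omega> - W s \<omega>)"
    using s by (intro continuous_intros continuous_on_compose2[OF continuous_W]) auto
qed simp

text \<open>The Markov property in the form needed for maxima. Box events for the two pairs are
  decreasing limits of grid events \<open>F n\<close> and \<open>G n\<close>; for each
  \<open>n\<close> these are independent because they depend on the past and the later displacements
  of one common grid.\<close>

lemma indep_max_end_shift:
  assumes t: "0 \<le> t" and h: "0 \<le> h"
  shows "indep_pair borel (\<lambda>\<omega>. (max_W 0 t \<omega>, W t \<omega>))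
     borel (\<lambda>\<omega>. (running_max (\<lambda>r. W (t + r) \<omega> - W t \<omega>) 0 h, W (t + h) \<omega> - W t \<omega>))"
    (is "indep_pair _ ?X _ ?Y")
proof -
  interpret S: continuous_brownian M "\<lambda>h \<omega>. W (t + h) \<omega> - W t \<omega>"
    by (rule brownian_shift[OF t])
  let ?A = "\<lambda>\<omega>. max_W 0 t \<omega>"
  let ?V = "\<lambda>\<omega>. running_max (\<lambda>r. W (t + r) \<omega> - W t \<omega>) 0 h"
  have [measurable]: "W t \<in> borel_measurable M" "(\<lambda>\<omega>. W (t + h) \<omega> - W t \<omega>) \<in> borel_measurable M"
    "?A \<in> borel_measurable M" "?V \<in> borel_measurable M"
    using t h measurable_W measurable_max S.measurable_W S.measurable_max by auto
  have X[measurable]: "?X \<in> borel_measurable M" and Y[measurable]: "?Y \<in> borel_measurable M"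
    unfolding borel_prod[symmetric] by measurable
  have boxes: "prob {\<omega>\<in>space M. ?A \<omega> \<le> a \<and> W t \<omega> \<le> b \<and> ?V \<omega> \<le> c \<and> W (t + h) \<omega> - W t \<omega> \<le> d}
      = prob {\<omega>\<in>space M. ?A \<omega> \<le> a \<and> W t \<omega> \<le> b} *
        prob {\<omega>\<in>space M. ?V \<omega> \<le> c \<and> W (t + h) \<omega> - W t \<omega> \<le> d}" for a b c d
  proof -
    define F where "F n = {\<omega>\<in>space M. (\<forall>k\<le>2 ^ n. W (dyadic 0 t n k) \<omega> \<le> a) \<and> W t \<omega> \<le> b}" for n
    define G where "G n = {\<omega>\<in>space M. (\<forall>k\<le>2 ^ n. W (t + dyadic 0 h n k) \<omega> - W t \<omega> \<le> c)
        \<and> W (t + h) \<omega> - W t \<omega> \<le> d}" for n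
    have FG: "F n \<in> events" "G n \<in> events" "prob (F n \<inter> G n) = prob (F n) * prob (G n)" for n
    proof -
      let ?K = "2 ^ n :: nat"
      \<comment> \<open>A dyadic grid of \<open>{0..t}\<close> followed by one of
        \<open>{t..t + h}\<close>: index \<open>2 ^ n\<close> is time \<open>t\<close>, where past
        and future are cut.\<close>
      define u where "u k = (if k \<le> ?K then dyadic 0 t n k else t + dyadic 0 h n (k - ?K))" for k
      have u: "u 0 = 0" "u ?K = t" "u (?K + ?K) = t + h"
        by (auto simp: u_def dyadic_0 dyadic_last)
      have u_mono: "u i \<le> u (Suc i)" if "i < ?K + ?K" for i
      proof -
        consider "i < ?K" | "i = ?K" | "?K < i" by linarith
        then show ?thesis
        proof cases
          case 1 then show ?thesis using dyadic_Suc_le[OF t] by (simp add: u_def)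
        next
          case 2
          then show ?thesis
            using dyadic_Suc_le[OF h, of n 0] by (simp add: u_def dyadic_0 dyadic_last)
        next
          case 3 then show ?thesis using dyadic_Suc_le[OF h, of n "i - ?K"] by (simp add: u_def Suc_diff_le)
        qed
      qed
      have u2: "u (k + ?K) = t + dyadic 0 h n k" for k
        by (cases "k = 0") (auto simp: u_def dyadic_0 dyadic_last)
      let ?S1 = "\<Pi>\<^sub>M i\<in>{..?K}. borel :: real measure" and ?S2 = "\<Pi>\<^sub>M i\<in>{?K..?K + ?K}. borel :: real measure"
      let ?f1 = "\<lambda>\<omega>. \<lambda>i\<in>{..?K}. W (u i) \<omega>" and ?f2 = "\<lambda>\<omega>. \<lambda>i\<in>{?K..?K + ?K}. W (u i) \<omega> - W (u ?K) \<omega>"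
      have ind: "indep_var ?S1 ?f1 ?S2 ?f2"
        by (rule indep_past_future) (use u_mono u in auto)
      let ?Z1 = "{x\<in>space ?S1. (\<forall>k\<in>{..?K}. x k \<le> a) \<and> x ?K \<le> b}"
      let ?Z2 = "{x\<in>space ?S2. (\<forall>k\<in>{?K..?K + ?K}. x k \<le> c) \<and> x (?K + ?K) \<le> d}"
      have Z1: "?Z1 \<in> sets ?S1"
        by (intro sets.sets_Collect_conj sets.sets_Collect_finite_All borel_measurable_le
            measurable_component_singleton) auto
      have Z2: "?Z2 \<in> sets ?S2"
        by (intro sets.sets_Collect_conj sets.sets_Collect_finite_All borel_measurable_le
            measurable_component_singleton) auto
      have eq1: "?f1 -` ?Z1 \<inter> space M = F n"
        using u(2) by (auto simp: F_def space_PiM u_def)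
      have eq2: "?f2 -` ?Z2 \<inter> space M = G n"
      proof -
        have "(\<forall>k\<in>{?K..?K + ?K}. W (u k) \<omega> - W t \<omega> \<le> c) \<longleftrightarrow>
           (\<forall>k\<le>?K. W (t + dyadic 0 h n k) \<omega> - W t \<omega> \<le> c)" for \<omega>
        proof safe
          fix k assume *: "\<forall>k\<in>{?K..?K + ?K}. W (u k) \<omega> - W t \<omega> \<le> c" "k \<le> ?K"
          then have "k + ?K \<in> {?K..?K + ?K}" by auto
          with * u2[of k] show "W (t + dyadic 0 h n k) \<omega> - W t \<omega> \<le> c" by metis
        next
          fix k assume *: "\<forall>k\<le>?K. W (t + dyadic 0 h n k) \<omega> - W t \<omega> \<le> c" "k \<in> {?K..?K + ?K}"
          then have "k - ?K \<le> ?K" "k = (k - ?K) + ?K" by auto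
          with * u2[of "k - ?K"] show "W (u k) \<omega> - W t \<omega> \<le> c" by metis
        qed
        then show ?thesis
          using u(2,3) by (auto simp: G_def space_PiM PiE_def extensional_def)
      qed
      show "F n \<in> events" using measurable_sets[OF indep_var_rv1[OF ind] Z1] eq1 by simp
      show "G n \<in> events" using measurable_sets[OF indep_var_rv2[OF ind] Z2] eq2 by simp
      have "(\<lambda>x. (?f1 x, ?f2 x)) -` (?Z1 \<times> ?Z2) \<inter> space M = F n \<inter> G n"
        using eq1 eq2 by blast
      then show "prob (F n \<inter> G n) = prob (F n) * prob (G n)"
        using indep_varD[OF ind Z1 Z2] eq1 eq2 by simp
    qed
    have mono: "F m \<subseteq> F n" "G m \<subseteq> G n" if "n \<le> m" for n m
      using that dyadic_mono_ex[OF that, of _ "\<lambda>r. \<not> W r _ \<le> a"]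
        dyadic_mono_ex[OF that, of _ "\<lambda>r. \<not> W (t + r) _ - W t _ \<le> c"]
      unfolding F_def G_def by blast+
    \<comment> \<open>Upper bounds at more and more grid points are harder to meet, so continuity
      from above gives the events for the true maxima.\<close>
    have dec: "decseq F" "decseq G" "decseq (\<lambda>n. F n \<inter> G n)"
      using mono unfolding decseq_def by blast+
    have IF: "(\<Inter>n. F n) = {\<omega>\<in>space M. ?A \<omega> \<le> a \<and> W t \<omega> \<le> b}"
      using running_max_le_iff_closure[OF continuous_path[of 0 t] t closure_dyadic[OF t], of _ a]
      by (auto simp: F_def)
    have IG: "(\<Inter>n. G n) = {\<omega>\<in>space M. ?V \<omega> \<le> c \<and> W (t + h) \<omega> - W t \<omega> \<le> d}"
      using running_max_le_iff_closure[OF S.continuous_path[of 0 h] h closure_dyadic[OF h], of _ c]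
      by (auto simp: G_def)
    have "(\<lambda>n. prob (F n)) \<longlonglongrightarrow> prob (\<Inter>n. F n)" "(\<lambda>n. prob (G n)) \<longlonglongrightarrow> prob (\<Inter>n. G n)"
      using FG dec by (auto intro!: finite_Lim_measure_decseq)
    then have "(\<lambda>n. prob (F n \<inter> G n)) \<longlonglongrightarrow> prob (\<Inter>n. F n) * prob (\<Inter>n. G n)"
      unfolding FG(3) by (rule tendsto_mult)
    moreover have "(\<lambda>n. prob (F n \<inter> G n)) \<longlonglongrightarrow> prob (\<Inter>n. F n \<inter> G n)"
      using FG(1,2) dec(3) by (intro finite_Lim_measure_decseq) auto
    ultimately have "prob (\<Inter>n. F n \<inter> G n) = prob (\<Inter>n. F n) * prob (\<Inter>n. G n)"
      using LIMSEQ_unique by blast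
    moreover have "(\<Inter>n. F n \<inter> G n) = {\<omega>\<in>space M. ?A \<omega> \<le> a \<and> W t \<omega> \<le> b \<and> ?V \<omega> \<le> c \<and> W (t + h) \<omega> - W t \<omega> \<le> d}"
      using IF IG by blast
    ultimately show ?thesis unfolding IF IG by simp
  qed
  show ?thesis
  proof (rule indep_pair_atMostI[OF X Y])
    fix p q :: "real \<times> real"
    show "prob {\<omega>\<in>space M. ?X \<omega> \<le> p \<and> ?Y \<omega> \<le> q} = prob {\<omega>\<in>space M. ?X \<omega> \<le> p} * prob {\<omega>\<in>space M. ?Y \<omega> \<le> q}"
      using boxes[of "fst p" "snd p" "fst q" "snd q"] by (simp add: less_eq_prod_def conj_assoc)
  qed
qed

end

subsection \<open>Gaussian integrals\<close>

definition Phi :: "real \<Rightarrow> real" where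
  "Phi = cdf (density lborel (\<lambda>x. ennreal (std_normal_density x)))"

lemma Phi_lim: "(Phi \<longlongrightarrow> 1) at_top"
proof -
  interpret real_distribution "density lborel (\<lambda>x. ennreal (std_normal_density x))"
    by (rule real_dist_normal_dist)
  show ?thesis unfolding Phi_def by (rule cdf_lim_at_top_prob)
qed

lemma Phi_affine_lim:
  assumes "0 < q"
  shows "((\<lambda>v. Phi ((v + c) / q)) \<longlongrightarrow> 1) at_top"
proof -
  have "filterlim (\<lambda>v. (v + c) / q) at_top at_top"
    using assms by real_asymp
  then show ?thesis by (rule filterlim_compose[OF Phi_lim])
qed

lemma DERIV_Phi: "(Phi has_real_derivative std_normal_density x) (at x)"
proof -
  let ?N = "density lborel (\<lambda>x. ennreal (std_normal_density x))"
  interpret real_distribution ?N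
    by (rule real_dist_normal_dist)
  have cont: "continuous_on S std_normal_density" for S
    unfolding std_normal_density_def by (intro continuous_intros) auto
  \<comment> \<open>Anchoring at \<open>x - 1\<close> expresses \<open>Phi\<close> near
    \<open>x\<close> through a proper integral, to which the fundamental theorem of calculus
    applies.\<close>
  define F where "F y = Phi (x - 1) + (LBINT z=ereal (x - 1)..ereal y. std_normal_density z)" for y
  have F: "Phi y = F y" if "y \<in> {x - 1<..<x + 1}" for y
  proof -
    have "Phi y - Phi (x - 1) = measure ?N {x - 1<..y}"
      unfolding Phi_def using that by (intro cdf_diff_eq) simp
    also have "\<dots> = (\<integral>z. indicator {x - 1<..y} z \<partial>?N)"
      by simp
    also have "\<dots> = (LBINT z:{x - 1<..y}. std_normal_density z)"
      by (subst integral_density) (auto simp: set_lebesgue_integral_def mult.commute)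
    also have "\<dots> = (LBINT z=ereal (x - 1)..ereal y. std_normal_density z)"
      using that by (intro interval_integral_Ioc[symmetric]) auto
    finally show ?thesis by (simp add: F_def)
  qed
  have "((\<lambda>u. LBINT z=ereal (x - 1)..ereal u. std_normal_density z) has_real_derivative
      std_normal_density x) (at x within {x - 1..x + 1})"
    unfolding has_real_derivative_iff_has_vector_derivative
    by (rule interval_integral_FTC2) (auto intro: cont)
  then have "(F has_real_derivative std_normal_density x) (at x)"
    unfolding F_def
    by (subst (asm) at_within_interior) (auto intro!: derivative_eq_intros)
  then show ?thesis
    by (rule has_field_derivative_transform_within_open[where S = "{x - 1<..<x + 1}"]) (auto simp: F)
qed

lemma DERIV_Phi_chain [derivative_intros]:
  "(g has_real_derivative D) (at x within S) \<Longrightarrow>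
   ((\<lambda>x. Phi (g x)) has_real_derivative std_normal_density (g x) * D) (at x within S)"
  by (rule DERIV_chain2[OF DERIV_Phi])

lemma DERIV_Phi_affine:
  "((\<lambda>u. Phi ((u + c) / q)) has_real_derivative std_normal_density ((u + c) / q) / q) (at u)"
  by (rule DERIV_cong[OF DERIV_Phi_chain[OF DERIV_cdivide[OF DERIV_add[OF DERIV_ident DERIV_const]]]]) simp

lemma DERIV_heat_chain [derivative_intros]:
  "(g has_real_derivative D) (at x within S) \<Longrightarrow> 0 < t \<Longrightarrow>
   ((\<lambda>x. heat t (g x)) has_real_derivative - (g x / t) * heat t (g x) * D) (at x within S)"
  by (rule DERIV_chain2[OF DERIV_heat])

text \<open>The integrand is the derivative of \<open>- 2 * heat t (a + u)\<close>, which vanishes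
  at infinity. Here \<open>u\<close> stands for the gap between maximum and endpoint, so this is the
  density of the maximum \<open>a\<close> with a gap of at least \<open>v\<close>.\<close>

lemma integral_shifted_density:
  assumes t: "0 < t" and "0 \<le> a + v"
  shows "(\<integral>\<^sup>+u. ennreal (2 * (a + u) / t * heat t (a + u)) * indicator {v..} u \<partial>lborel)
    = ennreal (2 * heat t (a + v))"
proof -
  have "(\<integral>\<^sup>+u. ennreal (2 * (a + u) / t * heat t (a + u)) * indicator {v..} u \<partial>lborel)
      = ennreal (0 - (- 2 * heat t (a + v)))"
  proof (rule nn_integral_FTC_atLeast)
    fix u assume "v \<le> u"
    show "((\<lambda>u. - 2 * heat t (a + u)) has_real_derivative 2 * (a + u) / t * heat t (a + u)) (at u)"
      using t by (auto intro!: derivative_eq_intros simp: field_simps)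
    show "0 \<le> 2 * (a + u) / t * heat t (a + u)"
      using t assms \<open>v \<le> u\<close> by auto
  next
    show "((\<lambda>u. - 2 * heat t (a + u)) \<longlongrightarrow> 0) at_top"
      unfolding heat_eq[OF t, abs_def] using t by real_asymp
  qed auto
  then show ?thesis by simp
qed

lemma heat_mult:
  assumes "0 < s" "0 < r"
  shows "heat s x * heat r y = exp (- x\<^sup>2 / (2 * s) + - y\<^sup>2 / (2 * r)) / (2 * pi * (sqrt s * sqrt r))"
proof -
  have "sqrt (2 * pi * s) * sqrt (2 * pi * r) = 2 * pi * (sqrt s * sqrt r)"
    using real_sqrt_mult[of 2 2] real_sqrt_mult[of pi pi] by (simp add: real_sqrt_mult mult_ac)
  then show ?thesis
    using assms by (simp only: heat_eq exp_add times_divide_times_eq)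
qed

lemma heat_mult_std_normal:
  assumes "0 < r"
  shows "heat 1 b * (std_normal_density (y / sqrt r) / sqrt r)
    = exp (- b\<^sup>2 / 2 + - (y\<^sup>2 / r) / 2) / (2 * pi * sqrt r)"
  using heat_mult[of 1 1 b "y / sqrt r"] assms
  by (simp add: power_divide)

text \<open>Completing the square. For independent centered normals \<open>x\<close>,
  \<open>y\<close> of variances \<open>t\<close>, \<open>1 - t\<close>, the combinations
  \<open>x - y\<close> and \<open>y * t + x * (1 - t)\<close> are uncorrelated, with variances
  \<open>1\<close> and \<open>t * (1 - t)\<close>, and the linear map has determinant 1. One factor
  is thus free of the variable to be integrated whenever \<open>x - y\<close> is.\<close>

lemma heat_mult_heat:
  assumes t: "0 < t" "t < 1"
  shows "heat t x * heat (1 - t) y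
     = heat 1 (x - y) * (std_normal_density ((y * t + x * (1 - t) ) / sqrt (t * (1 - t))) / sqrt (t * (1 - t)))"
proof -
  have "- x\<^sup>2 / (2 * t) + - y\<^sup>2 / (2 * (1 - t)) =
      - (x - y)\<^sup>2 / 2 + - ((y * t + x * (1 - t))\<^sup>2 / (t * (1 - t))) / 2"
    using t by (simp add: divide_simps) algebra
  then show ?thesis
    using t by (subst heat_mult_std_normal) (simp_all add: heat_mult real_sqrt_mult)
qed

text \<open>Density of the maximum over \<open>[0, 1]\<close> on the event that it is attained before time \<open>t\<close>, for the
  Brownian motion; \<open>early_max_B\<close> below is its analogue for the bridge.\<close>

definition early_max_W :: "real \<Rightarrow> real \<Rightarrow> real" where
  "early_max_W t a = 4 * heat 1 a * (1 - Phi (a * sqrt ((1 - t) / t)))"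

text \<open>Here \<open>v\<close> is the rise of the motion after \<open>t\<close>, with half-normal
  density, and \<open>2 * heat t (a + v)\<close> accounts for an early maximum \<open>a\<close> with
  gap at least \<open>v\<close>. As \<open>(a + v) - v = a\<close> is constant,
  \<open>heat_mult_heat\<close> makes the integrand a multiple of a normal density in
  \<open>v\<close>.\<close>

lemma early_max_W_integral:
  assumes t: "0 < t" "t < 1"
  shows "(\<integral>\<^sup>+v. ennreal (2 * heat (1 - t) v * (2 * heat t (a + v))) * indicator {0..} v \<partial>lborel)
    = ennreal (early_max_W t a)"
proof -
  let ?q = "sqrt (t * (1 - t))"
  have q: "0 < ?q" using t by simp
  let ?F = "\<lambda>v. 4 * heat 1 a * Phi ((v + a * (1 - t)) / ?q)"
  have "(\<integral>\<^sup>+v. ennreal (2 * heat (1 - t) v * (2 * heat t (a + v))) * indicator {0..} v \<partial>lborel)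
      = ennreal (4 * heat 1 a * 1 - ?F 0)"
  proof (rule nn_integral_FTC_atLeast[where F = ?F])
    fix v :: real
    have "(?F has_real_derivative 4 * heat 1 a * (std_normal_density ((v + a * (1 - t)) / ?q) / ?q)) (at v)"
      by (intro DERIV_cmult DERIV_Phi_affine)
    also have "4 * heat 1 a * (std_normal_density ((v + a * (1 - t)) / ?q) / ?q)
        = 2 * heat (1 - t) v * (2 * heat t (a + v))"
      using heat_mult_heat[OF t, of "a + v" v] by (simp add: algebra_simps)
    finally show "(?F has_real_derivative 2 * heat (1 - t) v * (2 * heat t (a + v))) (at v)" .
    show "(?F \<longlongrightarrow> 4 * heat 1 a * 1) at_top"
      using q by (intro tendsto_mult tendsto_const Phi_affine_lim)
  qed auto
  also have "a * (1 - t) / ?q = a * sqrt ((1 - t) / t)"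
  proof -
    have "(1 - t) / ?q = (1 - t) / sqrt (1 - t) / sqrt t"
      by (simp add: real_sqrt_mult mult.commute)
    also have "(1 - t) / sqrt (1 - t) = sqrt (1 - t)"
      using t by (intro real_div_sqrt) simp
    finally show ?thesis by (simp add: real_sqrt_divide flip: times_divide_eq_right)
  qed
  then have "4 * heat 1 a * 1 - ?F 0 = early_max_W t a"
    by (simp add: early_max_W_def algebra_simps)
  finally show ?thesis .
qed

definition early_max_B :: "real \<Rightarrow> real \<Rightarrow> real" where
  "early_max_B t a = 4 * a * exp (- 2 * a\<^sup>2) * (1 - Phi (a * (1 - 2 * t) / sqrt (t * (1 - t))))"

lemma measurable_Phi[measurable]: "Phi \<in> borel_measurable borel"
  by (intro borel_measurable_continuous_onI continuous_at_imp_continuous_on ballI)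
     (rule DERIV_isCont[OF DERIV_Phi])

lemma measurable_early_max[measurable]:
  "early_max_W t \<in> borel_measurable borel" "early_max_B t \<in> borel_measurable borel"
  unfolding early_max_W_def[abs_def] early_max_B_def[abs_def] by measurable

text \<open>With early maximum \<open>a\<close> and gap \<open>u\<close>, the path is at
  \<open>a - u\<close> at time \<open>t\<close>; the difference of kernels is the density for
  travelling from there to 0 in the remaining time while staying below \<open>a\<close>. Division by
  \<open>heat 1 0\<close> normalizes the conditioning on the endpoint.\<close>

lemma early_max_B_integral:
  assumes t: "0 < t" "t < 1" and a: "0 \<le> a"
  shows "(\<integral>\<^sup>+u. ennreal (2 * (a + u) / t * heat t (a + u)
        * ((heat (1 - t) (a - u) - heat (1 - t) (a + u)) / heat 1 0)) * indicator {0..} u \<partial>lborel)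
    = ennreal (early_max_B t a)"
proof -
  let ?q = "sqrt (t * (1 - t))"
  have q: "0 < ?q" using t by simp
  let ?P = "\<lambda>u. heat t (a + u) * heat (1 - t) (a - u)" and ?Q = "\<lambda>u. heat t (a + u) * heat (1 - t) (a + u)"
  \<comment> \<open>Obtained by integration by parts. The factor \<open>- (2 * (1 - t))\<close>
    turns the derivative of \<open>?P - ?Q\<close> into the integrand minus
    \<open>4 * a * ?P\<close>, and \<open>?P\<close> integrates to \<open>Phi\<close> by
    \<open>heat_mult_heat\<close> with \<open>x - y = 2 * a\<close>. At \<open>u = 0\<close> the
    products agree, so only the \<open>Phi\<close> term survives.\<close>
  let ?F = "\<lambda>u. (- (2 * (1 - t)) * (?P u - ?Q u) + 4 * a * heat 1 (2 * a) * Phi ((u + a * (1 - 2 * t)) / ?q)) / heat 1 0"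
  let ?f = "\<lambda>u. 2 * (a + u) / t * heat t (a + u) * ((heat (1 - t) (a - u) - heat (1 - t) (a + u)) / heat 1 0)"
  have h1: "0 < heat 1 0" by (simp add: normal_density_pos)
  have "(\<integral>\<^sup>+u. ennreal (?f u) * indicator {0..} u \<partial>lborel)
      = ennreal ((- (2 * (1 - t)) * (0 - 0) + 4 * a * heat 1 (2 * a) * 1) / heat 1 0 - ?F 0)"
  proof (rule nn_integral_FTC_atLeast[where F = ?F])
    fix u :: real assume "0 \<le> u"
    have "(?P has_real_derivative (- ((a + u) / t) * heat t (a + u) * (0 + 1)) * heat (1 - t) (a - u)
        + (- ((a - u) / (1 - t)) * heat (1 - t) (a - u) * (0 - 1)) * heat t (a + u)) (at u)"
      using t by (intro derivative_intros) auto
    then have P: "(?P has_real_derivative (- ((a + u) / t) + (a - u) / (1 - t)) * ?P u) (at u)"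
      by (rule DERIV_cong) (simp add: algebra_simps add_divide_distrib diff_divide_distrib)
    have "(?Q has_real_derivative (- ((a + u) / t) * heat t (a + u) * (0 + 1)) * heat (1 - t) (a + u)
        + (- ((a + u) / (1 - t)) * heat (1 - t) (a + u) * (0 + 1)) * heat t (a + u)) (at u)"
      using t by (intro derivative_intros) auto
    then have Q: "(?Q has_real_derivative (- ((a + u) / t) - (a + u) / (1 - t)) * ?Q u) (at u)"
      by (rule DERIV_cong) (simp add: algebra_simps add_divide_distrib diff_divide_distrib)
    have "((\<lambda>u. heat 1 (2 * a) * Phi ((u + a * (1 - 2 * t)) / ?q)) has_real_derivative
        heat 1 (2 * a) * (std_normal_density ((u + a * (1 - 2 * t)) / ?q) / ?q)) (at u)"
      by (intro DERIV_cmult DERIV_Phi_affine)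
    also have "heat 1 (2 * a) * (std_normal_density ((u + a * (1 - 2 * t)) / ?q) / ?q) = ?P u"
      using heat_mult_heat[OF t, of "a + u" "u - a"] heat_minus[of "1 - t" "u - a"] by (simp add: algebra_simps)
    finally have R: "((\<lambda>u. heat 1 (2 * a) * Phi ((u + a * (1 - 2 * t)) / ?q)) has_real_derivative ?P u) (at u)" .
    have "(?F has_real_derivative (- (2 * (1 - t)) * ((- ((a + u) / t) + (a - u) / (1 - t)) * ?P u
         - (- ((a + u) / t) - (a + u) / (1 - t)) * ?Q u) + 4 * a * ?P u) / heat 1 0) (at u)"
      using DERIV_cdivide[OF DERIV_add[OF DERIV_cmult[OF DERIV_diff[OF P Q], of "- (2 * (1 - t))"]
          DERIV_cmult[OF R, of "4 * a"]], of "heat 1 0"] by (simp add: mult.assoc)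
    also have "- (2 * (1 - t)) * ((- ((a + u) / t) + (a - u) / (1 - t)) * ?P u
         - (- ((a + u) / t) - (a + u) / (1 - t)) * ?Q u) + 4 * a * ?P u =
      2 * (a + u) / t * ?P u - 2 * (a + u) / t * ?Q u"
    proof -
      have 1: "- (2 * (1 - t)) * (- ((a + u) / t) + (a - u) / (1 - t)) + 4 * a = 2 * (a + u) / t"
        using t by (simp add: field_simps)
      have 2: "- (2 * (1 - t)) * (- ((a + u) / t) - (a + u) / (1 - t)) = 2 * (a + u) / t"
        using t by (simp add: field_simps)
      have "k * ((x * p) - y * q) + c * p = (k * x + c) * p - k * y * q" for k x y c p q :: real
        by (simp add: algebra_simps)
      then show ?thesis by (simp only: 1 2)
    qed
    also have "(2 * (a + u) / t * ?P u - 2 * (a + u) / t * ?Q u) / heat 1 0 = ?f u"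
    proof -
      have "(k * (h * p) - k * (h * q)) / c = k * h * ((p - q) / c)" for k h p q c :: real
        by (simp add: algebra_simps diff_divide_distrib)
      then show ?thesis .
    qed
    finally show "(?F has_real_derivative ?f u) (at u)" .
    have "heat (1 - t) (a + u) \<le> heat (1 - t) (a - u)"
      using a \<open>0 \<le> u\<close> by (intro heat_antimono) auto
    then show "0 \<le> ?f u"
      using t a h1 \<open>0 \<le> u\<close> by (intro mult_nonneg_nonneg divide_nonneg_pos) auto
  next
    have "(?P \<longlongrightarrow> 0) at_top" "(?Q \<longlongrightarrow> 0) at_top"
    proof -
      have h: "((\<lambda>u. heat r (c + u)) \<longlongrightarrow> 0) at_top" if "0 < r" for r c
        unfolding heat_eq[OF that] using that by real_asymp
      have "((\<lambda>u. heat (1 - t) (a - u)) \<longlongrightarrow> 0) at_top"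
        using h[of "1 - t" "- a"] t heat_minus[of "1 - t" "_ - a"] by simp
      then show "(?P \<longlongrightarrow> 0) at_top" "(?Q \<longlongrightarrow> 0) at_top"
        using h[of t a] h[of "1 - t" a] t by (auto intro: tendsto_mult_zero)
    qed
    then show "(?F \<longlongrightarrow> (- (2 * (1 - t)) * (0 - 0) + 4 * a * heat 1 (2 * a) * 1) / heat 1 0) at_top"
      using h1 q by (intro tendsto_intros Phi_affine_lim) auto
  qed auto
  also have "(- (2 * (1 - t)) * (0 - 0) + 4 * a * heat 1 (2 * a) * 1) / heat 1 0 - ?F 0
     = 4 * a * (heat 1 (2 * a) / heat 1 0) * (1 - Phi (a * (1 - 2 * t) / ?q))"
    using h1 by (simp add: field_simps)
  also have "heat 1 (2 * a) / heat 1 0 = exp (- 2 * a\<^sup>2)"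
    by (simp add: std_normal_density_def power_mult_distrib)
  finally show ?thesis by (simp add: early_max_B_def)
qed

text \<open>The joint densities of the time \<open>s\<close> and the value \<open>a\<close> of the maximum, obtained by
  differentiating \<open>early_max_W\<close> and \<open>early_max_B\<close> in time.\<close>

definition W_density :: "real \<Rightarrow> real \<Rightarrow> real" where
  "W_density s a = a / (pi * (s * sqrt s) * sqrt (1 - s)) * exp (- a\<^sup>2 / (2 * s))"

definition B_density :: "real \<Rightarrow> real \<Rightarrow> real" where
  "B_density s a = 2 * a\<^sup>2 / (sqrt (2 * pi) * (sqrt (s * (1 - s))) ^ 3) * exp (- a\<^sup>2 / (2 * (s * (1 - s))))"

text \<open>Time occurs only inside \<open>Phi\<close>, so differentiation leaves a product of two
  Gaussian factors in \<open>a\<close>; they merge since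
  \<open>1 + (1 - s) / s = 1 / s\<close>.\<close>

lemma DERIV_early_max_W:
  assumes s: "0 < s" "s < 1"
  shows "((\<lambda>s. early_max_W s a) has_real_derivative W_density s a) (at s)"
proof -
  define r where "r = sqrt ((1 - s) / s)"
  have r: "0 < r" "r\<^sup>2 = (1 - s) / s" using s by (auto simp: r_def)
  have "((\<lambda>s. (1 - s) / s) has_real_derivative - 1 / s\<^sup>2) (at s)"
    using s by (auto intro!: derivative_eq_intros simp: field_simps power2_eq_square)
  then have "((\<lambda>s. sqrt ((1 - s) / s)) has_real_derivative inverse r / 2 * (- 1 / s\<^sup>2)) (at s)"
    unfolding r_def using s by (intro DERIV_chain2[OF DERIV_real_sqrt]) auto
  then have "((\<lambda>s. early_max_W s a) has_real_derivative
      4 * heat 1 a * (0 - std_normal_density (a * r) * (a * (inverse r / 2 * (- 1 / s\<^sup>2))))) (at s)"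
    unfolding early_max_W_def r_def
    by (intro DERIV_cmult DERIV_diff DERIV_const DERIV_Phi_chain)
  moreover have "4 * heat 1 a * (0 - std_normal_density (a * r) * (a * (inverse r / 2 * (- 1 / s\<^sup>2))))
      = W_density s a"
  proof -
    have 1: "heat 1 a * std_normal_density (a * r) = exp (- a\<^sup>2 / (2 * s)) / (2 * pi)"
    proof -
      have "- a\<^sup>2 / (2 * 1) + - (a * r)\<^sup>2 / (2 * 1) = - a\<^sup>2 / (2 * s)"
        using s unfolding power_mult_distrib r(2) by (simp add: field_simps)
      then show ?thesis using heat_mult[of 1 1 a "a * r"] by simp
    qed
    have "inverse (y / x) / (x\<^sup>2)\<^sup>2 = 1 / (x\<^sup>2 * x * y)" if "0 < x" "0 < y" for x y :: real
      using that by (simp add: field_simps power2_eq_square)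
    from this[of "sqrt s" "sqrt (1 - s)"] have 2: "inverse r / s\<^sup>2 = 1 / (s * sqrt s * sqrt (1 - s))"
      using s by (simp add: r_def real_sqrt_divide)
    have "4 * h * (0 - n * (a * (i / 2 * (- 1 / c)))) = 2 * a * (h * n) * (i / c)" for h n i c :: real
      by simp
    then have "4 * heat 1 a * (0 - std_normal_density (a * r) * (a * (inverse r / 2 * (- 1 / s\<^sup>2))))
       = 2 * a * (heat 1 a * std_normal_density (a * r)) * (inverse r / s\<^sup>2)" .
    also have "\<dots> = W_density s a"
      unfolding 1 2 by (simp add: W_density_def)
    finally show ?thesis .
  qed
  ultimately show ?thesis by simp
qed

text \<open>The identity \<open>4 * q\<^sup>2 + (1 - 2 * s)\<^sup>2 = 1\<close> with
  \<open>q\<^sup>2 = s * (1 - s)\<close> is used twice: for the derivative of the argument of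
  \<open>Phi\<close>, and to merge \<open>exp (- 2 * a\<^sup>2)\<close> with the normal
  density.\<close>

lemma DERIV_early_max_B:
  assumes s: "0 < s" "s < 1"
  shows "((\<lambda>s. early_max_B s a) has_real_derivative B_density s a) (at s)"
proof -
  define q where "q = sqrt (s * (1 - s))"
  have q: "0 < q" "q\<^sup>2 = s * (1 - s)" using s by (auto simp: q_def)
  have "((\<lambda>s. s * (1 - s)) has_real_derivative 1 - 2 * s) (at s)"
    by (auto intro!: derivative_eq_intros)
  then have "((\<lambda>s. sqrt (s * (1 - s))) has_real_derivative inverse q / 2 * (1 - 2 * s)) (at s)"
    unfolding q_def using s by (intro DERIV_chain2[OF DERIV_real_sqrt]) auto
  moreover have "((\<lambda>s. a * (1 - 2 * s)) has_real_derivative - 2 * a) (at s)"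
    by (auto intro!: derivative_eq_intros)
  ultimately have "((\<lambda>s. a * (1 - 2 * s) / sqrt (s * (1 - s))) has_real_derivative
      (- 2 * a * q - a * (1 - 2 * s) * (inverse q / 2 * (1 - 2 * s))) / (q * q)) (at s)"
    using q unfolding q_def by (intro DERIV_divide) auto
  also have "(- 2 * a * q - a * (1 - 2 * s) * (inverse q / 2 * (1 - 2 * s))) / (q * q)
     = - a / (2 * q ^ 3)"
  proof -
    have "(- 2 * a * q - a * (1 - 2 * s) * (inverse q / 2 * (1 - 2 * s))) / (q * q)
      = - a * (4 * q\<^sup>2 + (1 - 2 * s)\<^sup>2) / (2 * q ^ 3)"
      using q(1) by (simp add: field_simps power2_eq_square power3_eq_cube)
    also have "4 * q\<^sup>2 + (1 - 2 * s)\<^sup>2 = 1"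
      unfolding q(2) by (simp add: power2_eq_square algebra_simps)
    finally show ?thesis by simp
  qed
  finally have "((\<lambda>s. early_max_B s a) has_real_derivative
     4 * a * exp (- 2 * a\<^sup>2) * (0 - std_normal_density (a * (1 - 2 * s) / q) * (- a / (2 * q ^ 3)))) (at s)"
    unfolding early_max_B_def q_def
    by (intro DERIV_cmult DERIV_diff DERIV_const DERIV_Phi_chain)
  moreover have "4 * a * exp (- 2 * a\<^sup>2) * (0 - std_normal_density (a * (1 - 2 * s) / q) * (- a / (2 * q ^ 3)))
      = B_density s a"
  proof -
    have "- 2 * a\<^sup>2 + - (a * (1 - 2 * s) / q)\<^sup>2 / 2 = - a\<^sup>2 * (4 * q\<^sup>2 + (1 - 2 * s)\<^sup>2) / (2 * q\<^sup>2)"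
    proof -
      have "- 2 * a\<^sup>2 + - (a * c / q)\<^sup>2 / 2 = - a\<^sup>2 * (4 * q\<^sup>2 + c\<^sup>2) / (2 * q\<^sup>2)" for c
        using q(1) by (simp add: power_divide power_mult_distrib field_simps)
      then show ?thesis .
    qed
    also have "4 * q\<^sup>2 + (1 - 2 * s)\<^sup>2 = 1"
      unfolding q(2) by (simp add: power2_eq_square algebra_simps)
    finally have "exp (- 2 * a\<^sup>2) * exp (- (a * (1 - 2 * s) / q)\<^sup>2 / 2) = exp (- a\<^sup>2 / (2 * q\<^sup>2))"
      by (simp flip: exp_add)
    then have 1: "exp (- 2 * a\<^sup>2) * std_normal_density (a * (1 - 2 * s) / q) = exp (- a\<^sup>2 / (2 * q\<^sup>2)) / sqrt (2 * pi)"
      by (simp add: std_normal_density_def)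
    have "4 * a * e * (0 - n * (- a / (2 * c))) = 2 * a\<^sup>2 * (e * n) / c" for e n c :: real
      by (simp add: power2_eq_square)
    then have "4 * a * exp (- 2 * a\<^sup>2) * (0 - std_normal_density (a * (1 - 2 * s) / q) * (- a / (2 * q ^ 3)))
       = 2 * a\<^sup>2 * (exp (- 2 * a\<^sup>2) * std_normal_density (a * (1 - 2 * s) / q)) / q ^ 3" .
    also have "\<dots> = B_density s a"
      unfolding 1 B_density_def q(2)[symmetric] q_def[symmetric] using q(1) by simp
    finally show ?thesis .
  qed
  ultimately show ?thesis by (rule DERIV_cong)
qed

text \<open>The early laws divide by a quantity vanishing at time 0, so the fundamental theorem is
  used in improper form, with a limit in place of the value at 0.\<close>

lemma nn_integral_FTC_Ioo_0:
  fixes f F :: "real \<Rightarrow> real"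
  assumes t: "0 < t" and f: "\<And>s. 0 < s \<Longrightarrow> s \<le> t \<Longrightarrow> (F has_real_derivative f s) (at s)"
    and cont: "\<And>s. 0 < s \<Longrightarrow> s \<le> t \<Longrightarrow> isCont f s"
    and nonneg: "\<And>s. 0 < s \<Longrightarrow> s \<le> t \<Longrightarrow> 0 \<le> f s"
    and lim: "(F \<longlongrightarrow> 0) (at_right 0)"
  shows "(\<integral>\<^sup>+s. ennreal (f s) * indicator {0<..<t} s \<partial>lborel) = ennreal (F t)"
proof -
  have A: "((F \<circ> real_of_ereal) \<longlongrightarrow> 0) (at_right (ereal 0))"
    using lim by (simp add: ereal_tendsto_simps1)
  have "isCont F t" using f[of t] t DERIV_isCont by auto
  then have "(F \<longlongrightarrow> F t) (at_left t)"
    by (simp add: isCont_def filterlim_at_split)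
  then have B: "((F \<circ> real_of_ereal) \<longlongrightarrow> F t) (at_left (ereal t))"
    by (simp add: ereal_tendsto_simps1)
  have ftc: "set_integrable lborel (einterval (ereal 0) (ereal t)) f" "(LBINT s=ereal 0..ereal t. f s) = F t - 0"
    using interval_integral_FTC_nonneg[OF _ _ _ _ A B, of f] t f cont nonneg by auto
  have "(\<integral>\<^sup>+s. ennreal (f s) * indicator {0<..<t} s \<partial>lborel)
      = (\<integral>\<^sup>+s. ennreal (indicator {0<..<t} s * f s) \<partial>lborel)"
    by (intro nn_integral_cong) (auto simp: indicator_def)
  also have "\<dots> = ennreal (\<integral>s. indicator {0<..<t} s * f s \<partial>lborel)"
    using ftc(1) nonneg by (intro nn_integral_eq_integral) (auto simp: set_integrable_def indicator_def)
  also have "(\<integral>s. indicator {0<..<t} s * f s \<partial>lborel) = F t"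
    using ftc(2) t by (simp add: interval_lebesgue_integral_def set_lebesgue_integral_def)
  finally show ?thesis .
qed

text \<open>For \<open>a > 0\<close> the argument of \<open>Phi\<close> tends to infinity as the
  time tends to 0, so the early law starts from 0 there and its time derivative recovers it
  completely.\<close>

lemma W_density_integral:
  assumes "0 < a" "0 < t" "t < 1"
  shows "(\<integral>\<^sup>+s. ennreal (W_density s a) * indicator {0<..<t} s \<partial>lborel) = ennreal (early_max_W t a)"
proof (rule nn_integral_FTC_Ioo_0)
  have "filterlim (\<lambda>s. a * sqrt ((1 - s) / s)) at_top (at_right 0)"
    using assms by real_asymp
  then have "((\<lambda>s. early_max_W s a) \<longlongrightarrow> 4 * heat 1 a * (1 - 1)) (at_right 0)"
    unfolding early_max_W_def by (intro tendsto_intros filterlim_compose[OF Phi_lim])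
  then show "((\<lambda>s. early_max_W s a) \<longlongrightarrow> 0) (at_right 0)" by simp
  fix s assume s: "0 < s" "s \<le> t"
  show "isCont (\<lambda>s. W_density s a) s"
    unfolding W_density_def using s assms by (intro continuous_intros) auto
  show "0 \<le> W_density s a"
    unfolding W_density_def using s assms by simp
qed (use assms DERIV_early_max_W in auto)

lemma B_density_integral:
  assumes "0 < a" "0 < t" "t < 1"
  shows "(\<integral>\<^sup>+s. ennreal (B_density s a) * indicator {0<..<t} s \<partial>lborel) = ennreal (early_max_B t a)"
proof (rule nn_integral_FTC_Ioo_0)
  have "filterlim (\<lambda>s. a * (1 - 2 * s) / sqrt (s * (1 - s))) at_top (at_right 0)"
    using assms by real_asymp
  then have "((\<lambda>s. early_max_B s a) \<longlongrightarrow> 4 * a * exp (- 2 * a\<^sup>2) * (1 - 1)) (at_right 0)"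
    unfolding early_max_B_def by (intro tendsto_intros filterlim_compose[OF Phi_lim])
  then show "((\<lambda>s. early_max_B s a) \<longlongrightarrow> 0) (at_right 0)" by simp
  fix s assume s: "0 < s" "s \<le> t"
  show "isCont (\<lambda>s. B_density s a) s"
    unfolding B_density_def using s assms by (intro continuous_intros) auto
  show "0 \<le> B_density s a"
    unfolding B_density_def using s assms by simp
qed (use assms DERIV_early_max_B in auto)

lemma W_density_nonneg: "0 \<le> a \<Longrightarrow> 0 < s \<Longrightarrow> s < 1 \<Longrightarrow> 0 \<le> W_density s a"
  unfolding W_density_def by (intro mult_nonneg_nonneg divide_nonneg_nonneg) auto

lemma B_density_nonneg: "0 < s \<Longrightarrow> s < 1 \<Longrightarrow> 0 \<le> B_density s a"
  unfolding B_density_def by (intro mult_nonneg_nonneg divide_nonneg_nonneg) auto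

lemma measurable_densities[measurable]:
  "(\<lambda>p. W_density (fst p) (snd p)) \<in> borel_measurable (borel \<Otimes>\<^sub>M borel)"
  "(\<lambda>p. B_density (fst p) (snd p)) \<in> borel_measurable (borel \<Otimes>\<^sub>M borel)"
  "W_density s \<in> borel_measurable borel" "B_density s \<in> borel_measurable borel"
proof -
  show "(\<lambda>p. W_density (fst p) (snd p)) \<in> borel_measurable (borel \<Otimes>\<^sub>M borel)"
    unfolding W_density_def by measurable
  show "(\<lambda>p. B_density (fst p) (snd p)) \<in> borel_measurable (borel \<Otimes>\<^sub>M borel)"
    unfolding B_density_def by measurable
  show "W_density s \<in> borel_measurable borel"
    unfolding W_density_def[abs_def] by measurable
  show "B_density s \<in> borel_measurable borel"
    unfolding B_density_def[abs_def] by measurable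
qed

section \<open>Integrating the joint densities over the level\<close>

definition rho_W :: "real \<Rightarrow> real" where
  "rho_W t = 4 * sqrt t / (pi * (4 * t + 1) * sqrt (1 - t))"

definition rho_B :: "real \<Rightarrow> real" where
  "rho_B t = 2 / pi * (sqrt (t * (1 - t)) / (1 + t - t\<^sup>2) + arctan (sqrt (t * (1 - t))))"

text \<open>The factor \<open>1 - exp (- 2 * a\<^sup>2)\<close> is the distribution function of the
  bridge maximum. Multiplied by the Gaussian factor it gives two exponentials, with exponents
  \<open>- a\<^sup>2 / (2 * s)\<close> and \<open>- a\<^sup>2 * (1 + 4 * s) / (2 * s)\<close>; this
  is where \<open>4 * t + 1\<close> in the final density comes from.\<close>

lemma rho_W_integral:
  assumes s: "0 < s" "s < 1"
  shows "(\<integral>\<^sup>+a. ennreal (W_density s a) * ennreal (1 - exp (- 2 * a\<^sup>2)) * indicator {0..} a \<partial>lborel)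
    = ennreal (rho_W s)"
proof -
  define c where "c = 1 / (pi * (s * sqrt s) * sqrt (1 - s))"
  have c: "0 < c" using s by (simp add: c_def)
  let ?F = "\<lambda>a. c * (- s * exp (- a\<^sup>2 / (2 * s)) + s / (1 + 4 * s) * exp (- a\<^sup>2 * (1 + 4 * s) / (2 * s)))"
  let ?f = "\<lambda>a. W_density s a * (1 - exp (- 2 * a\<^sup>2))"
  have "(\<integral>\<^sup>+a. ennreal (W_density s a) * ennreal (1 - exp (- 2 * a\<^sup>2)) * indicator {0..} a \<partial>lborel)
     = (\<integral>\<^sup>+a. ennreal (?f a) * indicator {0..} a \<partial>lborel)"
    using s by (intro nn_integral_cong) (auto simp: indicator_def W_density_nonneg ennreal_mult)
  also have "\<dots> = ennreal (0 - ?F 0)"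
  proof (rule nn_integral_FTC_atLeast[where F = ?F])
    fix a :: real assume a: "0 \<le> a"
    have "(?F has_real_derivative c * (- s * (exp (- a\<^sup>2 / (2 * s)) * (- (2 * a) / (2 * s)))
       + s / (1 + 4 * s) * (exp (- a\<^sup>2 * (1 + 4 * s) / (2 * s)) * (- (2 * a) * (1 + 4 * s) / (2 * s))))) (at a)"
      by (auto intro!: derivative_eq_intros)
    also have "c * (- s * (exp (- a\<^sup>2 / (2 * s)) * (- (2 * a) / (2 * s)))
       + s / (1 + 4 * s) * (exp (- a\<^sup>2 * (1 + 4 * s) / (2 * s)) * (- (2 * a) * (1 + 4 * s) / (2 * s))))
       = c * a * (exp (- a\<^sup>2 / (2 * s)) - exp (- a\<^sup>2 * (1 + 4 * s) / (2 * s)))"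
      using s by (simp add: divide_simps) (simp add: algebra_simps)
    also have "exp (- a\<^sup>2 * (1 + 4 * s) / (2 * s)) = exp (- a\<^sup>2 / (2 * s)) * exp (- 2 * a\<^sup>2)"
      using s unfolding exp_add[symmetric] by (intro arg_cong[where f = exp]) (simp add: field_simps)
    finally show "(?F has_real_derivative ?f a) (at a)"
      by (simp add: W_density_def c_def right_diff_distrib mult.assoc)
    show "0 \<le> ?f a" using W_density_nonneg[OF a s] by simp
  next
    have lim: "((\<lambda>a. exp (- a\<^sup>2 * d / (2 * s))) \<longlongrightarrow> 0) at_top" if "0 < d" for d :: real
      using s that by real_asymp
    have "(?F \<longlongrightarrow> c * (- s * 0 + s / (1 + 4 * s) * 0)) at_top"
      using lim[of 1] lim[of "1 + 4 * s"] s by (intro tendsto_intros) auto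
    then show "(?F \<longlongrightarrow> 0) at_top" by simp
  qed auto
  also have "0 - ?F 0 = rho_W s"
  proof -
    have "c * (s - s / (1 + 4 * s)) = 4 * (c * s * s) / (4 * s + 1)"
      using s by (simp add: field_simps)
    also have "c * s * s = sqrt s / (pi * sqrt (1 - s))"
    proof -
      have "1 / (pi * (x\<^sup>2 * x) * y) * x\<^sup>2 * x\<^sup>2 = x / (pi * y)" if "0 < x" for x y :: real
        using that by (simp add: power2_eq_square)
      note * = this[of "sqrt s" "sqrt (1 - s)", OF real_sqrt_gt_zero[OF s(1)]]
      have sq: "(sqrt s)\<^sup>2 = s" using s by simp
      show ?thesis using * unfolding sq c_def .
    qed
    finally show ?thesis by (simp add: rho_W_def algebra_simps)
  qed
  finally show ?thesis .
qed

text \<open>The substitution \<open>v = a * y\<close> makes the range of integration independent of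
  \<open>a\<close>, so that the integral over \<open>a\<close> can later be carried out
  first.\<close>

lemma half_normal_integral_scale:
  assumes "0 < a"
  shows "(\<integral>\<^sup>+v. ennreal (2 * heat 1 v) * indicator {0..a} v \<partial>lborel)
    = (\<integral>\<^sup>+y. ennreal (a * (2 * heat 1 (a * y))) * indicator {0..1} y \<partial>lborel)"
proof -
  have "(\<integral>\<^sup>+v. ennreal (2 * heat 1 v) * indicator {0..a} v \<partial>lborel)
    = ennreal \<bar>a\<bar> * (\<integral>\<^sup>+y. ennreal (2 * heat 1 (0 + a * y)) * indicator {0..a} (0 + a * y) \<partial>lborel)"
    using assms by (intro nn_integral_real_affine) auto
  also have "\<dots> = (\<integral>\<^sup>+y. ennreal \<bar>a\<bar> * (ennreal (2 * heat 1 (0 + a * y)) * indicator {0..a} (0 + a * y)) \<partial>lborel)"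
    by (rule nn_integral_cmult[symmetric]) auto
  also have "\<dots> = (\<integral>\<^sup>+y. ennreal (a * (2 * heat 1 (a * y))) * indicator {0..1} y \<partial>lborel)"
  proof (rule nn_integral_cong)
    fix y
    have "0 + a * y \<in> {0..a} \<longleftrightarrow> y \<in> {0..1}"
      using assms by (auto simp: zero_le_mult_iff)
    then show "ennreal \<bar>a\<bar> * (ennreal (2 * heat 1 (0 + a * y)) * indicator {0..a} (0 + a * y))
       = ennreal (a * (2 * heat 1 (a * y))) * indicator {0..1} y"
      using assms by (simp add: indicator_def ennreal_mult)
  qed
  finally show ?thesis .
qed

lemma cubic_gaussian_integral:
  assumes c: "0 < c" and k: "0 \<le> k"
  shows "(\<integral>\<^sup>+a. ennreal (k * a ^ 3 * exp (- (c * a\<^sup>2) / 2)) * indicator {0..} a \<partial>lborel) = ennreal (2 * k / c\<^sup>2)"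
proof -
  let ?F = "\<lambda>a. k * (- (a\<^sup>2 / c + 2 / c\<^sup>2) * exp (- (c * a\<^sup>2) / 2))"
  have "(\<integral>\<^sup>+a. ennreal (k * a ^ 3 * exp (- (c * a\<^sup>2) / 2)) * indicator {0..} a \<partial>lborel) = ennreal (0 - ?F 0)"
  proof (rule nn_integral_FTC_atLeast[where F = ?F])
    fix a :: real assume "0 \<le> a"
    then show "0 \<le> k * a ^ 3 * exp (- (c * a\<^sup>2) / 2)" using k by simp
    have e: "((\<lambda>a. exp (- (c * a\<^sup>2) / 2)) has_real_derivative exp (- (c * a\<^sup>2) / 2) * (- (c * (2 * a)) / 2)) (at a)"
      by (auto intro!: derivative_eq_intros)
    have p: "((\<lambda>a. - (a\<^sup>2 / c + 2 / c\<^sup>2)) has_real_derivative - (2 * a / c)) (at a)"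
      using c by (auto intro!: derivative_eq_intros)
    have "(?F has_real_derivative k * (- (2 * a / c) * exp (- (c * a\<^sup>2) / 2)
         + exp (- (c * a\<^sup>2) / 2) * (- (c * (2 * a)) / 2) * - (a\<^sup>2 / c + 2 / c\<^sup>2))) (at a)"
      by (rule DERIV_cmult[OF DERIV_mult[OF p e]])
    also have "k * (- (2 * a / c) * exp (- (c * a\<^sup>2) / 2)
         + exp (- (c * a\<^sup>2) / 2) * (- (c * (2 * a)) / 2) * - (a\<^sup>2 / c + 2 / c\<^sup>2))
       = k * a ^ 3 * exp (- (c * a\<^sup>2) / 2)"
    proof -
      have "k * (- (2 * a / c) * x + x * (- (c * (2 * a)) / 2) * - (a\<^sup>2 / c + 2 / c\<^sup>2)) = k * a ^ 3 * x" for x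
        using c by (simp add: field_simps power2_eq_square power3_eq_cube)
      then show ?thesis .
    qed
    finally show "(?F has_real_derivative k * a ^ 3 * exp (- (c * a\<^sup>2) / 2)) (at a)" .
  next
    show "(?F \<longlongrightarrow> 0) at_top" using c by real_asymp
  qed auto
  then show ?thesis by (simp add: mult.commute)
qed

text \<open>The distribution function of the maximum of \<open>W\<close> is not elementary, so it is
  kept as an integral over \<open>y\<close> in \<open>{0..1}\<close> and the order is exchanged. The
  integral over \<open>a\<close> is then a cubic Gaussian moment, and a rational function of
  \<open>y\<close> remains.\<close>

lemma rho_B_integral:
  assumes s: "0 < s" "s < 1"
  shows "(\<integral>\<^sup>+a. ennreal (B_density s a) * (\<integral>\<^sup>+v. ennreal (2 * heat 1 v) * indicator {0..a} v \<partial>lborel)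
      * indicator {0..} a \<partial>lborel) = ennreal (rho_B s)"
proof -
  define q where "q = sqrt (s * (1 - s))"
  have q: "0 < q" "q\<^sup>2 = s * (1 - s)" using s by (auto simp: q_def)
  define k where "k = 2 / (pi * q ^ 3)"
  have k: "0 < k" using q by (simp add: k_def)
  have prod: "B_density s a * (a * (2 * heat 1 (a * y))) = k * a ^ 3 * exp (- ((1 / q\<^sup>2 + y\<^sup>2) * a\<^sup>2) / 2)" for a y
  proof -
    have e: "exp (- a\<^sup>2 / (2 * q\<^sup>2)) * exp (- (a * y)\<^sup>2 / 2) = exp (- ((1 / q\<^sup>2 + y\<^sup>2) * a\<^sup>2) / 2)"
      using q(1) unfolding exp_add[symmetric] by (intro arg_cong[where f = exp]) (simp add: field_simps)
    define r where "r = sqrt (2 * pi)"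
    have r2: "r\<^sup>2 = 2 * pi" by (simp add: r_def)
    have "B_density s a * (a * (2 * heat 1 (a * y)))
       = 2 * a\<^sup>2 / (r * q ^ 3) * exp (- a\<^sup>2 / (2 * q\<^sup>2)) * (a * (2 * (exp (- (a * y)\<^sup>2 / 2) / r)))"
      unfolding r_def B_density_def q(2)[symmetric] q_def[symmetric] using q(1)
      by (simp add: std_normal_density_def)
    also have "2 * a\<^sup>2 / (r * q ^ 3) * exp (- a\<^sup>2 / (2 * q\<^sup>2)) * (a * (2 * (exp (- (a * y)\<^sup>2 / 2) / r)))
       = 4 / (r\<^sup>2 * q ^ 3) * a ^ 3 * (exp (- a\<^sup>2 / (2 * q\<^sup>2)) * exp (- (a * y)\<^sup>2 / 2))"
    proof -
      have "2 * a\<^sup>2 / (r * p) * e * (a * (2 * (e' / r))) = 4 / (r\<^sup>2 * p) * a ^ 3 * (e * e')" for p e e' :: real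
        by (simp add: power2_eq_square power3_eq_cube mult_ac)
      then show ?thesis .
    qed
    finally show ?thesis unfolding e r2 k_def by simp
  qed
  have "(\<integral>\<^sup>+a. ennreal (B_density s a) * (\<integral>\<^sup>+v. ennreal (2 * heat 1 v) * indicator {0..a} v \<partial>lborel)
      * indicator {0..} a \<partial>lborel)
    = (\<integral>\<^sup>+a. \<integral>\<^sup>+y. ennreal (k * a ^ 3 * exp (- ((1 / q\<^sup>2 + y\<^sup>2) * a\<^sup>2) / 2)) * indicator {0..} a * indicator {0..1} y \<partial>lborel \<partial>lborel)"
  proof (intro nn_integral_cong_AE)
    show "AE a in lborel. ennreal (B_density s a) * (\<integral>\<^sup>+v. ennreal (2 * heat 1 v) * indicator {0..a} v \<partial>lborel) * indicator {0..} a
       = (\<integral>\<^sup>+y. ennreal (k * a ^ 3 * exp (- ((1 / q\<^sup>2 + y\<^sup>2) * a\<^sup>2) / 2)) * indicator {0..} a * indicator {0..1} y \<partial>lborel)"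
      using AE_lborel_singleton[of 0]
    proof eventually_elim
      case (elim a)
      show ?case
      proof (cases "0 < a")
        case True
        have "ennreal (B_density s a) * (\<integral>\<^sup>+y. ennreal (a * (2 * heat 1 (a * y))) * indicator {0..1} y \<partial>lborel)
            = (\<integral>\<^sup>+y. ennreal (B_density s a) * (ennreal (a * (2 * heat 1 (a * y))) * indicator {0..1} y) \<partial>lborel)"
          by (rule nn_integral_cmult[symmetric]) auto
        also have "\<dots> = (\<integral>\<^sup>+y. ennreal (k * a ^ 3 * exp (- ((1 / q\<^sup>2 + y\<^sup>2) * a\<^sup>2) / 2)) * indicator {0..1} y \<partial>lborel)"
          using True s unfolding prod[symmetric]
          by (intro nn_integral_cong) (simp add: ennreal_mult B_density_nonneg mult.assoc)
        finally show ?thesis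
          unfolding half_normal_integral_scale[OF True] using True by simp
      qed (use elim in auto)
    qed
  qed
  also have "\<dots> = (\<integral>\<^sup>+y. \<integral>\<^sup>+a. ennreal (k * a ^ 3 * exp (- ((1 / q\<^sup>2 + y\<^sup>2) * a\<^sup>2) / 2)) * indicator {0..} a * indicator {0..1} y \<partial>lborel \<partial>lborel)"
    by (rule lborel_pair.Fubini'[symmetric]) measurable
  also have "\<dots> = (\<integral>\<^sup>+y. ennreal (2 * k / (1 / q\<^sup>2 + y\<^sup>2)\<^sup>2) * indicator {0..1} y \<partial>lborel)"
  proof (rule nn_integral_cong)
    fix y :: real
    have "0 < 1 / q\<^sup>2 + y\<^sup>2" using q(1) by (simp add: add_pos_nonneg)
    then show "(\<integral>\<^sup>+a. ennreal (k * a ^ 3 * exp (- ((1 / q\<^sup>2 + y\<^sup>2) * a\<^sup>2) / 2)) * indicator {0..} a * indicator {0..1} y \<partial>lborel)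
       = ennreal (2 * k / (1 / q\<^sup>2 + y\<^sup>2)\<^sup>2) * indicator {0..1} y"
      using cubic_gaussian_integral[of "1 / q\<^sup>2 + y\<^sup>2" k] k by (subst nn_integral_multc) auto
  qed
  \<comment> \<open>In \<open>w = q * y\<close> the integrand is proportional to
    \<open>1 / (1 + w\<^sup>2)\<^sup>2\<close>, with antiderivative
    \<open>(w / (1 + w\<^sup>2) + arctan w) / 2\<close>. At \<open>y = 1\<close> the denominator is
    \<open>1 + q\<^sup>2 = 1 + s - s\<^sup>2\<close>.\<close>
  also have "\<dots> = ennreal (2 / pi * (q * 1 / (1 + (q * 1)\<^sup>2) + arctan (q * 1)) - 2 / pi * (q * 0 / (1 + (q * 0)\<^sup>2) + arctan (q * 0)))"
  proof (rule nn_integral_FTC_Icc[where F = "\<lambda>y. 2 / pi * (q * y / (1 + (q * y)\<^sup>2) + arctan (q * y))"])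
    fix y :: real
    show "0 \<le> 2 * k / (1 / q\<^sup>2 + y\<^sup>2)\<^sup>2" using k by simp
    have p: "1 + (q * y)\<^sup>2 \<noteq> 0"
      using zero_le_power2[of "q * y"] by linarith
    have d1: "((\<lambda>y. q * y) has_real_derivative q) (at y)"
      by (auto intro!: derivative_eq_intros)
    have d2: "((\<lambda>y. 1 + (q * y)\<^sup>2) has_real_derivative 2 * (q * y) * q) (at y)"
      by (auto intro!: derivative_eq_intros)
    have "((\<lambda>y. 2 / pi * (q * y / (1 + (q * y)\<^sup>2) + arctan (q * y))) has_real_derivative
       2 / pi * ((q * (1 + (q * y)\<^sup>2) - q * y * (2 * (q * y) * q)) / ((1 + (q * y)\<^sup>2) * (1 + (q * y)\<^sup>2))
         + inverse (1 + (q * y)\<^sup>2) * q)) (at y)"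
      by (rule DERIV_cmult[OF DERIV_add[OF DERIV_divide[OF d1 d2 p] DERIV_chain2[OF DERIV_arctan d1]]])
    also have "2 / pi * ((q * (1 + (q * y)\<^sup>2) - q * y * (2 * (q * y) * q)) / ((1 + (q * y)\<^sup>2) * (1 + (q * y)\<^sup>2))
         + inverse (1 + (q * y)\<^sup>2) * q) = 4 * q / (pi * (1 + (q * y)\<^sup>2)\<^sup>2)"
    proof -
      have "(q * x - w * (2 * w * q)) / (x * x) + inverse x * q = 2 * q * (x - w\<^sup>2) / x\<^sup>2" if "x \<noteq> 0" for x w
        using that by (simp add: field_simps power2_eq_square)
      from this[OF p, of "q * y"] show ?thesis by simp
    qed
    also have "1 + (q * y)\<^sup>2 = q\<^sup>2 * (1 / q\<^sup>2 + y\<^sup>2)"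
      using q(1) by (simp add: field_simps)
    also have "4 * q / (pi * (q\<^sup>2 * (1 / q\<^sup>2 + y\<^sup>2))\<^sup>2) = 2 * k / (1 / q\<^sup>2 + y\<^sup>2)\<^sup>2"
    proof -
      have "4 * q / (pi * (q\<^sup>2 * x)\<^sup>2) = 2 * k / x\<^sup>2" for x
        using q(1) by (simp add: k_def power2_eq_square power3_eq_cube)
      then show ?thesis .
    qed
    finally show "((\<lambda>y. 2 / pi * (q * y / (1 + (q * y)\<^sup>2) + arctan (q * y))) has_real_derivative
       2 * k / (1 / q\<^sup>2 + y\<^sup>2)\<^sup>2) (at y)" .
  qed auto
  also have "2 / pi * (q * 1 / (1 + (q * 1)\<^sup>2) + arctan (q * 1)) - 2 / pi * (q * 0 / (1 + (q * 0)\<^sup>2) + arctan (q * 0)) = rho_B s"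
  proof -
    have "1 + q\<^sup>2 = 1 + s - s\<^sup>2"
      unfolding q(2) by (simp add: power2_eq_square algebra_simps)
    then show ?thesis unfolding rho_B_def q_def[symmetric] by simp
  qed
  finally show ?thesis .
qed

subsection \<open>Brownian motion: early maxima\<close>

lemma running_max_increments:
  assumes c: "continuous_on {t..t + h} x" and h: "0 \<le> h"
  shows "running_max x t (t + h) = x t + running_max (\<lambda>r. x (t + r) - x t) 0 h"
proof -
  have c': "continuous_on {0..h} (\<lambda>r. x (t + r) - x t)"
    by (intro continuous_intros continuous_on_compose2[OF c]) auto
  have "running_max x t (t + h) \<le> a \<longleftrightarrow> x t + running_max (\<lambda>r. x (t + r) - x t) 0 h \<le> a" for a
  proof -
    have "running_max x t (t + h) \<le> a \<longleftrightarrow> (\<forall>r\<in>{t..t + h}. x r \<le> a)"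
      using h by (intro running_max_le_iff[OF c]) simp
    also have "\<dots> \<longleftrightarrow> (\<forall>r\<in>{0..h}. x (t + r) - x t \<le> a - x t)"
    proof safe
      fix r assume *: "\<forall>r\<in>{0..h}. x (t + r) - x t \<le> a - x t" "r \<in> {t..t + h}"
      then show "x r \<le> a" using bspec[OF *(1), of "r - t"] by simp
    qed auto
    also have "\<dots> \<longleftrightarrow> running_max (\<lambda>r. x (t + r) - x t) 0 h \<le> a - x t"
      using running_max_le_iff[OF c' h] by simp
    finally show ?thesis by linarith
  qed
  then show ?thesis by (meson order_antisym order_refl)
qed

text \<open>Change of variable to the gap \<open>u = m - x\<close>: on the support \<open>u\<close>
  is nonnegative and \<open>2 * m - x\<close> becomes \<open>m + u\<close>.\<close>

lemma integral_max_end_gap: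
  assumes g[measurable]: "g \<in> borel_measurable borel"
  shows "(\<integral>\<^sup>+x. ennreal (max_end_density t m x) * g x \<partial>lborel)
    = (\<integral>\<^sup>+u. ennreal (2 * (m + u) / t * heat t (m + u)) * g (m - u) * indicator {0..} u \<partial>lborel) * indicator {0..} m"
proof -
  have "(\<integral>\<^sup>+x. ennreal (max_end_density t m x) * g x \<partial>lborel)
    = ennreal \<bar>-1\<bar> * (\<integral>\<^sup>+u. ennreal (max_end_density t m (m + (-1) * u)) * g (m + (-1) * u) \<partial>lborel)"
    by (rule nn_integral_real_affine) auto
  also have "\<dots> = (\<integral>\<^sup>+u. ennreal (2 * (m + u) / t * heat t (m + u)) * g (m - u) * indicator {0..} u * indicator {0..} m \<partial>lborel)"
    by (simp, intro nn_integral_cong) (auto simp: max_end_density_def indicator_def)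
  also have "\<dots> = (\<integral>\<^sup>+u. ennreal (2 * (m + u) / t * heat t (m + u)) * g (m - u) * indicator {0..} u \<partial>lborel) * indicator {0..} m"
    by (rule nn_integral_multc) auto
  finally show ?thesis .
qed

context continuous_brownian
begin

text \<open>Integrating out the endpoint leaves the half-normal law, the classical fact that the
  maximum up to \<open>t\<close> is distributed as the absolute value of \<open>W t\<close>.\<close>

lemma nn_integral_max:
  assumes t: "0 < t" and f[measurable]: "f \<in> borel_measurable borel"
  shows "(\<integral>\<^sup>+\<omega>. f (max_W 0 t \<omega>) \<partial>M)
    = (\<integral>\<^sup>+a. ennreal (2 * heat t a) * f a * indicator {0..} a \<partial>lborel)"
proof -
  have fst_f: "(\<lambda>p. f (fst p)) \<in> borel_measurable (borel :: (real \<times> real) measure)"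
    unfolding borel_prod[symmetric] by measurable
  have "(\<integral>\<^sup>+\<omega>. f (max_W 0 t \<omega>) \<partial>M)
      = (\<integral>\<^sup>+m. \<integral>\<^sup>+x. ennreal (max_end_density t m x) * f m \<partial>lborel \<partial>lborel)"
    using nn_integral_max_end[OF t fst_f] by simp
  also have "\<dots> = (\<integral>\<^sup>+a. ennreal (2 * heat t a) * f a * indicator {0..} a \<partial>lborel)"
  proof (rule nn_integral_cong)
    fix m
    have "(\<integral>\<^sup>+x. ennreal (max_end_density t m x) * f m \<partial>lborel)
      = (\<integral>\<^sup>+x. ennreal (max_end_density t m x) * 1 \<partial>lborel) * f m"
      by (subst nn_integral_multc) auto
    also have "\<dots> = ennreal (2 * heat t m) * indicator {0..} m * f m"
    proof (cases "0 \<le> m")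
      case True
      then show ?thesis
        using integral_shifted_density[OF t, of m 0] by (subst integral_max_end_gap) auto
    qed (subst integral_max_end_gap, auto)
    finally show "(\<integral>\<^sup>+x. ennreal (max_end_density t m x) * f m \<partial>lborel) = ennreal (2 * heat t m) * f m * indicator {0..} m"
      by (simp add: mult_ac)
  qed
  finally show ?thesis .
qed

lemma AE_max_neq:
  assumes t: "0 < t"
  shows "AE \<omega> in M. max_W 0 t \<omega> \<noteq> c"
proof -
  have [measurable]: "(\<lambda>\<omega>. max_W 0 t \<omega>) \<in> borel_measurable M"
    using t by (intro measurable_max) simp_all
  have "(\<integral>\<^sup>+\<omega>. indicator {c} (max_W 0 t \<omega>) \<partial>M)
    = (\<integral>\<^sup>+a. ennreal (2 * heat t a) * indicator {c} a * indicator {0..} a \<partial>lborel)"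
    by (rule nn_integral_max[OF t]) simp
  also have "\<dots> = (\<integral>\<^sup>+a. 0 \<partial>(lborel :: real measure))"
  proof (rule nn_integral_cong_AE)
    show "AE a in lborel. ennreal (2 * heat t a) * indicator {c} a * indicator {0..} a = 0"
      using AE_lborel_singleton[of c] by eventually_elim simp
  qed
  finally have "AE \<omega> in M. indicator {c} (max_W 0 t \<omega>) = (0::ennreal)"
    by (simp only: nn_integral_const mult_zero_left) (subst (asm) nn_integral_0_iff_AE, measurable)
  then show ?thesis by eventually_elim (auto simp: indicator_def split: if_splits)
qed

text \<open>The pair has a density in the plane and the diagonal is a null set. This later excludes
  time 1 as the maximizing time.\<close>

lemma AE_max_neq_end:
  assumes t: "0 < t"
  shows "AE \<omega> in M. max_W 0 t \<omega> \<noteq> W t \<omega>"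
proof -
  have [measurable]: "(\<lambda>\<omega>. max_W 0 t \<omega>) \<in> borel_measurable M"
    using t by (intro measurable_max) simp_all
  have [measurable]: "W t \<in> borel_measurable M" using t by (intro measurable_W) simp
  let ?f = "\<lambda>p :: real \<times> real. if fst p = snd p then 1 else 0 :: ennreal"
  have f: "?f \<in> borel_measurable borel"
    unfolding borel_prod[symmetric] by measurable
  have "(\<integral>\<^sup>+\<omega>. ?f (max_W 0 t \<omega>, W t \<omega>) \<partial>M)
    = (\<integral>\<^sup>+m. \<integral>\<^sup>+x. ennreal (max_end_density t m x) * ?f (m, x) \<partial>lborel \<partial>lborel)"
    by (rule nn_integral_max_end[OF t f])
  also have "\<dots> = (\<integral>\<^sup>+m. \<integral>\<^sup>+x. 0 \<partial>(lborel :: real measure) \<partial>(lborel :: real measure))"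
  proof (intro nn_integral_cong[OF nn_integral_cong_AE])
    fix m :: real
    show "AE x in lborel. ennreal (max_end_density t m x) * ?f (m, x) = 0"
      using AE_lborel_singleton[of m] by eventually_elim auto
  qed
  finally have "AE \<omega> in M. ?f (max_W 0 t \<omega>, W t \<omega>) = 0"
    by (simp only: nn_integral_const mult_zero_left) (subst (asm) nn_integral_0_iff_AE, measurable)
  then show ?thesis by eventually_elim (auto split: if_splits)
qed

lemma max_after:
  assumes "0 \<le> t" "t \<le> r"
  shows "max_W t r \<omega> = W t \<omega> + running_max (\<lambda>r. W (t + r) \<omega> - W t \<omega>) 0 (r - t)"
  using running_max_increments[of t "r - t" "\<lambda>r. W r \<omega>"] continuous_path[of t r \<omega>] assms by simp

lemma nn_integral_past_future:
  assumes t: "0 < t" "t \<le> r"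
    and h: "h \<in> borel_measurable ((borel :: (real \<times> real) measure) \<Otimes>\<^sub>M (borel :: (real \<times> real) measure))"
  shows "(\<integral>\<^sup>+\<omega>. h ((max_W 0 t \<omega>, W t \<omega>),
        (running_max (\<lambda>r. W (t + r) \<omega> - W t \<omega>) 0 (r - t), W r \<omega> - W t \<omega>)) \<partial>M)
    = (\<integral>\<^sup>+\<omega>. (\<integral>\<^sup>+\<omega>'. h ((max_W 0 t \<omega>, W t \<omega>),
        (running_max (\<lambda>r. W (t + r) \<omega>' - W t \<omega>') 0 (r - t), W r \<omega>' - W t \<omega>')) \<partial>M) \<partial>M)"
  using indep_pair_nn_integral[OF indep_max_end_shift[of t "r - t"] h] t by simp

text \<open>A tie means that the rise after \<open>t\<close> equals the gap
  \<open>max_W 0 t - W t\<close>. With the past frozen this gap is a constant, and the independent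
  rise has no atoms.\<close>

lemma AE_early_late_max_neq:
  assumes t: "0 < t" "t < r"
  shows "AE \<omega> in M. max_W 0 t \<omega> \<noteq> max_W t r \<omega>"
proof -
  interpret S: continuous_brownian M "\<lambda>h \<omega>. W (t + h) \<omega> - W t \<omega>"
    using t by (intro brownian_shift) simp
  have [measurable]: "(\<lambda>\<omega>. max_W 0 t \<omega>) \<in> borel_measurable M"
    "(\<lambda>\<omega>. max_W t r \<omega>) \<in> borel_measurable M"
    using t by (intro measurable_max; simp)+
  have [measurable]: "W t \<in> borel_measurable M" using t by (intro measurable_W) simp
  have [measurable]: "(\<lambda>\<omega>. running_max (\<lambda>r. W (t + r) \<omega> - W t \<omega>) 0 (r - t)) \<in> borel_measurable M"
    using t by (intro S.measurable_max) simp_all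
  let ?h = "\<lambda>p :: (real \<times> real) \<times> (real \<times> real). if fst (fst p) - snd (fst p) = fst (snd p) then 1 else 0 :: ennreal"
  have h: "?h \<in> borel_measurable (borel \<Otimes>\<^sub>M borel)"
    unfolding borel_prod[symmetric] by measurable
  have "(\<integral>\<^sup>+\<omega>. (if max_W 0 t \<omega> - W t \<omega> = running_max (\<lambda>r. W (t + r) \<omega> - W t \<omega>) 0 (r - t) then 1 else 0) \<partial>M)
    = (\<integral>\<^sup>+\<omega>. (\<integral>\<^sup>+\<omega>'. (if max_W 0 t \<omega> - W t \<omega> = running_max (\<lambda>r. W (t + r) \<omega>' - W t \<omega>') 0 (r - t) then 1 else 0) \<partial>M) \<partial>M)"
    using nn_integral_past_future[OF t(1) less_imp_le[OF t(2)] h] by (simp only: fst_conv snd_conv)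
  also have "\<dots> = (\<integral>\<^sup>+\<omega>. (\<integral>\<^sup>+\<omega>'. 0 \<partial>M) \<partial>M)"
  proof (intro nn_integral_cong[OF nn_integral_cong_AE])
    fix \<omega>
    show "AE \<omega>' in M. (if max_W 0 t \<omega> - W t \<omega> = running_max (\<lambda>r. W (t + r) \<omega>' - W t \<omega>') 0 (r - t) then 1 else 0) = (0::ennreal)"
    proof -
      have "AE \<omega>' in M. running_max (\<lambda>r. W (t + r) \<omega>' - W t \<omega>') 0 (r - t) \<noteq> max_W 0 t \<omega> - W t \<omega>"
        using t by (intro S.AE_max_neq) simp
      then show ?thesis by eventually_elim auto
    qed
  qed
  finally have "AE \<omega> in M. (if max_W 0 t \<omega> - W t \<omega> = running_max (\<lambda>r. W (t + r) \<omega> - W t \<omega>) 0 (r - t) then 1 else 0) = (0::ennreal)"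
    by (simp only: nn_integral_const mult_zero_left) (subst (asm) nn_integral_0_iff_AE, measurable)
  then show ?thesis
  proof eventually_elim
    case (elim \<omega>)
    then show ?case using max_after[of t r \<omega>] t by (auto split: if_splits)
  qed
qed

text \<open>The event says that the rise after \<open>t\<close> does not exceed the gap at
  \<open>t\<close>. The two are independent, so the rise enters through its distribution function
  and the past through the joint law of maximum and endpoint.\<close>

lemma early_max_law:
  assumes t: "0 < t" "t < 1" and f[measurable]: "f \<in> borel_measurable borel"
  shows "(\<integral>\<^sup>+\<omega>. (if max_W t 1 \<omega> \<le> max_W 0 t \<omega>
        then f (max_W 0 t \<omega>) else 0) \<partial>M)
    = (\<integral>\<^sup>+a. f a * ennreal (early_max_W t a) * indicator {0..} a \<partial>lborel)"
proof -
  interpret S: continuous_brownian M "\<lambda>h \<omega>. W (t + h) \<omega> - W t \<omega>"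
    using t by (intro brownian_shift) simp
  let ?A = "\<lambda>\<omega>. max_W 0 t \<omega>" and ?V = "\<lambda>\<omega>. running_max (\<lambda>r. W (t + r) \<omega> - W t \<omega>) 0 (1 - t)"
  let ?h = "\<lambda>p :: (real \<times> real) \<times> (real \<times> real). if fst (snd p) \<le> fst (fst p) - snd (fst p) then f (fst (fst p)) else 0"
  have h: "?h \<in> borel_measurable (borel \<Otimes>\<^sub>M borel)"
    unfolding borel_prod[symmetric] by measurable
  \<comment> \<open>\<open>H\<close> is the distribution function of the rise after
    \<open>t\<close>, kept as an integral so that the order of integration can be exchanged
    below.\<close>
  define H where "H u = (\<integral>\<^sup>+v. ennreal (2 * heat (1 - t) v) * indicator {..u} v * indicator {0..} v \<partial>lborel)" for u
  have H[measurable]: "H \<in> borel_measurable borel"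
  proof -
    have "(\<lambda>p. ennreal (2 * heat (1 - t) (snd p)) * (if snd p \<le> fst p then 1 else 0) * indicator {0..} (snd p))
        \<in> borel_measurable (borel \<Otimes>\<^sub>M lborel)"
      by measurable
    then have "(\<lambda>u. \<integral>\<^sup>+v. ennreal (2 * heat (1 - t) v) * (if v \<le> u then 1 else 0) * indicator {0..} v \<partial>lborel)
        \<in> borel_measurable borel"
      using lborel.borel_measurable_nn_integral_fst[of "\<lambda>p. ennreal (2 * heat (1 - t) (snd p)) * (if snd p \<le> fst p then 1 else 0) * indicator {0..} (snd p)" borel]
      by simp
    then show ?thesis
      unfolding H_def[abs_def] by (simp add: indicator_def of_bool_def)
  qed
  have "(\<integral>\<^sup>+\<omega>. (if max_W t 1 \<omega> \<le> ?A \<omega> then f (?A \<omega>) else 0) \<partial>M)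
     = (\<integral>\<^sup>+\<omega>. (if ?V \<omega> \<le> ?A \<omega> - W t \<omega> then f (?A \<omega>) else 0) \<partial>M)"
    using t by (intro nn_integral_cong) (simp add: max_after algebra_simps)
  also have "\<dots> = (\<integral>\<^sup>+\<omega>. (\<integral>\<^sup>+\<omega>'. (if ?V \<omega>' \<le> ?A \<omega> - W t \<omega> then f (?A \<omega>) else 0) \<partial>M) \<partial>M)"
    using nn_integral_past_future[OF t(1) less_imp_le[OF t(2)] h] by (simp only: fst_conv snd_conv)
  also have "\<dots> = (\<integral>\<^sup>+\<omega>. f (?A \<omega>) * H (?A \<omega> - W t \<omega>) \<partial>M)"
  proof (rule nn_integral_cong)
    fix \<omega>
    have [measurable]: "?V \<in> borel_measurable M" using t by (intro S.measurable_max) simp_all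
    have "(\<integral>\<^sup>+\<omega>'. (if ?V \<omega>' \<le> ?A \<omega> - W t \<omega> then f (?A \<omega>) else 0) \<partial>M)
       = (\<integral>\<^sup>+\<omega>'. f (?A \<omega>) * indicator {..?A \<omega> - W t \<omega>} (?V \<omega>') \<partial>M)"
      by (intro nn_integral_cong) (auto simp: indicator_def)
    also have "\<dots> = f (?A \<omega>) * (\<integral>\<^sup>+\<omega>'. indicator {..?A \<omega> - W t \<omega>} (?V \<omega>') \<partial>M)"
      by (rule nn_integral_cmult) measurable
    also have "(\<integral>\<^sup>+\<omega>'. indicator {..?A \<omega> - W t \<omega>} (?V \<omega>') \<partial>M) = H (?A \<omega> - W t \<omega>)"
      unfolding H_def using t by (intro S.nn_integral_max) auto
    finally show "(\<integral>\<^sup>+\<omega>'. (if ?V \<omega>' \<le> ?A \<omega> - W t \<omega> then f (?A \<omega>) else 0) \<partial>M) = f (?A \<omega>) * H (?A \<omega> - W t \<omega>)" .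
  qed
  also have "\<dots> = (\<integral>\<^sup>+m. \<integral>\<^sup>+x. ennreal (max_end_density t m x) * (f m * H (m - x)) \<partial>lborel \<partial>lborel)"
  proof -
    have "(\<lambda>p. f (fst p) * H (fst p - snd p)) \<in> borel_measurable (borel :: (real \<times> real) measure)"
      unfolding borel_prod[symmetric] by measurable
    from nn_integral_max_end[OF t(1) this] show ?thesis by simp
  qed
  also have "\<dots> = (\<integral>\<^sup>+a. f a * ennreal (early_max_W t a) * indicator {0..} a \<partial>lborel)"
  proof (rule nn_integral_cong)
    fix m :: real
    have "(\<integral>\<^sup>+x. ennreal (max_end_density t m x) * (f m * H (m - x)) \<partial>lborel)
      = (\<integral>\<^sup>+x. ennreal (max_end_density t m x) * H (m - x) \<partial>lborel) * f m"
      by (subst nn_integral_multc[symmetric]) (auto simp: mult_ac)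
    also have "(\<integral>\<^sup>+x. ennreal (max_end_density t m x) * H (m - x) \<partial>lborel)
      = (\<integral>\<^sup>+u. ennreal (2 * (m + u) / t * heat t (m + u)) * H u * indicator {0..} u \<partial>lborel) * indicator {0..} m"
      by (subst integral_max_end_gap) auto
    also have "\<dots> = ennreal (early_max_W t m) * indicator {0..} m"
    proof (cases "0 \<le> m")
      case True
      have "(\<integral>\<^sup>+u. ennreal (2 * (m + u) / t * heat t (m + u)) * H u * indicator {0..} u \<partial>lborel)
        = (\<integral>\<^sup>+u. \<integral>\<^sup>+v. ennreal (2 * (m + u) / t * heat t (m + u)) * ennreal (2 * heat (1 - t) v)
             * (if 0 \<le> v \<and> v \<le> u then 1 else 0) \<partial>lborel \<partial>lborel)"
      proof (rule nn_integral_cong)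
        fix u :: real
        have "ennreal (2 * (m + u) / t * heat t (m + u)) * H u * indicator {0..} u
          = (\<integral>\<^sup>+v. ennreal (2 * (m + u) / t * heat t (m + u)) * (ennreal (2 * heat (1 - t) v) * indicator {..u} v * indicator {0..} v) \<partial>lborel) * indicator {0..} u"
          unfolding H_def by (subst nn_integral_cmult) auto
        also have "\<dots> = (\<integral>\<^sup>+v. ennreal (2 * (m + u) / t * heat t (m + u)) * (ennreal (2 * heat (1 - t) v) * indicator {..u} v * indicator {0..} v) * indicator {0..} u \<partial>lborel)"
          by (rule nn_integral_multc[symmetric]) measurable
        also have "\<dots> = (\<integral>\<^sup>+v. ennreal (2 * (m + u) / t * heat t (m + u)) * ennreal (2 * heat (1 - t) v)
             * (if 0 \<le> v \<and> v \<le> u then 1 else 0) \<partial>lborel)"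
          by (rule nn_integral_cong) (auto simp: indicator_def)
        finally show "ennreal (2 * (m + u) / t * heat t (m + u)) * H u * indicator {0..} u
          = (\<integral>\<^sup>+v. ennreal (2 * (m + u) / t * heat t (m + u)) * ennreal (2 * heat (1 - t) v)
             * (if 0 \<le> v \<and> v \<le> u then 1 else 0) \<partial>lborel)" .
      qed
      \<comment> \<open>With the gap \<open>u\<close> innermost, running over
        \<open>u \<ge> v\<close>, the inner integral is elementary.\<close>
      also have "\<dots> = (\<integral>\<^sup>+v. \<integral>\<^sup>+u. ennreal (2 * (m + u) / t * heat t (m + u)) * ennreal (2 * heat (1 - t) v)
             * (if 0 \<le> v \<and> v \<le> u then 1 else 0) \<partial>lborel \<partial>lborel)"
        by (rule lborel_pair.Fubini'[symmetric]) measurable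
      also have "\<dots> = (\<integral>\<^sup>+v. ennreal (2 * heat (1 - t) v * (2 * heat t (m + v))) * indicator {0..} v \<partial>lborel)"
      proof (rule nn_integral_cong)
        fix v :: real
        have "(\<integral>\<^sup>+u. ennreal (2 * (m + u) / t * heat t (m + u)) * ennreal (2 * heat (1 - t) v)
             * (if 0 \<le> v \<and> v \<le> u then 1 else 0) \<partial>lborel)
          = (\<integral>\<^sup>+u. ennreal (2 * heat (1 - t) v) * indicator {0..} v * (ennreal (2 * (m + u) / t * heat t (m + u)) * indicator {v..} u) \<partial>lborel)"
          by (intro nn_integral_cong) (auto simp: indicator_def mult_ac)
        also have "\<dots> = ennreal (2 * heat (1 - t) v) * indicator {0..} v * (\<integral>\<^sup>+u. ennreal (2 * (m + u) / t * heat t (m + u)) * indicator {v..} u \<partial>lborel)"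
          by (rule nn_integral_cmult) measurable
        also have "\<dots> = ennreal (2 * heat (1 - t) v * (2 * heat t (m + v))) * indicator {0..} v"
        proof (cases "0 \<le> v")
          case v: True
          show ?thesis
            using True v t by (subst integral_shifted_density) (auto simp: ennreal_mult''[symmetric])
        qed simp
        finally show "(\<integral>\<^sup>+u. ennreal (2 * (m + u) / t * heat t (m + u)) * ennreal (2 * heat (1 - t) v)
             * (if 0 \<le> v \<and> v \<le> u then 1 else 0) \<partial>lborel) = ennreal (2 * heat (1 - t) v * (2 * heat t (m + v))) * indicator {0..} v" .
      qed
      also have "\<dots> = ennreal (early_max_W t m)"
        by (rule early_max_W_integral[OF t])
      finally show ?thesis by simp
    qed simp
    finally show "(\<integral>\<^sup>+x. ennreal (max_end_density t m x) * (f m * H (m - x)) \<partial>lborel)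
      = f m * ennreal (early_max_W t m) * indicator {0..} m" by (simp add: mult_ac)
  qed
  finally show ?thesis .
qed

end

subsection \<open>Pinning the endpoint\<close>

lemma heat_le: "0 < t \<Longrightarrow> heat t x \<le> 1 / sqrt (2 * pi * t)"
  using heat_antimono[of 0 x t] by (simp add: heat_eq)

lemma heat_affine:
  assumes d: "0 < d"
  shows "sqrt d * heat d (sqrt d * z) = std_normal_density z"
proof -
  have "(sqrt d * z)\<^sup>2 / (2 * d) = z\<^sup>2 / 2"
    using d by (simp add: power_mult_distrib)
  then show ?thesis
    using d by (simp add: heat_eq[OF d] std_normal_density_def real_sqrt_mult)
qed

lemma tendsto_heat:
  assumes "(s \<longlongrightarrow> s0) F" "(x \<longlongrightarrow> x0) F" "0 < s0"
  shows "((\<lambda>n. heat (s n) (x n)) \<longlongrightarrow> heat s0 x0) F"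
  unfolding normal_density_def using assms by (intro tendsto_intros) auto

text \<open>Transition density over time \<open>T - d\<close> of a Brownian motion killed above \<open>u\<close>, paired with the
  heat kernel over the remaining time \<open>d\<close>: the value at time \<open>T\<close> is pinned to \<open>- x\<close>.\<close>

definition pinned_mass :: "real \<Rightarrow> real \<Rightarrow> real \<Rightarrow> real \<Rightarrow> ennreal" where
  "pinned_mass T d x u = (\<integral>\<^sup>+y. ennreal (heat (T - d) y - heat (T - d) (2 * u - y)) *
      ennreal (heat d (x + y)) * indicator {..u} y \<partial>lborel)"

text \<open>Substituting \<open>y = sqrt d * z - x\<close> turns the kernel that concentrates as
  \<open>d\<close> tends to 0 into a fixed normal density, which makes dominated convergence
  available.\<close>

lemma pinned_mass_scaled:
  assumes d: "0 < d"
  shows "pinned_mass T d x u = (\<integral>\<^sup>+z. ennreal (heat (T - d) (sqrt d * z - x) - heat (T - d) (2 * u + x - sqrt d * z)) *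
      ennreal (std_normal_density z) * indicator {..u} (sqrt d * z - x) \<partial>lborel)"
proof -
  have "pinned_mass T d x u = ennreal \<bar>sqrt d\<bar> * (\<integral>\<^sup>+z. ennreal (heat (T - d) (- x + sqrt d * z) - heat (T - d) (2 * u - (- x + sqrt d * z))) *
      ennreal (heat d (x + (- x + sqrt d * z))) * indicator {..u} (- x + sqrt d * z) \<partial>lborel)"
    unfolding pinned_mass_def using d by (intro nn_integral_real_affine) auto
  also have "\<dots> = (\<integral>\<^sup>+z. ennreal \<bar>sqrt d\<bar> * (ennreal (heat (T - d) (- x + sqrt d * z) - heat (T - d) (2 * u - (- x + sqrt d * z))) *
      ennreal (heat d (x + (- x + sqrt d * z))) * indicator {..u} (- x + sqrt d * z)) \<partial>lborel)"
    by (rule nn_integral_cmult[symmetric]) measurable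
  also have "\<dots> = (\<integral>\<^sup>+z. ennreal (heat (T - d) (sqrt d * z - x) - heat (T - d) (2 * u + x - sqrt d * z)) *
      ennreal (std_normal_density z) * indicator {..u} (sqrt d * z - x) \<partial>lborel)"
  proof (rule nn_integral_cong)
    fix z
    have *: "ennreal \<bar>sqrt d\<bar> * ennreal (heat d (x + (- x + sqrt d * z))) = ennreal (std_normal_density z)"
      using heat_affine[OF d, of z] d by (simp flip: ennreal_mult)
    have **: "- x + sqrt d * z = sqrt d * z - x" "2 * u - (sqrt d * z - x) = 2 * u + x - sqrt d * z" by auto
    note * = *[unfolded **]
    show "ennreal \<bar>sqrt d\<bar> * (ennreal (heat (T - d) (- x + sqrt d * z) - heat (T - d) (2 * u - (- x + sqrt d * z))) *
      ennreal (heat d (x + (- x + sqrt d * z))) * indicator {..u} (- x + sqrt d * z))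
      = ennreal (heat (T - d) (sqrt d * z - x) - heat (T - d) (2 * u + x - sqrt d * z)) *
      ennreal (std_normal_density z) * indicator {..u} (sqrt d * z - x)"
    proof -
      have "k * (a * b * i) = a * (k * b) * i" for k a b i :: ennreal
        by (simp add: mult_ac)
      then show ?thesis by (simp only: ** *)
    qed
  qed
  finally show ?thesis .
qed

lemma nn_integral_std_normal: "(\<integral>\<^sup>+z. ennreal (std_normal_density z) \<partial>lborel) = 1"
  by (subst nn_integral_eq_integral) auto

text \<open>\<open>d \<le> T / 2\<close> keeps the elapsed time at least \<open>T / 2\<close>, so
  the peak of the kernel is bounded uniformly in \<open>d\<close>.\<close>

lemma killed_heat_le:
  assumes "0 < T" "0 < d" "d \<le> T / 2"
  shows "heat (T - d) y - heat (T - d) z \<le> 1 / sqrt (pi * T)"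
proof -
  have "heat (T - d) y - heat (T - d) z \<le> 1 / sqrt (2 * pi * (T - d))"
    using heat_le[of "T - d" y] assms normal_density_nonneg[of 0 "sqrt (T - d)" z] by linarith
  also have "\<dots> \<le> 1 / sqrt (pi * T)"
    using assms by (intro divide_left_mono real_sqrt_le_mono mult_pos_pos) (auto simp: field_simps)
  finally show ?thesis .
qed

lemma pinned_mass_bound:
  assumes T: "0 < T" and d: "0 < d" "d \<le> T / 2"
  shows "pinned_mass T d x u \<le> ennreal (1 / sqrt (pi * T))"
proof -
  have "pinned_mass T d x u \<le> (\<integral>\<^sup>+z. ennreal (1 / sqrt (pi * T)) * ennreal (std_normal_density z) \<partial>lborel)"
    unfolding pinned_mass_scaled[OF d(1)]
  proof (rule nn_integral_mono)
    fix z :: real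
    have "ennreal (heat (T - d) (sqrt d * z - x) - heat (T - d) (2 * u + x - sqrt d * z)) \<le> ennreal (1 / sqrt (pi * T))"
      by (rule ennreal_leI[OF killed_heat_le[OF T d]])
    then show "ennreal (heat (T - d) (sqrt d * z - x) - heat (T - d) (2 * u + x - sqrt d * z)) *
      ennreal (std_normal_density z) * indicator {..u} (sqrt d * z - x) \<le> ennreal (1 / sqrt (pi * T)) * ennreal (std_normal_density z)"
      by (auto simp: indicator_def intro: mult_right_mono)
  qed
  also have "\<dots> = ennreal (1 / sqrt (pi * T))"
    by (subst nn_integral_cmult) (auto simp: nn_integral_std_normal)
  finally show ?thesis .
qed

text \<open>The kernel over time \<open>d\<close> acts as a point mass at \<open>y = - x\<close>.
  The hypothesis \<open>0 < x + u\<close> places this point strictly below the killing level, where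
  the cut-off is not felt.\<close>

lemma pinned_mass_limit:
  assumes T: "0 < T" and d: "\<And>n. 0 < d n" "\<And>n. d n \<le> T / 2" "d \<longlonglongrightarrow> 0" and xu: "0 < x + u"
  shows "(\<lambda>n. pinned_mass T (d n) x u) \<longlonglongrightarrow> ennreal (heat T x - heat T (2 * u + x))"
proof -
  let ?f = "\<lambda>n z. ennreal (heat (T - d n) (sqrt (d n) * z - x) - heat (T - d n) (2 * u + x - sqrt (d n) * z)) *
      ennreal (std_normal_density z) * indicator {..u} (sqrt (d n) * z - x)"
  let ?c = "heat T x - heat T (2 * u + x)"
  have "(\<lambda>n. \<integral>\<^sup>+z. ?f n z \<partial>lborel) \<longlonglongrightarrow> (\<integral>\<^sup>+z. ennreal ?c * ennreal (std_normal_density z) \<partial>lborel)"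
  proof (rule nn_integral_dominated_convergence[where w = "\<lambda>z. ennreal (1 / sqrt (pi * T)) * ennreal (std_normal_density z)"])
    show "(\<integral>\<^sup>+z. ennreal (1 / sqrt (pi * T)) * ennreal (std_normal_density z) \<partial>lborel) < \<infinity>"
      by (subst nn_integral_cmult) (auto simp: nn_integral_std_normal)
    show "AE z in lborel. ?f n z \<le> ennreal (1 / sqrt (pi * T)) * ennreal (std_normal_density z)" for n
    proof (rule AE_I2)
      fix z :: real
      have "ennreal (heat (T - d n) (sqrt (d n) * z - x) - heat (T - d n) (2 * u + x - sqrt (d n) * z)) \<le> ennreal (1 / sqrt (pi * T))"
        by (rule ennreal_leI[OF killed_heat_le[OF T d(1,2)]])
      then show "?f n z \<le> ennreal (1 / sqrt (pi * T)) * ennreal (std_normal_density z)"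
        by (auto simp: indicator_def intro: mult_right_mono)
    qed
    show "AE z in lborel. (\<lambda>n. ?f n z) \<longlonglongrightarrow> ennreal ?c * ennreal (std_normal_density z)"
    proof (rule AE_I2)
      fix z :: real
      have Td: "(\<lambda>n. T - d n) \<longlonglongrightarrow> T" using tendsto_diff[OF tendsto_const d(3), of T] by simp
      have y: "(\<lambda>n. sqrt (d n) * z) \<longlonglongrightarrow> 0"
        using tendsto_mult[OF tendsto_real_sqrt[OF d(3)] tendsto_const[of z]] by simp
      have y1: "(\<lambda>n. sqrt (d n) * z - x) \<longlonglongrightarrow> - x"
        using tendsto_diff[OF y tendsto_const[of x]] by simp
      have y2: "(\<lambda>n. 2 * u + x - sqrt (d n) * z) \<longlonglongrightarrow> 2 * u + x"
        using tendsto_diff[OF tendsto_const[of "2 * u + x"] y] by simp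
      have "eventually (\<lambda>n. sqrt (d n) * z - x < u) sequentially"
        using y1 xu by (intro order_tendstoD(2)[OF y1]) simp
      then have ev: "eventually (\<lambda>n. indicator {..u} (sqrt (d n) * z - x) = (1::ennreal)) sequentially"
        by eventually_elim auto
      have "(\<lambda>n. heat (T - d n) (sqrt (d n) * z - x) - heat (T - d n) (2 * u + x - sqrt (d n) * z)) \<longlonglongrightarrow> heat T (- x) - heat T (2 * u + x)"
        by (intro tendsto_diff tendsto_heat Td y1 y2 T)
      then have "(\<lambda>n. heat (T - d n) (sqrt (d n) * z - x) - heat (T - d n) (2 * u + x - sqrt (d n) * z)) \<longlonglongrightarrow> ?c"
        unfolding heat_minus .
      then have "(\<lambda>n. ennreal (heat (T - d n) (sqrt (d n) * z - x) - heat (T - d n) (2 * u + x - sqrt (d n) * z)) *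
          ennreal (std_normal_density z) * indicator {..u} (sqrt (d n) * z - x)) \<longlonglongrightarrow> ennreal ?c * ennreal (std_normal_density z) * 1"
        by (intro tendsto_mult_ennreal tendsto_ennrealI tendsto_const tendsto_eventually[OF ev]) auto
      then show "(\<lambda>n. ?f n z) \<longlonglongrightarrow> ennreal ?c * ennreal (std_normal_density z)" by simp
    qed
  qed auto
  also have "(\<integral>\<^sup>+z. ennreal ?c * ennreal (std_normal_density z) \<partial>lborel) = ennreal ?c"
    by (subst nn_integral_cmult) (auto simp: nn_integral_std_normal)
  finally show ?thesis
    unfolding pinned_mass_scaled[OF d(1)] .
qed

lemma measurable_pinned_mass:
  "(\<lambda>p. pinned_mass T d (fst p) (snd p)) \<in> borel_measurable (borel \<Otimes>\<^sub>M borel)"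
proof -
  have "(\<lambda>q. ennreal (heat (T - d) (snd q) - heat (T - d) (2 * snd (fst q) - snd q)) *
      ennreal (heat d (fst (fst q) + snd q)) * (if snd q \<le> snd (fst q) then 1 else 0))
      \<in> borel_measurable ((borel \<Otimes>\<^sub>M borel) \<Otimes>\<^sub>M lborel)"
    by measurable
  from lborel.borel_measurable_nn_integral_fst[OF this] show ?thesis
    unfolding pinned_mass_def by (simp add: indicator_def of_bool_def)
qed

context continuous_brownian
begin

text \<open>Integrating out the maximum first gives the kernel
  \<open>heat t x - heat t (2 * u - x)\<close> of the motion killed above \<open>u\<close>.\<close>

lemma nn_integral_killed:
  assumes t: "0 < t" and u: "0 \<le> u" and g[measurable]: "g \<in> borel_measurable borel"
  shows "(\<integral>\<^sup>+\<omega>. (if max_W 0 t \<omega> \<le> u then g (W t \<omega>) else 0) \<partial>M)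
    = (\<integral>\<^sup>+x. ennreal (heat t x - heat t (2 * u - x)) * g x * indicator {..u} x \<partial>lborel)"
proof -
  have f: "(\<lambda>p. if fst p \<le> u then g (snd p) else 0) \<in> borel_measurable (borel :: (real \<times> real) measure)"
    unfolding borel_prod[symmetric] by measurable
  have "(\<integral>\<^sup>+\<omega>. (if max_W 0 t \<omega> \<le> u then g (W t \<omega>) else 0) \<partial>M)
    = (\<integral>\<^sup>+m. \<integral>\<^sup>+x. ennreal (max_end_density t m x) * (if m \<le> u then g x else 0) \<partial>lborel \<partial>lborel)"
    using nn_integral_max_end[OF t f] by (simp only: fst_conv snd_conv)
  also have "\<dots> = (\<integral>\<^sup>+x. \<integral>\<^sup>+m. ennreal (max_end_density t m x) * (if m \<le> u then g x else 0) \<partial>lborel \<partial>lborel)"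
    by (rule lborel_pair.Fubini'[symmetric]) (simp add: split_beta')
  also have "\<dots> = (\<integral>\<^sup>+x. ennreal (heat t x - heat t (2 * u - x)) * g x * indicator {..u} x \<partial>lborel)"
  proof (rule nn_integral_cong)
    fix x
    have "(\<integral>\<^sup>+m. ennreal (max_end_density t m x) * (if m \<le> u then g x else 0) \<partial>lborel)
      = (\<integral>\<^sup>+m. ennreal (max_end_density t m x) * indicator {..u} m * g x \<partial>lborel)"
      by (intro nn_integral_cong) (auto simp: indicator_def)
    also have "\<dots> = (\<integral>\<^sup>+m. ennreal (max_end_density t m x) * indicator {..u} m \<partial>lborel) * g x"
      by (rule nn_integral_multc) measurable
    also have "\<dots> = ennreal (heat t x - heat t (2 * u - x)) * g x * indicator {..u} x"
      unfolding integral_max_end_density[OF t] using u by (auto simp: indicator_def)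
    finally show "(\<integral>\<^sup>+m. ennreal (max_end_density t m x) * (if m \<le> u then g x else 0) \<partial>lborel)
      = ennreal (heat t x - heat t (2 * u - x)) * g x * indicator {..u} x" .
  qed
  finally show ?thesis .
qed

lemma pinned_max_limit:
  assumes d: "\<And>n. 0 < d n" "\<And>n. d n \<le> 1 / 2" "d \<longlonglongrightarrow> 0" and m: "0 < m"
  shows "(\<lambda>n. \<integral>\<^sup>+\<omega>. (if max_W 0 (1 - d n) \<omega> \<le> m then ennreal (heat (d n) (W (1 - d n) \<omega>)) else 0) \<partial>M)
    \<longlonglongrightarrow> ennreal (heat 1 0 - heat 1 (2 * m))"
proof -
  have "(\<integral>\<^sup>+\<omega>. (if max_W 0 (1 - d n) \<omega> \<le> m then ennreal (heat (d n) (W (1 - d n) \<omega>)) else 0) \<partial>M)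
     = pinned_mass 1 (d n) 0 m" for n
    unfolding pinned_mass_def using d(2)[of n] m by (subst nn_integral_killed) auto
  moreover have "(\<lambda>n. pinned_mass 1 (d n) 0 m) \<longlonglongrightarrow> ennreal (heat 1 0 - heat 1 (2 * m + 0))"
    using d m by (intro pinned_mass_limit) auto
  ultimately show ?thesis by simp
qed

text \<open>Given the past, the future up to \<open>1 - d n\<close> contributes the mass of a path
  that stays below the early maximum and is pinned at the end: \<open>pinned_mass\<close> with
  remaining time \<open>1 - t\<close>, start \<open>W t\<close> and room
  \<open>max_W 0 t - W t\<close>. The bound on \<open>f\<close> and the uniform bound on the mass
  allow the limit under the outer integral.\<close>

lemma pinned_early_max_limit:
  assumes t: "0 < t" "t < 1" and f[measurable]: "f \<in> borel_measurable borel" and f1: "\<And>a. f a \<le> 1"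
    and d: "\<And>n. 0 < d n" "\<And>n. d n \<le> (1 - t) / 2" "d \<longlonglongrightarrow> 0"
  shows "(\<lambda>n. \<integral>\<^sup>+\<omega>. (if max_W t (1 - d n) \<omega> \<le> max_W 0 t \<omega>
        then f (max_W 0 t \<omega>) * ennreal (heat (d n) (W (1 - d n) \<omega>)) else 0) \<partial>M)
    \<longlonglongrightarrow> ennreal (heat 1 0) * (\<integral>\<^sup>+a. f a * ennreal (early_max_B t a) * indicator {0..} a \<partial>lborel)"
proof -
  interpret S: continuous_brownian M "\<lambda>h \<omega>. W (t + h) \<omega> - W t \<omega>"
    using t by (intro brownian_shift) simp
  let ?A = "\<lambda>\<omega>. max_W 0 t \<omega>"
  have [measurable]: "?A \<in> borel_measurable M" using t by (intro measurable_max) auto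
  have [measurable]: "W t \<in> borel_measurable M" using t by (intro measurable_W) auto
  have pm[measurable]: "(\<lambda>\<omega>. pinned_mass (1 - t) (d n) (W t \<omega>) (?A \<omega> - W t \<omega>)) \<in> borel_measurable M" for n
    using measurable_compose[OF _ measurable_pinned_mass, of "\<lambda>\<omega>. (W t \<omega>, ?A \<omega> - W t \<omega>)" M "1 - t" "d n"] by simp
  have step: "(\<integral>\<^sup>+\<omega>. (if max_W t (1 - d n) \<omega> \<le> ?A \<omega>
        then f (?A \<omega>) * ennreal (heat (d n) (W (1 - d n) \<omega>)) else 0) \<partial>M)
     = (\<integral>\<^sup>+\<omega>. f (?A \<omega>) * pinned_mass (1 - t) (d n) (W t \<omega>) (?A \<omega> - W t \<omega>) \<partial>M)" for n
  proof -
    let ?r = "1 - d n"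
    let ?V = "\<lambda>\<omega>. running_max (\<lambda>r. W (t + r) \<omega> - W t \<omega>) 0 (?r - t)"
    have tr: "t < ?r" using d(2)[of n] t by (simp add: field_simps)
    let ?h = "\<lambda>p :: (real \<times> real) \<times> (real \<times> real). if fst (snd p) \<le> fst (fst p) - snd (fst p)
       then f (fst (fst p)) * ennreal (heat (d n) (snd (fst p) + snd (snd p))) else 0"
    have h: "?h \<in> borel_measurable (borel \<Otimes>\<^sub>M borel)"
      unfolding borel_prod[symmetric] by measurable
    have "(\<integral>\<^sup>+\<omega>. (if running_max (\<lambda>r. W r \<omega>) t ?r \<le> ?A \<omega> then f (?A \<omega>) * ennreal (heat (d n) (W ?r \<omega>)) else 0) \<partial>M)
       = (\<integral>\<^sup>+\<omega>. (if ?V \<omega> \<le> ?A \<omega> - W t \<omega> then f (?A \<omega>) * ennreal (heat (d n) (W t \<omega> + (W ?r \<omega> - W t \<omega>))) else 0) \<partial>M)"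
      using t tr by (intro nn_integral_cong) (simp add: max_after algebra_simps)
    also have "\<dots> = (\<integral>\<^sup>+\<omega>. (\<integral>\<^sup>+\<omega>'. (if ?V \<omega>' \<le> ?A \<omega> - W t \<omega> then f (?A \<omega>) * ennreal (heat (d n) (W t \<omega> + (W ?r \<omega>' - W t \<omega>'))) else 0) \<partial>M) \<partial>M)"
      using nn_integral_past_future[OF t(1) less_imp_le[OF tr] h] by (simp only: fst_conv snd_conv)
    also have "\<dots> = (\<integral>\<^sup>+\<omega>. f (?A \<omega>) * pinned_mass (1 - t) (d n) (W t \<omega>) (?A \<omega> - W t \<omega>) \<partial>M)"
    proof (rule nn_integral_cong)
      fix \<omega>
      let ?u = "?A \<omega> - W t \<omega>"
      have u: "0 \<le> ?u"
        using running_max_upper[OF continuous_path, of 0 t t] t by simp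
      have [measurable]: "?V \<in> borel_measurable M" using tr by (intro S.measurable_max) simp_all
      have [measurable]: "W ?r \<in> borel_measurable M" using t tr by (intro measurable_W) simp
      have [measurable]: "W (t + (?r - t)) \<in> borel_measurable M" using t tr by (intro measurable_W) simp
      have "(\<integral>\<^sup>+\<omega>'. (if ?V \<omega>' \<le> ?u then f (?A \<omega>) * ennreal (heat (d n) (W t \<omega> + (W ?r \<omega>' - W t \<omega>'))) else 0) \<partial>M)
        = (\<integral>\<^sup>+\<omega>'. f (?A \<omega>) * (if ?V \<omega>' \<le> ?u then ennreal (heat (d n) (W t \<omega> + (W (t + (?r - t)) \<omega>' - W t \<omega>'))) else 0) \<partial>M)"
        by (intro nn_integral_cong) auto
      also have "\<dots> = f (?A \<omega>) * (\<integral>\<^sup>+\<omega>'. (if ?V \<omega>' \<le> ?u then ennreal (heat (d n) (W t \<omega> + (W (t + (?r - t)) \<omega>' - W t \<omega>'))) else 0) \<partial>M)"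
        by (rule nn_integral_cmult) simp
      also have "(\<integral>\<^sup>+\<omega>'. (if ?V \<omega>' \<le> ?u then ennreal (heat (d n) (W t \<omega> + (W (t + (?r - t)) \<omega>' - W t \<omega>'))) else 0) \<partial>M)
         = (\<integral>\<^sup>+x. ennreal (heat (?r - t) x - heat (?r - t) (2 * ?u - x)) * ennreal (heat (d n) (W t \<omega> + x)) * indicator {..?u} x \<partial>lborel)"
        using tr u by (intro S.nn_integral_killed) auto
      also have "\<dots> = pinned_mass (1 - t) (d n) (W t \<omega>) ?u"
      proof -
        have "?r - t = 1 - t - d n" by simp
        then show ?thesis unfolding pinned_mass_def by (simp only:)
      qed
      finally show "(\<integral>\<^sup>+\<omega>'. (if ?V \<omega>' \<le> ?u then f (?A \<omega>) * ennreal (heat (d n) (W t \<omega> + (W ?r \<omega>' - W t \<omega>'))) else 0) \<partial>M)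
        = f (?A \<omega>) * pinned_mass (1 - t) (d n) (W t \<omega>) ?u" .
    qed
    finally show ?thesis .
  qed
  have "(\<lambda>n. \<integral>\<^sup>+\<omega>. f (?A \<omega>) * pinned_mass (1 - t) (d n) (W t \<omega>) (?A \<omega> - W t \<omega>) \<partial>M)
     \<longlonglongrightarrow> (\<integral>\<^sup>+\<omega>. f (?A \<omega>) * ennreal (heat (1 - t) (W t \<omega>) - heat (1 - t) (2 * (?A \<omega> - W t \<omega>) + W t \<omega>)) \<partial>M)"
  proof (rule nn_integral_dominated_convergence[where w = "\<lambda>_. ennreal (1 / sqrt (pi * (1 - t)))"])
    show "(\<integral>\<^sup>+\<omega>. ennreal (1 / sqrt (pi * (1 - t))) \<partial>M) < \<infinity>"
      by (simp add: emeasure_space_1)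
    show "AE \<omega> in M. f (?A \<omega>) * pinned_mass (1 - t) (d n) (W t \<omega>) (?A \<omega> - W t \<omega>) \<le> ennreal (1 / sqrt (pi * (1 - t)))" for n
      using mult_mono[OF f1 pinned_mass_bound[of "1 - t" "d n"]] d(1,2)[of n] t by (intro AE_I2) simp
    show "AE \<omega> in M. (\<lambda>n. f (?A \<omega>) * pinned_mass (1 - t) (d n) (W t \<omega>) (?A \<omega> - W t \<omega>))
       \<longlonglongrightarrow> f (?A \<omega>) * ennreal (heat (1 - t) (W t \<omega>) - heat (1 - t) (2 * (?A \<omega> - W t \<omega>) + W t \<omega>))"
      \<comment> \<open>Start plus room is the early maximum itself; it is positive almost surely,
        as \<open>pinned_mass_limit\<close> requires.\<close>
      using AE_max_neq[OF t(1), of 0]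
    proof eventually_elim
      case (elim \<omega>)
      have "0 \<le> ?A \<omega>"
        using running_max_upper[OF continuous_path, of 0 0 t \<omega>] t by (simp add: W_0)
      with elim have "0 < W t \<omega> + (?A \<omega> - W t \<omega>)" by simp
      moreover have "f (?A \<omega>) < \<top>" using f1[of "?A \<omega>"] by (simp add: le_less_trans)
      ultimately show ?case
        using t d by (intro tendsto_mult_ennreal tendsto_const pinned_mass_limit) auto
    qed
  qed measurable
  also have "(\<integral>\<^sup>+\<omega>. f (?A \<omega>) * ennreal (heat (1 - t) (W t \<omega>) - heat (1 - t) (2 * (?A \<omega> - W t \<omega>) + W t \<omega>)) \<partial>M)
     = (\<integral>\<^sup>+m. \<integral>\<^sup>+x. ennreal (max_end_density t m x) * (f m * ennreal (heat (1 - t) x - heat (1 - t) (2 * (m - x) + x))) \<partial>lborel \<partial>lborel)"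
  proof -
    have "(\<lambda>p. f (fst p) * ennreal (heat (1 - t) (snd p) - heat (1 - t) (2 * (fst p - snd p) + snd p)))
        \<in> borel_measurable (borel :: (real \<times> real) measure)"
      unfolding borel_prod[symmetric] by measurable
    from nn_integral_max_end[OF t(1) this] show ?thesis by simp
  qed
  \<comment> \<open>\<open>early_max_B\<close> is normalized by \<open>heat 1 0\<close>, while the
    weights here are not yet divided by it, so this factor is split off.\<close>
  also have "\<dots> = (\<integral>\<^sup>+m. ennreal (heat 1 0) * (f m * ennreal (early_max_B t m) * indicator {0..} m) \<partial>lborel)"
  proof (rule nn_integral_cong)
    fix m :: real
    have h0: "0 < heat 1 0" by (simp add: normal_density_pos)
    have "(\<integral>\<^sup>+x. ennreal (max_end_density t m x) * (f m * ennreal (heat (1 - t) x - heat (1 - t) (2 * (m - x) + x))) \<partial>lborel)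
      = (\<integral>\<^sup>+x. ennreal (max_end_density t m x) * ennreal (heat (1 - t) x - heat (1 - t) (2 * (m - x) + x)) \<partial>lborel) * f m"
      by (subst nn_integral_multc[symmetric]) (auto simp: mult_ac)
    also have "(\<integral>\<^sup>+x. ennreal (max_end_density t m x) * ennreal (heat (1 - t) x - heat (1 - t) (2 * (m - x) + x)) \<partial>lborel)
      = (\<integral>\<^sup>+u. ennreal (2 * (m + u) / t * heat t (m + u)) * ennreal (heat (1 - t) (m - u) - heat (1 - t) (2 * (m - (m - u)) + (m - u))) * indicator {0..} u \<partial>lborel) * indicator {0..} m"
      by (rule integral_max_end_gap) measurable
    also have "\<dots> = ennreal (heat 1 0) * ennreal (early_max_B t m) * indicator {0..} m"
    proof (cases "0 \<le> m")
      case True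
      have "(\<integral>\<^sup>+u. ennreal (2 * (m + u) / t * heat t (m + u)) * ennreal (heat (1 - t) (m - u) - heat (1 - t) (2 * (m - (m - u)) + (m - u))) * indicator {0..} u \<partial>lborel)
        = (\<integral>\<^sup>+u. ennreal (heat 1 0) * (ennreal (2 * (m + u) / t * heat t (m + u)
           * ((heat (1 - t) (m - u) - heat (1 - t) (m + u)) / heat 1 0)) * indicator {0..} u) \<partial>lborel)"
      proof (rule nn_integral_cong)
        fix u :: real
        show "ennreal (2 * (m + u) / t * heat t (m + u)) * ennreal (heat (1 - t) (m - u) - heat (1 - t) (2 * (m - (m - u)) + (m - u))) * indicator {0..} u
          = ennreal (heat 1 0) * (ennreal (2 * (m + u) / t * heat t (m + u)
           * ((heat (1 - t) (m - u) - heat (1 - t) (m + u)) / heat 1 0)) * indicator {0..} u)"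
        proof (cases "0 \<le> u")
          case u: True
          have e: "2 * (m - (m - u)) + (m - u) = m + u" by simp
          have p: "0 \<le> heat (1 - t) (m - u) - heat (1 - t) (m + u)"
            using heat_antimono[of "m - u" "m + u" "1 - t"] u True by simp
          have k: "0 \<le> 2 * (m + u) / t * heat t (m + u)" using u True t by simp
          have "ennreal (heat 1 0) * ennreal (2 * (m + u) / t * heat t (m + u) * ((heat (1 - t) (m - u) - heat (1 - t) (m + u)) / heat 1 0))
            = ennreal (heat 1 0 * (2 * (m + u) / t * heat t (m + u) * ((heat (1 - t) (m - u) - heat (1 - t) (m + u)) / heat 1 0)))"
            using h0 by (intro ennreal_mult'[symmetric]) simp
          also have "heat 1 0 * (2 * (m + u) / t * heat t (m + u) * ((heat (1 - t) (m - u) - heat (1 - t) (m + u)) / heat 1 0))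
            = 2 * (m + u) / t * heat t (m + u) * (heat (1 - t) (m - u) - heat (1 - t) (m + u))"
          proof -
            have "h * (k * (p / h)) = k * p" if "0 < h" for h k p :: real using that by simp
            from this[OF h0] show ?thesis .
          qed
          also have "ennreal \<dots> = ennreal (2 * (m + u) / t * heat t (m + u)) * ennreal (heat (1 - t) (m - u) - heat (1 - t) (m + u))"
            by (rule ennreal_mult[OF k p])
          finally show ?thesis unfolding e using u by simp
        qed simp
      qed
      also have "\<dots> = ennreal (heat 1 0) * ennreal (early_max_B t m)"
        unfolding early_max_B_integral[OF t True, symmetric] by (rule nn_integral_cmult) measurable
      finally show ?thesis using True by simp
    qed simp
    finally show "(\<integral>\<^sup>+x. ennreal (max_end_density t m x) * (f m * ennreal (heat (1 - t) x - heat (1 - t) (2 * (m - x) + x))) \<partial>lborel)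
      = ennreal (heat 1 0) * (f m * ennreal (early_max_B t m) * indicator {0..} m)" by (simp only: mult_ac)
  qed
  also have "\<dots> = ennreal (heat 1 0) * (\<integral>\<^sup>+m. f m * ennreal (early_max_B t m) * indicator {0..} m \<partial>lborel)"
    by (rule nn_integral_cmult) measurable
  finally show ?thesis unfolding step .
qed

end

subsection \<open>The bridge as a weighted Brownian motion\<close>

lemma product_sigma_finite_lborel: "product_sigma_finite (\<lambda>_ :: nat. lborel :: real measure)"
  by (simp add: product_sigma_finite_def lborel.sigma_finite_measure_axioms)

lemma brownian_joint_density_Suc:
  "brownian_joint_density (Suc n) t x =
     brownian_joint_density n t x * heat (t (Suc n) - t n) (x (Suc n) - x n)"
  by (simp add: brownian_joint_density_def)

lemma brownian_joint_density_cong: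
  assumes "\<And>i. i \<le> n \<Longrightarrow> t i = t' i" "\<And>i. i \<le> n \<Longrightarrow> x i = x' i"
  shows "brownian_joint_density n t x = brownian_joint_density n t' x'"
  unfolding brownian_joint_density_def using assms by (intro prod.cong) auto

lemma brownian_joint_density_nonneg: "0 \<le> brownian_joint_density n t x"
  unfolding brownian_joint_density_def by (intro prod_nonneg) auto

lemma measurable_component_0:
  fixes i n :: nat
  shows
  "i \<le> n \<Longrightarrow> (\<lambda>x. (x(0 := 0)) i) \<in> borel_measurable (\<Pi>\<^sub>M i\<in>{1..n}. lborel :: real measure)"
proof (cases "i = 0")
  assume "i \<le> n" "i \<noteq> 0"
  then have "i \<in> {1..n}" by auto
  from measurable_component_singleton[OF this, of "\<lambda>_. lborel :: real measure"]
  show ?thesis using \<open>i \<noteq> 0\<close> by simp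
qed simp

lemma measurable_brownian_joint_density:
  "(\<lambda>x. brownian_joint_density n t (x(0 := 0))) \<in> borel_measurable (\<Pi>\<^sub>M i\<in>{1..n}. lborel)"
  unfolding brownian_joint_density_def
proof (intro borel_measurable_prod)
  fix i assume "i \<in> {..<n}"
  then have [measurable]: "(\<lambda>x. (x(0 := 0)) i) \<in> borel_measurable (\<Pi>\<^sub>M i\<in>{1..n}. lborel :: real measure)"
    "(\<lambda>x. (x(0 := 0)) (Suc i)) \<in> borel_measurable (\<Pi>\<^sub>M i\<in>{1..n}. lborel :: real measure)"
    by (intro measurable_component_0; simp)+
  show "(\<lambda>x. heat (t (Suc i) - t i) ((x(0 := 0)) (Suc i) - (x(0 := 0)) i)) \<in> borel_measurable (\<Pi>\<^sub>M i\<in>{1..n}. lborel)"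
    by measurable
qed

context continuous_brownian
begin

text \<open>Induction on the number of times: the next increment is independent of the earlier
  values and adds one Gaussian factor. Coordinates are indexed from 1, and \<open>x(0 := 0)\<close>
  supplies the starting value at index 0.\<close>

lemma nn_integral_fdd:
  fixes t :: "nat \<Rightarrow> real"
  assumes t0: "t 0 = 0" and mono: "\<And>i. i < n \<Longrightarrow> t i < t (Suc i)"
    and G: "G \<in> borel_measurable (\<Pi>\<^sub>M i\<in>{1..n}. lborel)"
  shows "(\<integral>\<^sup>+\<omega>. G (\<lambda>i\<in>{1..n}. W (t i) \<omega>) \<partial>M)
    = (\<integral>\<^sup>+x. G x * ennreal (brownian_joint_density n t (x(0 := 0))) \<partial>(\<Pi>\<^sub>M i\<in>{1..n}. lborel))"
  using mono G
proof (induction n arbitrary: G)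
  case 0
  interpret P: product_sigma_finite "\<lambda>_ :: nat. lborel :: real measure"
    by (rule product_sigma_finite_lborel)
  show ?case
    by (simp add: P.nn_integral_empty brownian_joint_density_def emeasure_space_1 restrict_def)
next
  case (Suc n)
  interpret P: product_sigma_finite "\<lambda>_ :: nat. lborel :: real measure"
    by (rule product_sigma_finite_lborel)
  let ?P = "\<lambda>n. \<Pi>\<^sub>M i\<in>{1..n :: nat}. lborel :: real measure"
  let ?X = "\<lambda>\<omega>. \<lambda>i\<in>{1..n}. W (t i) \<omega>"
  let ?d = "t (Suc n) - t n"
  have ge0: "0 \<le> t i" if "i \<le> Suc n" for i
    using grid_mono[of "Suc n" t 0 i] Suc.prems(1) that t0 by (simp add: less_imp_le)
  have d: "0 < ?d" using Suc.prems(1)[of n] by simp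
  have ins: "{1..Suc n} = insert (Suc n) {1..n}" by auto
  have add_dim: "(\<lambda>p. (fst p)(Suc n := snd p)) \<in> measurable (?P n \<Otimes>\<^sub>M lborel) (?P (Suc n))"
    using measurable_add_dim[of "Suc n" "{1..n}" "\<lambda>_. lborel :: real measure"] unfolding ins by (simp add: split_beta')
  have Gm[measurable]: "(\<lambda>p. G ((fst p)(Suc n := snd p))) \<in> borel_measurable (?P n \<Otimes>\<^sub>M lborel)"
    by (rule measurable_compose[OF add_dim Suc.prems(2)])
  have xn[measurable]: "(\<lambda>x. (x(0 := 0)) n) \<in> borel_measurable (?P n)"
    by (rule measurable_component_0) simp
  have ind: "indep_pair (?P n) ?X borel (\<lambda>\<omega>. W (t (Suc n)) \<omega> - W (t n) \<omega>)"
  proof -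
    have i0: "indep_pair (\<Pi>\<^sub>M i\<in>{..n}. borel) (\<lambda>\<omega>. \<lambda>i\<in>{..n}. W (t i) \<omega>)
      (\<Pi>\<^sub>M i\<in>{n..Suc n}. borel) (\<lambda>\<omega>. \<lambda>i\<in>{n..Suc n}. W (t i) \<omega> - W (t n) \<omega>)"
      using Suc.prems(1) t0 by (intro indep_var_imp_indep_pair indep_past_future) (auto intro: less_imp_le)
    have f: "(\<lambda>x. restrict x {1..n}) \<in> measurable (\<Pi>\<^sub>M i\<in>{..n}. borel) (?P n)"
      by (rule measurable_restrict) (auto intro!: measurable_component_singleton)
    have g: "(\<lambda>x. x (Suc n)) \<in> measurable (\<Pi>\<^sub>M i\<in>{n..Suc n}. borel :: real measure) borel"
      by (rule measurable_component_singleton) simp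
    have "(\<lambda>\<omega>. restrict (\<lambda>i\<in>{..n}. W (t i) \<omega>) {1..n}) = ?X"
      by (auto simp: restrict_def fun_eq_iff)
    with indep_pair_compose[OF i0 f g] show ?thesis by simp
  qed
  define G' where "G' x = (\<integral>\<^sup>+y. ennreal (heat ?d (y - (x(0 := 0)) n)) * G (x(Suc n := y)) \<partial>lborel)" for x
  have "(\<lambda>p. ennreal (heat ?d (snd p - ((fst p)(0 := 0)) n)) * G ((fst p)(Suc n := snd p))) \<in> borel_measurable (?P n \<Otimes>\<^sub>M lborel)"
    using measurable_compose[OF measurable_fst xn, of lborel] by measurable
  from lborel.borel_measurable_nn_integral_fst[OF this] have G': "G' \<in> borel_measurable (?P n)"
    by (simp add: G'_def[abs_def])
  let ?h = "\<lambda>p. G ((fst p)(Suc n := ((fst p)(0 := 0)) n + snd p))"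
  have h: "?h \<in> borel_measurable (?P n \<Otimes>\<^sub>M borel)"
  proof -
    have "(\<lambda>p. (fst p, ((fst p)(0 := 0)) n + snd p)) \<in> measurable (?P n \<Otimes>\<^sub>M borel) (?P n \<Otimes>\<^sub>M lborel)"
      using measurable_compose[OF measurable_fst xn, of borel] by measurable
    from measurable_compose[OF this Gm] show ?thesis by simp
  qed
  have X0: "((?X \<omega>)(0 := 0)) n = W (t n) \<omega>" for \<omega>
    by (cases "n = 0") (auto simp: t0 W_0)
  have "(\<integral>\<^sup>+\<omega>. G (\<lambda>i\<in>{1..Suc n}. W (t i) \<omega>) \<partial>M) = (\<integral>\<^sup>+\<omega>. ?h (?X \<omega>, W (t (Suc n)) \<omega> - W (t n) \<omega>) \<partial>M)"
    unfolding fst_conv snd_conv X0 by (intro nn_integral_cong arg_cong[where f = G]) (auto simp: restrict_def fun_eq_iff)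
  also have "\<dots> = (\<integral>\<^sup>+\<omega>. (\<integral>\<^sup>+\<omega>'. ?h (?X \<omega>, W (t (Suc n)) \<omega>' - W (t n) \<omega>') \<partial>M) \<partial>M)"
    by (rule indep_pair_nn_integral[OF ind h])
  also have "\<dots> = (\<integral>\<^sup>+\<omega>. G' (?X \<omega>) \<partial>M)"
  proof (rule nn_integral_cong)
    fix \<omega>
    let ?x = "?X \<omega>"
    have x: "?x \<in> space (?P n)" by (auto simp: space_PiM)
    have Gx[measurable]: "(\<lambda>y. G (?x(Suc n := y))) \<in> borel_measurable borel"
      using measurable_Pair2[OF Gm x] by simp
    have "(\<integral>\<^sup>+\<omega>'. ?h (?x, W (t (Suc n)) \<omega>' - W (t n) \<omega>') \<partial>M)
      = (\<integral>\<^sup>+\<omega>'. G (?x(Suc n := W (t n) \<omega> + (W (t (Suc n)) \<omega>' - W (t n) \<omega>'))) \<partial>M)"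
      unfolding fst_conv snd_conv X0 ..
    also have "\<dots> = (\<integral>\<^sup>+r. ennreal (heat ?d r) * G (?x(Suc n := W (t n) \<omega> + r)) \<partial>lborel)"
      using distributed_nn_integral[OF normal_increments[of "t n" "t (Suc n)"], of "\<lambda>r. G (?x(Suc n := W (t n) \<omega> + r))"]
        d ge0[of n] measurable_compose[OF _ Gx, of "\<lambda>r. W (t n) \<omega> + r" lborel] by simp
    also have "\<dots> = G' ?x"
    proof -
      define F where "F y = ennreal (heat ?d (y - W (t n) \<omega>)) * G (?x(Suc n := y))" for y
      have "F \<in> borel_measurable borel" unfolding F_def[abs_def] by measurable
      from nn_integral_real_affine[OF this, of 1 "W (t n) \<omega>"]
      have "(\<integral>\<^sup>+r. F (W (t n) \<omega> + r) \<partial>lborel) = (\<integral>\<^sup>+y. F y \<partial>lborel)" by simp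
      then show ?thesis unfolding G'_def X0 F_def by (simp only: add_diff_cancel_left')
    qed
    finally show "(\<integral>\<^sup>+\<omega>'. ?h (?x, W (t (Suc n)) \<omega>' - W (t n) \<omega>') \<partial>M) = G' ?x" .
  qed
  also have "\<dots> = (\<integral>\<^sup>+x. G' x * ennreal (brownian_joint_density n t (x(0 := 0))) \<partial>?P n)"
    by (rule Suc.IH[OF _ G']) (use Suc.prems(1) in simp)
  also have "\<dots> = (\<integral>\<^sup>+x. \<integral>\<^sup>+y. G (x(Suc n := y)) * ennreal (brownian_joint_density (Suc n) t ((x(Suc n := y))(0 := 0))) \<partial>lborel \<partial>?P n)"
  proof (rule nn_integral_cong)
    fix x assume x: "x \<in> space (?P n)"
    have [measurable]: "(\<lambda>y. G (x(Suc n := y))) \<in> borel_measurable borel"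
      using measurable_Pair2[OF Gm x] by simp
    have J: "brownian_joint_density (Suc n) t ((x(Suc n := y))(0 := 0))
        = brownian_joint_density n t (x(0 := 0)) * heat ?d (y - (x(0 := 0)) n)" for y
    proof -
      have "brownian_joint_density n t ((x(Suc n := y))(0 := 0)) = brownian_joint_density n t (x(0 := 0))"
        by (rule brownian_joint_density_cong) auto
      then show ?thesis by (simp add: brownian_joint_density_Suc)
    qed
    have "G' x * ennreal (brownian_joint_density n t (x(0 := 0))) =
      (\<integral>\<^sup>+y. ennreal (heat ?d (y - (x(0 := 0)) n)) * G (x(Suc n := y)) * ennreal (brownian_joint_density n t (x(0 := 0))) \<partial>lborel)"
      unfolding G'_def by (rule nn_integral_multc[symmetric]) measurable
    also have "\<dots> = (\<integral>\<^sup>+y. G (x(Suc n := y)) * ennreal (brownian_joint_density (Suc n) t ((x(Suc n := y))(0 := 0))) \<partial>lborel)"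
      unfolding J by (intro nn_integral_cong) (simp add: ennreal_mult brownian_joint_density_nonneg mult_ac)
    finally show "G' x * ennreal (brownian_joint_density n t (x(0 := 0))) =
      (\<integral>\<^sup>+y. G (x(Suc n := y)) * ennreal (brownian_joint_density (Suc n) t ((x(Suc n := y))(0 := 0))) \<partial>lborel)" .
  qed
  also have "\<dots> = (\<integral>\<^sup>+x. G x * ennreal (brownian_joint_density (Suc n) t (x(0 := 0))) \<partial>?P (Suc n))"
  proof -
    have "(\<lambda>x. G x * ennreal (brownian_joint_density (Suc n) t (x(0 := 0)))) \<in> borel_measurable (?P (Suc n))"
      using Suc.prems(2) measurable_brownian_joint_density[of "Suc n" t] by measurable
    then show ?thesis
      unfolding ins by (intro P.product_nn_integral_insert[symmetric]) auto
  qed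
  finally show ?case .
qed

end

section \<open>The bridge and its comparison with Brownian motion\<close>

locale continuous_bridge = prob_space M for M :: "'a measure" +
  fixes B :: "real \<Rightarrow> 'a \<Rightarrow> real"
  assumes measurable_B: "\<And>t. t \<in> {0..1} \<Longrightarrow> B t \<in> borel_measurable M"
    and B_0: "\<And>\<omega>. B 0 \<omega> = 0"
    and B_1: "\<And>\<omega>. B 1 \<omega> = 0"
    and distributed_B: "\<And>n t. t 0 = 0 \<Longrightarrow> t (Suc n) = 1 \<Longrightarrow> (\<And>i. i \<le> n \<Longrightarrow> t i < t (Suc i)) \<Longrightarrow>
        distributed M (\<Pi>\<^sub>M i\<in>{1..n}. lborel) (\<lambda>\<omega>. \<lambda>i\<in>{1..n}. B (t i) \<omega>)
          (\<lambda>x. ennreal (brownian_joint_density (Suc n) t (x(0 := 0, Suc n := 0)) / heat 1 0))"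
    and continuous_B: "\<And>\<omega>. continuous_on {0..1} (\<lambda>t. B t \<omega>)"

text \<open>\<open>W\<close> has two roles: it is the reference motion whose reweighted laws give
  those of the bridge, and it is the competitor of the bridge in the final problem. The first role
  compares laws only; independence enters later.\<close>

locale brownian_and_bridge = continuous_brownian M W + continuous_bridge M B
  for M :: "'a measure" and W B :: "real \<Rightarrow> 'a \<Rightarrow> real"
begin

text \<open>The bridge density contains one factor more than the Brownian one, namely the transition
  from the last value to 0 at time 1. This factor, divided by \<open>heat 1 0\<close>, is the
  weight, and it depends on the path only through its value at time \<open>t n\<close>.\<close>

lemma nn_integral_bridge_fdd:
  fixes t :: "nat \<Rightarrow> real"
  assumes t0: "t 0 = 0" and mono: "\<And>i. i < n \<Longrightarrow> t i < t (Suc i)" and tn: "t n < 1"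
    and G: "G \<in> borel_measurable (\<Pi>\<^sub>M i\<in>{1..n}. lborel)"
  shows "(\<integral>\<^sup>+\<omega>. G (\<lambda>i\<in>{1..n}. B (t i) \<omega>) \<partial>M)
    = (\<integral>\<^sup>+\<omega>. G (\<lambda>i\<in>{1..n}. W (t i) \<omega>) * ennreal (heat (1 - t n) (W (t n) \<omega>) / heat 1 0) \<partial>M)"
proof -
  let ?P = "\<Pi>\<^sub>M i\<in>{1..n}. lborel :: real measure"
  let ?t = "t(Suc n := 1)"
  have X0: "((\<lambda>i\<in>{1..n}. W (t i) \<omega>)(0 := 0)) n = W (t n) \<omega>" for \<omega>
    by (cases "n = 0") (auto simp: t0 W_0)
  have h0: "0 < heat 1 0" by (simp add: normal_density_pos)
  have dist: "distributed M ?P (\<lambda>\<omega>. \<lambda>i\<in>{1..n}. B (?t i) \<omega>)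
      (\<lambda>x. ennreal (brownian_joint_density (Suc n) ?t (x(0 := 0, Suc n := 0)) / heat 1 0))"
    by (rule distributed_B) (use t0 mono tn in \<open>auto simp: le_less\<close>)
  have eqt: "(\<lambda>i\<in>{1..n}. B (?t i) \<omega>) = (\<lambda>i\<in>{1..n}. B (t i) \<omega>)" for \<omega>
    by (auto simp: restrict_def fun_eq_iff)
  have "(\<integral>\<^sup>+\<omega>. G (\<lambda>i\<in>{1..n}. B (t i) \<omega>) \<partial>M)
    = (\<integral>\<^sup>+x. ennreal (brownian_joint_density (Suc n) ?t (x(0 := 0, Suc n := 0)) / heat 1 0) * G x \<partial>?P)"
    using distributed_nn_integral[OF dist G] unfolding eqt by (rule sym)
  also have "\<dots> = (\<integral>\<^sup>+x. G x * ennreal (heat (1 - t n) ((x(0 := 0)) n) / heat 1 0) * ennreal (brownian_joint_density n t (x(0 := 0))) \<partial>?P)"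
  proof (rule nn_integral_cong)
    fix x
    have "brownian_joint_density (Suc n) ?t (x(0 := 0, Suc n := 0))
      = brownian_joint_density n t (x(0 := 0)) * heat (1 - t n) (- (x(0 := 0)) n)"
      unfolding brownian_joint_density_Suc
      by (subst brownian_joint_density_cong[of n ?t t _ "x(0 := 0)"]) auto
    then have "brownian_joint_density (Suc n) ?t (x(0 := 0, Suc n := 0)) / heat 1 0
      = heat (1 - t n) ((x(0 := 0)) n) / heat 1 0 * brownian_joint_density n t (x(0 := 0))"
      by (simp only: heat_minus times_divide_eq_left times_divide_eq_right mult.commute)
    then show "ennreal (brownian_joint_density (Suc n) ?t (x(0 := 0, Suc n := 0)) / heat 1 0) * G x
      = G x * ennreal (heat (1 - t n) ((x(0 := 0)) n) / heat 1 0) * ennreal (brownian_joint_density n t (x(0 := 0)))"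
      using h0 by (simp only: ennreal_mult brownian_joint_density_nonneg divide_nonneg_pos normal_density_nonneg mult_ac)
  qed
  also have "\<dots> = (\<integral>\<^sup>+\<omega>. G (\<lambda>i\<in>{1..n}. W (t i) \<omega>) * ennreal (heat (1 - t n) (((\<lambda>i\<in>{1..n}. W (t i) \<omega>)(0 := 0)) n) / heat 1 0) \<partial>M)"
  proof (rule nn_integral_fdd[symmetric, OF t0 mono])
    have [measurable]: "(\<lambda>x. (x(0 := 0)) n) \<in> borel_measurable ?P"
      by (rule measurable_component_0) simp
    show "(\<lambda>x. G x * ennreal (heat (1 - t n) ((x(0 := 0)) n) / heat 1 0)) \<in> borel_measurable ?P"
      using G by measurable
  qed
  finally show ?thesis unfolding X0 .
qed

text \<open>Time \<open>r\<close> is adjoined as the last grid time, without a constraint on the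
  value there, so that the weight refers to \<open>r\<close> whatever the set \<open>Q\<close> is.
  Levels may vary with time in order to treat two intervals at once later.\<close>

lemma bridge_below_finite:
  assumes Q: "finite Q" "Q \<subseteq> {0<..<r}" and r: "0 < r" "r < 1"
  shows "(\<integral>\<^sup>+\<omega>. (if \<forall>q\<in>Q. B q \<omega> \<le> c q then 1 else 0) \<partial>M)
    = (\<integral>\<^sup>+\<omega>. (if \<forall>q\<in>Q. W q \<omega> \<le> c q then 1 else 0) * ennreal (heat (1 - r) (W r \<omega>) / heat 1 0) \<partial>M)"
proof -
  let ?R = "insert r Q"
  define n where "n = card ?R"
  define xs where "xs = sorted_list_of_set ?R"
  have xs: "length xs = n" "set xs = ?R" "sorted_wrt (<) xs"
  proof -
    have fin: "finite ?R" using Q by simp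
    show "length xs = n" unfolding xs_def n_def by (rule sorted_list_of_set.length_sorted_key_list_of_set)
    show "set xs = ?R" unfolding xs_def by (rule set_sorted_list_of_set[OF fin])
    show "sorted_wrt (<) xs" unfolding xs_def by (rule strict_sorted_list_of_set)
  qed
  have n: "0 < n" using Q by (simp add: n_def card_gt_0_iff)
  \<comment> \<open>Grid index 0 is time 0, so the sorted list is shifted by one.\<close>
  define t where "t i = (if i = 0 then 0 else xs ! (i - 1))" for i
  have img: "t ` {1..n} = ?R"
  proof -
    have "t ` {1..n} = (!) xs ` {..<n}"
    proof safe
      fix i assume "i \<in> {1..n}"
      then show "t i \<in> (!) xs ` {..<n}" by (auto simp: t_def)
    next
      fix i assume "i < n"
      then show "xs ! i \<in> t ` {1..n}" by (intro image_eqI[of _ _ "Suc i"]) (auto simp: t_def)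
    qed
    then show ?thesis using xs by (simp add: set_conv_nth image_def lessThan_def) blast
  qed
  have mono: "t i < t (Suc i)" if "i < n" for i
  proof (cases "i = 0")
    case True
    have "xs ! 0 \<in> ?R" using n xs nth_mem by metis
    then show ?thesis using True Q r by (auto simp: t_def)
  next
    case False
    then show ?thesis using that xs sorted_wrt_nth_less[OF xs(3), of "i - 1" i] by (simp add: t_def)
  qed
  have tn: "t n = r"
  proof -
    obtain j where j: "j \<in> {1..n}" "t j = r" using img by (metis imageE insertI1)
    have "t j \<le> t n" using grid_mono[of n t j n] mono j by (simp add: less_imp_le)
    moreover have "t n \<in> ?R" using img n by force
    ultimately show ?thesis using j Q by auto
  qed
  let ?G = "\<lambda>x. if \<forall>i\<in>{1..n}. t i \<in> Q \<longrightarrow> x i \<le> c (t i) then 1 else 0 :: ennreal"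
  have "{x \<in> space (\<Pi>\<^sub>M i\<in>{1..n}. lborel). \<forall>i\<in>{1..n}. t i \<in> Q \<longrightarrow> x i \<le> c (t i)} \<in> sets (\<Pi>\<^sub>M i\<in>{1..n}. lborel :: real measure)"
  proof (intro sets.sets_Collect_finite_All sets.sets_Collect_imp sets.sets_Collect_const)
    fix i assume "i \<in> {1..n}"
    then have "(\<lambda>x. x i) \<in> borel_measurable (\<Pi>\<^sub>M i\<in>{1..n}. lborel :: real measure)"
      using measurable_component_0[of i n] by simp
    then show "{x \<in> space (\<Pi>\<^sub>M i\<in>{1..n}. lborel). x i \<le> c (t i)} \<in> sets (\<Pi>\<^sub>M i\<in>{1..n}. lborel :: real measure)"
      by measurable
  qed simp
  then have G: "?G \<in> borel_measurable (\<Pi>\<^sub>M i\<in>{1..n}. lborel)"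
    by (intro measurable_If) auto
  have eq: "?G (\<lambda>i\<in>{1..n}. X (t i) \<omega>) = (if \<forall>q\<in>Q. X q \<omega> \<le> c q then 1 else 0)" for X :: "real \<Rightarrow> 'a \<Rightarrow> real" and \<omega>
  proof -
    have "(\<forall>q\<in>Q. X q \<omega> \<le> c q) \<longleftrightarrow> (\<forall>q\<in>?R. q \<in> Q \<longrightarrow> X q \<omega> \<le> c q)" by blast
    then show ?thesis unfolding img[symmetric] by simp
  qed
  have "t 0 = 0" by (simp add: t_def)
  from nn_integral_bridge_fdd[OF this mono _ G] show ?thesis
    unfolding eq tn using r by simp
qed

text \<open>Finite subsets exhaust \<open>Q\<close>, and for each \<open>\<omega>\<close> the
  indicators are eventually constant. The constant 1 dominates on the bridge side and the weight
  itself on the Brownian side.\<close>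

lemma bridge_below_countable:
  assumes Q: "countable Q" "Q \<subseteq> {0<..<r}" and r: "0 < r" "r < 1"
  shows "(\<integral>\<^sup>+\<omega>. (if \<forall>q\<in>Q. B q \<omega> \<le> c q then 1 else 0) \<partial>M)
    = (\<integral>\<^sup>+\<omega>. (if \<forall>q\<in>Q. W q \<omega> \<le> c q then 1 else 0) * ennreal (heat (1 - r) (W r \<omega>) / heat 1 0) \<partial>M)"
proof -
  obtain F where F: "\<And>n :: nat. finite (F n)" "\<And>n. F n \<subseteq> Q" "incseq F" "(\<Union>n. F n) = Q"
  proof (cases "Q = {}")
    case False
    then show ?thesis
    proof (intro that[of "\<lambda>n. from_nat_into Q ` {..n}"])
      show "from_nat_into Q ` {..n} \<subseteq> Q" for n using from_nat_into[OF False] by auto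
      show "incseq (\<lambda>n. from_nat_into Q ` {..n})" by (auto simp: incseq_def)
      have "(\<Union>n. from_nat_into Q ` {..n}) = range (from_nat_into Q)" by auto
      then show "(\<Union>n. from_nat_into Q ` {..n}) = Q"
        using range_from_nat_into[OF False Q(1)] by simp
    qed simp
  qed (use that[of "\<lambda>_. {}"] in auto)
  let ?I = "\<lambda>X Q \<omega>. if \<forall>q\<in>Q. X q \<omega> \<le> c q then 1 else 0 :: ennreal"
  let ?w = "\<lambda>\<omega>. ennreal (heat (1 - r) (W r \<omega>) / heat 1 0)"
  have h0: "0 < heat 1 0" by (simp add: normal_density_pos)
  have lim: "(\<lambda>n. ?I X (F n) \<omega>) \<longlonglongrightarrow> ?I X Q \<omega>" for X \<omega>
  proof (cases "\<forall>q\<in>Q. X q \<omega> \<le> c q")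
    case True
    then have "?I X (F n) \<omega> = ?I X Q \<omega>" for n using F(2)[of n] by auto
    then show ?thesis by simp
  next
    case False
    then obtain q n where "q \<in> F n" "\<not> X q \<omega> \<le> c q" using F(4) by blast
    then have "\<forall>m\<ge>n. ?I X (F m) \<omega> = ?I X Q \<omega>" using F(3) False by (auto simp: incseq_def)
    then have "eventually (\<lambda>m. ?I X (F m) \<omega> = ?I X Q \<omega>) sequentially"
      unfolding eventually_sequentially by blast
    then show ?thesis by (rule tendsto_eventually)
  qed
  have meas: "?I X S \<in> borel_measurable M" if "countable S" "\<And>q. q \<in> S \<Longrightarrow> X q \<in> borel_measurable M" for X S
  proof -
    have "{\<omega> \<in> space M. \<forall>q\<in>S. X q \<omega> \<le> c q} \<in> events"
      using that by (intro sets.sets_Collect_countable_All' borel_measurable_le) auto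
    then show ?thesis by (intro measurable_If) auto
  qed
  have BQ: "B q \<in> borel_measurable M" "W q \<in> borel_measurable M" if "q \<in> Q" for q
    using that Q r by (auto intro!: measurable_B measurable_W)
  have cF: "countable (F n)" for n using F(1) by (rule countable_finite)
  have w[measurable]: "?w \<in> borel_measurable M"
  proof -
    have [measurable]: "W r \<in> borel_measurable M" using r by (intro measurable_W) simp
    show ?thesis by measurable
  qed
  have "(\<lambda>n. \<integral>\<^sup>+\<omega>. ?I B (F n) \<omega> \<partial>M) \<longlonglongrightarrow> (\<integral>\<^sup>+\<omega>. ?I B Q \<omega> \<partial>M)"
  proof (rule nn_integral_dominated_convergence[where w = "\<lambda>_. 1"])
    show "?I B (F n) \<in> borel_measurable M" for n using F(2) BQ by (intro meas cF) blast
    show "?I B Q \<in> borel_measurable M" using BQ by (intro meas Q) blast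
    show "AE \<omega> in M. ?I B (F n) \<omega> \<le> 1" for n by (rule AE_I2) auto
    show "AE \<omega> in M. (\<lambda>n. ?I B (F n) \<omega>) \<longlonglongrightarrow> ?I B Q \<omega>" by (rule AE_I2, rule lim)
  qed (auto simp: emeasure_space_1)
  moreover have "(\<lambda>n. \<integral>\<^sup>+\<omega>. ?I W (F n) \<omega> * ?w \<omega> \<partial>M) \<longlonglongrightarrow> (\<integral>\<^sup>+\<omega>. ?I W Q \<omega> * ?w \<omega> \<partial>M)"
  proof (rule nn_integral_dominated_convergence[where w = ?w])
    have [measurable]: "?I W (F n) \<in> borel_measurable M" for n using F(2) BQ by (intro meas cF) blast
    have [measurable]: "?I W Q \<in> borel_measurable M" using BQ by (intro meas Q) blast
    show "(\<lambda>\<omega>. ?I W (F n) \<omega> * ?w \<omega>) \<in> borel_measurable M" for n by measurable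
    show "(\<lambda>\<omega>. ?I W Q \<omega> * ?w \<omega>) \<in> borel_measurable M" by measurable
    show "AE \<omega> in M. ?I W (F n) \<omega> * ?w \<omega> \<le> ?w \<omega>" for n by (rule AE_I2) auto
    show "AE \<omega> in M. (\<lambda>n. ?I W (F n) \<omega> * ?w \<omega>) \<longlonglongrightarrow> ?I W Q \<omega> * ?w \<omega>"
      by (rule AE_I2, intro tendsto_mult_ennreal lim tendsto_const) auto
    \<comment> \<open>The weight has total mass 1: this is the finite case with no constraint at
      all.\<close>
    have "(\<integral>\<^sup>+\<omega>. ?w \<omega> \<partial>M) = (\<integral>\<^sup>+\<omega>. 1 \<partial>M)"
      using bridge_below_finite[of "{}" r c] r by simp
    then show "(\<integral>\<^sup>+\<omega>. ?w \<omega> \<partial>M) < \<infinity>" by (simp add: emeasure_space_1)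
  qed (rule w)
  moreover have "(\<integral>\<^sup>+\<omega>. ?I B (F n) \<omega> \<partial>M) = (\<integral>\<^sup>+\<omega>. ?I W (F n) \<omega> * ?w \<omega> \<partial>M)" for n
    using F(2)[of n] Q r by (intro bridge_below_finite F) auto
  ultimately show ?thesis using LIMSEQ_unique by (simp only:) blast
qed

end

subsection \<open>Maxima of the bridge\<close>

text \<open>Both bounds are coded as one time-dependent level on a countable set of interior times,
  the form in which bridge and motion can be compared.\<close>

lemma running_max_pair_le_iff:
  assumes c: "continuous_on {0..r} x" and t: "0 < t" "t < r"
  shows "(running_max x 0 t, running_max x t r) \<le> p \<longleftrightarrow>
    (\<forall>q\<in>\<rat> \<inter> {0<..<t} \<union> \<rat> \<inter> {t<..<r}. x q \<le> (if q < t then fst p else snd p))"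
proof -
  have c': "continuous_on {0..t} x" "continuous_on {t..r} x"
    using t by (auto intro: continuous_on_subset[OF c])
  have "(running_max x 0 t, running_max x t r) \<le> p \<longleftrightarrow> running_max x 0 t \<le> fst p \<and> running_max x t r \<le> snd p"
    by (simp add: less_eq_prod_def)
  also have "running_max x 0 t \<le> fst p \<longleftrightarrow> (\<forall>q\<in>\<rat> \<inter> {0<..<t}. x q \<le> fst p)"
    using t by (intro running_max_le_iff_closure c' closure_rat_Ioo) auto
  also have "running_max x t r \<le> snd p \<longleftrightarrow> (\<forall>q\<in>\<rat> \<inter> {t<..<r}. x q \<le> snd p)"
    using t by (intro running_max_le_iff_closure c' closure_rat_Ioo) auto
  finally show ?thesis
    unfolding ball_Un by (simp add: Ball_def)
qed

context brownian_and_bridge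
begin

abbreviation "weight r \<omega> \<equiv> ennreal (heat (1 - r) (W r \<omega>) / heat 1 0)"
abbreviation "max_B s t \<omega> \<equiv> running_max (\<lambda>r. B r \<omega>) s t"

lemma heat_1_0: "0 < heat 1 0"
  by (simp add: normal_density_pos)

lemma continuous_bridge_path: "0 \<le> s \<Longrightarrow> t \<le> 1 \<Longrightarrow> continuous_on {s..t} (\<lambda>t. B t \<omega>)"
  using continuous_B by (rule continuous_on_subset) auto

lemma measurable_max_B[measurable]:
  "0 \<le> s \<Longrightarrow> s \<le> t \<Longrightarrow> t \<le> 1 \<Longrightarrow> max_B s t \<in> borel_measurable M"
  by (rule measurable_running_max) (auto intro: continuous_bridge_path measurable_B)

lemma bridge_max_law:
  assumes r: "0 < r" "r < 1"
  shows "(\<integral>\<^sup>+\<omega>. (if max_B 0 r \<omega> \<le> m then 1 else 0) \<partial>M)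
    = (\<integral>\<^sup>+\<omega>. (if max_W 0 r \<omega> \<le> m then 1 else 0) * weight r \<omega> \<partial>M)"
proof -
  let ?Q = "\<rat> \<inter> {0<..<r}"
  have B: "max_B 0 r \<omega> \<le> m \<longleftrightarrow> (\<forall>q\<in>?Q. B q \<omega> \<le> m)" for \<omega>
    using r by (intro running_max_le_iff_closure continuous_bridge_path closure_rat_Ioo) auto
  have W: "max_W 0 r \<omega> \<le> m \<longleftrightarrow> (\<forall>q\<in>?Q. W q \<omega> \<le> m)" for \<omega>
    using r by (intro running_max_le_iff_closure continuous_path closure_rat_Ioo) auto
  show ?thesis
    unfolding B W by (rule bridge_below_countable) (use r countable_rat in \<open>auto intro: countable_Int1\<close>)
qed

text \<open>The preceding comparison gives the distribution function of the pair, hence equality of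
  its law with the law of the Brownian pair under the measure with density \<open>weight r\<close>;
  arbitrary nonnegative \<open>f\<close> follow.\<close>

lemma bridge_pair_law:
  assumes t: "0 < t" "t < r" "r < 1" and f[measurable]: "f \<in> borel_measurable (borel :: (real \<times> real) measure)"
  shows "(\<integral>\<^sup>+\<omega>. f (max_B 0 t \<omega>, max_B t r \<omega>) \<partial>M)
    = (\<integral>\<^sup>+\<omega>. f (max_W 0 t \<omega>, max_W t r \<omega>) * weight r \<omega> \<partial>M)"
proof -
  let ?X = "\<lambda>\<omega>. (max_B 0 t \<omega>, max_B t r \<omega>)" and ?Y = "\<lambda>\<omega>. (max_W 0 t \<omega>, max_W t r \<omega>)"
  have [measurable]: "max_B 0 t \<in> borel_measurable M" "max_B t r \<in> borel_measurable M"
    "max_W 0 t \<in> borel_measurable M" "max_W t r \<in> borel_measurable M"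
    using t by (auto intro!: measurable_max_B measurable_max)
  have X[measurable]: "?X \<in> borel_measurable M" and Y[measurable]: "?Y \<in> borel_measurable M"
    unfolding borel_prod[symmetric] by measurable
  have w[measurable]: "weight r \<in> borel_measurable M"
  proof -
    have [measurable]: "W r \<in> borel_measurable M" using t by (intro measurable_W) simp
    show ?thesis by measurable
  qed
  let ?Q1 = "\<rat> \<inter> {0<..<t}" and ?Q2 = "\<rat> \<inter> {t<..<r}"
  have box: "(\<integral>\<^sup>+\<omega>. (if ?X \<omega> \<le> p then 1 else 0) \<partial>M) = (\<integral>\<^sup>+\<omega>. (if ?Y \<omega> \<le> p then 1 else 0) * weight r \<omega> \<partial>M)" for p
  proof -
    have Q: "countable (?Q1 \<union> ?Q2)" "?Q1 \<union> ?Q2 \<subseteq> {0<..<r}"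
      using t countable_rat by (auto intro: countable_Int1)
    have B: "?X \<omega> \<le> p \<longleftrightarrow> (\<forall>q\<in>?Q1 \<union> ?Q2. B q \<omega> \<le> (if q < t then fst p else snd p))" for \<omega>
      using t by (intro running_max_pair_le_iff continuous_bridge_path) auto
    have W: "?Y \<omega> \<le> p \<longleftrightarrow> (\<forall>q\<in>?Q1 \<union> ?Q2. W q \<omega> \<le> (if q < t then fst p else snd p))" for \<omega>
      using t by (intro running_max_pair_le_iff continuous_path) auto
    show ?thesis unfolding B W using t by (intro bridge_below_countable Q) auto
  qed
  have "distr M borel ?X = distr (density M (weight r)) borel ?Y"
  proof (rule finite_borel_measure_eqI_atMost)
    show "finite_measure (distr M borel ?X)" by (intro finite_measure_distr X)
    fix p
    have "emeasure (distr M borel ?X) {..p} = (\<integral>\<^sup>+q. indicator {..p} q \<partial>distr M borel ?X)"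
      by simp
    also have "\<dots> = (\<integral>\<^sup>+\<omega>. indicator {..p} (?X \<omega>) \<partial>M)"
      by (rule nn_integral_distr) simp_all
    also have "\<dots> = (\<integral>\<^sup>+\<omega>. (if ?X \<omega> \<le> p then 1 else 0) \<partial>M)"
      by (intro nn_integral_cong) (auto simp: indicator_def)
    also have "\<dots> = (\<integral>\<^sup>+\<omega>. weight r \<omega> * indicator {..p} (?Y \<omega>) \<partial>M)"
      unfolding box by (intro nn_integral_cong) (auto simp: indicator_def)
    also have "\<dots> = (\<integral>\<^sup>+\<omega>. indicator {..p} (?Y \<omega>) \<partial>density M (weight r))"
      by (rule nn_integral_density[symmetric, OF w]) measurable
    also have "\<dots> = (\<integral>\<^sup>+q. indicator {..p} q \<partial>distr (density M (weight r)) borel ?Y)"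
      by (rule nn_integral_distr[symmetric]) simp_all
    also have "\<dots> = emeasure (distr (density M (weight r)) borel ?Y) {..p}"
      by simp
    finally show "emeasure (distr M borel ?X) {..p} = emeasure (distr (density M (weight r)) borel ?Y) {..p}" .
  qed auto
  then have "(\<integral>\<^sup>+p. f p \<partial>distr M borel ?X) = (\<integral>\<^sup>+p. f p \<partial>distr (density M (weight r)) borel ?Y)"
    by simp
  moreover have "(\<integral>\<^sup>+p. f p \<partial>distr M borel ?X) = (\<integral>\<^sup>+\<omega>. f (?X \<omega>) \<partial>M)"
    by (rule nn_integral_distr) simp_all
  moreover have "(\<integral>\<^sup>+p. f p \<partial>distr (density M (weight r)) borel ?Y) = (\<integral>\<^sup>+\<omega>. f (?Y \<omega>) \<partial>density M (weight r))"
    by (rule nn_integral_distr) simp_all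
  moreover have "(\<integral>\<^sup>+\<omega>. f (?Y \<omega>) \<partial>density M (weight r)) = (\<integral>\<^sup>+\<omega>. weight r \<omega> * f (?Y \<omega>) \<partial>M)"
    by (rule nn_integral_density[OF w]) measurable
  ultimately show ?thesis
    by (simp only: mult.commute)
qed

text \<open>The bridge returns to \<open>B 1 = 0\<close>, so a positive maximum over \<open>[t, 1]\<close> is attained before
  time \<open>1\<close>.\<close>

lemma bridge_max_before_1:
  assumes t: "0 \<le> t" "t < 1" and a: "0 \<le> a" "a < max_B t 1 \<omega>"
    and r: "r \<longlonglongrightarrow> 1" "\<And>n. t \<le> r n" "\<And>n. r n \<le> 1"
  shows "eventually (\<lambda>n. a < max_B t (r n) \<omega>) sequentially"
    and "eventually (\<lambda>n. max_B t (r n) \<omega> = max_B t 1 \<omega>) sequentially"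
proof -
  obtain q where q: "q \<in> {t..1}" "max_B t 1 \<omega> = B q \<omega>"
    using running_max_attained[OF continuous_bridge_path[of t 1 \<omega>]] t by auto
  have "q \<noteq> 1" using a q(2) B_1[of \<omega>] by auto
  then have "q < 1" using q(1) by auto
  then have ev: "eventually (\<lambda>n. q < r n) sequentially"
    by (rule order_tendstoD(1)[OF r(1)])
  then show *: "eventually (\<lambda>n. max_B t (r n) \<omega> = max_B t 1 \<omega>) sequentially"
  proof eventually_elim
    case (elim n)
    have "B q \<omega> \<le> max_B t (r n) \<omega>"
      using elim q t r by (intro running_max_upper continuous_bridge_path) auto
    moreover have "max_B t (r n) \<omega> \<le> max_B t 1 \<omega>"
      using t r by (intro running_max_subset continuous_bridge_path) auto
    ultimately show ?case using q(2) by simp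
  qed
  then show "eventually (\<lambda>n. a < max_B t (r n) \<omega>) sequentially"
    using a(2) by (elim eventually_mono) simp
qed

lemma max_B_nonneg: "0 \<le> t \<Longrightarrow> t \<le> 1 \<Longrightarrow> 0 \<le> max_B 0 t \<omega>"
  using running_max_upper[OF continuous_bridge_path, of 0 t 0 \<omega>] by (simp add: B_0)

lemma max_W_nonneg: "0 \<le> t \<Longrightarrow> 0 \<le> max_W 0 t \<omega>"
  using running_max_upper[OF continuous_path, of 0 0 t \<omega>] by (simp add: W_0)

text \<open>The remaining time before 1 along a sequence. The shift by 2 keeps it at most
  \<open>(1 - t) / 2\<close>, the range in which the pinned bounds are uniform.\<close>

definition gap :: "real \<Rightarrow> nat \<Rightarrow> real" where "gap t n = (1 - t) / real (n + 2)"

lemma gap: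
  assumes "t < 1"
  shows "0 < gap t n" "gap t n \<le> (1 - t) / 2" "gap t \<longlonglongrightarrow> 0" "(\<lambda>n. 1 - gap t n) \<longlonglongrightarrow> 1"
    "t < 1 - gap t n" "1 - gap t n < 1"
proof -
  show 1: "0 < gap t n" "gap t n \<le> (1 - t) / 2"
    unfolding gap_def using assms by (intro divide_left_mono divide_pos_pos mult_pos_pos; simp)+
  then show "t < 1 - gap t n" "1 - gap t n < 1" using assms by (auto simp: field_simps)
  show *: "gap t \<longlonglongrightarrow> 0"
    unfolding gap_def[abs_def] by real_asymp
  show "(\<lambda>n. 1 - gap t n) \<longlonglongrightarrow> 1"
    using tendsto_diff[OF tendsto_const[of 1] *] by simp
qed

lemma nn_integral_weight:
  assumes r: "0 \<le> r" and g: "g \<in> borel_measurable M"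
  shows "(\<integral>\<^sup>+\<omega>. g \<omega> * weight r \<omega> \<partial>M)
    = ennreal (1 / heat 1 0) * (\<integral>\<^sup>+\<omega>. g \<omega> * ennreal (heat (1 - r) (W r \<omega>)) \<partial>M)"
proof -
  have [measurable]: "W r \<in> borel_measurable M" using r by (rule measurable_W)
  have h: "(\<lambda>\<omega>. ennreal (heat (1 - r) (W r \<omega>))) \<in> borel_measurable M" by measurable
  have "weight r \<omega> = ennreal (1 / heat 1 0) * ennreal (heat (1 - r) (W r \<omega>))" for \<omega>
    using heat_1_0 by (subst ennreal_mult[symmetric]) auto
  then have "(\<integral>\<^sup>+\<omega>. g \<omega> * weight r \<omega> \<partial>M)
      = (\<integral>\<^sup>+\<omega>. ennreal (1 / heat 1 0) * (g \<omega> * ennreal (heat (1 - r) (W r \<omega>))) \<partial>M)"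
    by (simp only: mult_ac)
  also have "\<dots> = ennreal (1 / heat 1 0) * (\<integral>\<^sup>+\<omega>. g \<omega> * ennreal (heat (1 - r) (W r \<omega>)) \<partial>M)"
    by (rule nn_integral_cmult[OF borel_measurable_times_ennreal[OF g h]])
  finally show ?thesis .
qed

lemma inverse_heat_1_0: "ennreal (1 / heat 1 0) * ennreal (heat 1 0) = 1"
  using heat_1_0 by (subst ennreal_mult[symmetric]) auto

text \<open>The identity is available for maxima up to \<open>?r n < 1\<close>, and both sides have
  limits: the Brownian side by pinning, the bridge side because for each \<open>\<omega>\<close> the
  comparison of maxima eventually agrees with that on the full interval.\<close>

lemma bridge_early_max_law:
  assumes t: "0 < t" "t < 1" and f[measurable]: "f \<in> borel_measurable borel" and f1: "\<And>a. f a \<le> 1"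
  shows "(\<integral>\<^sup>+\<omega>. (if max_B t 1 \<omega> \<le> max_B 0 t \<omega> then f (max_B 0 t \<omega>) else 0) \<partial>M)
    = (\<integral>\<^sup>+a. f a * ennreal (early_max_B t a) * indicator {0..} a \<partial>lborel)" (is "?L = ?I")
proof -
  let ?r = "\<lambda>n. 1 - gap t n"
  note g = gap[OF t(2)]
  let ?J = "\<lambda>n. \<integral>\<^sup>+\<omega>. (if max_B t (?r n) \<omega> \<le> max_B 0 t \<omega> then f (max_B 0 t \<omega>) else 0) \<partial>M"
  let ?K = "\<lambda>n. \<integral>\<^sup>+\<omega>. (if max_W t (?r n) \<omega> \<le> max_W 0 t \<omega> then f (max_W 0 t \<omega>) * ennreal (heat (gap t n) (W (?r n) \<omega>)) else 0) \<partial>M"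
  have fm: "(\<lambda>p. if snd p \<le> fst p then f (fst p) else 0) \<in> borel_measurable (borel :: (real \<times> real) measure)"
    unfolding borel_prod[symmetric] by measurable
  have J: "?J n = ennreal (1 / heat 1 0) * ?K n" for n
  proof -
    have [measurable]: "W (?r n) \<in> borel_measurable M" using g(5)[of n] t by (intro measurable_W) simp
    have [measurable]: "max_W 0 t \<in> borel_measurable M" "max_W t (?r n) \<in> borel_measurable M"
      using t g(5)[of n] by (auto intro!: measurable_max)
    have "?J n = (\<integral>\<^sup>+\<omega>. (if max_W t (?r n) \<omega> \<le> max_W 0 t \<omega> then f (max_W 0 t \<omega>) else 0) * weight (?r n) \<omega> \<partial>M)"
      using bridge_pair_law[OF t(1) g(5) g(6) fm] by (simp only: fst_conv snd_conv)
    also have "\<dots> = ennreal (1 / heat 1 0) * (\<integral>\<^sup>+\<omega>. (if max_W t (?r n) \<omega> \<le> max_W 0 t \<omega> then f (max_W 0 t \<omega>) else 0)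
        * ennreal (heat (1 - ?r n) (W (?r n) \<omega>)) \<partial>M)"
      using t g(5)[of n] by (intro nn_integral_weight) simp_all
    also have "\<dots> = ennreal (1 / heat 1 0) * ?K n"
      by (intro arg_cong2[where f = times] nn_integral_cong) auto
    finally show ?thesis .
  qed
  have "?K \<longlonglongrightarrow> ennreal (heat 1 0) * ?I"
    using g by (intro pinned_early_max_limit[OF t f f1]) auto
  then have "(\<lambda>n. ennreal (1 / heat 1 0) * ?K n) \<longlonglongrightarrow> ennreal (1 / heat 1 0) * (ennreal (heat 1 0) * ?I)"
    by (rule ennreal_tendsto_cmult[rotated]) simp
  also have "ennreal (1 / heat 1 0) * (ennreal (heat 1 0) * ?I) = ?I"
    by (simp only: mult.assoc[symmetric] inverse_heat_1_0 mult_1)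
  finally have 1: "?J \<longlonglongrightarrow> ?I" unfolding J .
  have "?J \<longlonglongrightarrow> ?L"
  proof (rule nn_integral_dominated_convergence[where w = "\<lambda>_. 1"])
    have [measurable]: "max_B 0 t \<in> borel_measurable M" "max_B t 1 \<in> borel_measurable M"
      using t by (auto intro!: measurable_max_B)
    show "(\<lambda>\<omega>. if max_B t 1 \<omega> \<le> max_B 0 t \<omega> then f (max_B 0 t \<omega>) else 0) \<in> borel_measurable M"
      by measurable
    fix n
    have [measurable]: "max_B t (?r n) \<in> borel_measurable M"
      using t g(5,6)[of n] by (intro measurable_max_B) auto
    show "(\<lambda>\<omega>. if max_B t (?r n) \<omega> \<le> max_B 0 t \<omega> then f (max_B 0 t \<omega>) else 0) \<in> borel_measurable M"
      by measurable
    show "AE \<omega> in M. (if max_B t (?r n) \<omega> \<le> max_B 0 t \<omega> then f (max_B 0 t \<omega>) else 0) \<le> 1"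
      by (rule AE_I2) (simp add: f1)
  next
    show "AE \<omega> in M. (\<lambda>n. if max_B t (?r n) \<omega> \<le> max_B 0 t \<omega> then f (max_B 0 t \<omega>) else 0)
       \<longlonglongrightarrow> (if max_B t 1 \<omega> \<le> max_B 0 t \<omega> then f (max_B 0 t \<omega>) else 0)"
    proof (rule AE_I2, rule tendsto_eventually)
      fix \<omega>
      show "eventually (\<lambda>n. (if max_B t (?r n) \<omega> \<le> max_B 0 t \<omega> then f (max_B 0 t \<omega>) else 0)
        = (if max_B t 1 \<omega> \<le> max_B 0 t \<omega> then f (max_B 0 t \<omega>) else 0)) sequentially"
      proof (cases "max_B t 1 \<omega> \<le> max_B 0 t \<omega>")
        case True
        have "max_B t (?r n) \<omega> \<le> max_B t 1 \<omega>" for n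
          using t g(5,6)[of n] by (intro running_max_subset continuous_bridge_path) auto
        then have "max_B t (?r n) \<omega> \<le> max_B 0 t \<omega>" for n using True order_trans by blast
        then show ?thesis using True by (intro always_eventually allI) simp
      next
        case False
        \<comment> \<open>A late maximum above the nonnegative early one is attained before time 1,
          hence within reach for all large \<open>n\<close>.\<close>
        have "eventually (\<lambda>n. max_B 0 t \<omega> < max_B t (?r n) \<omega>) sequentially"
          using False t max_B_nonneg[of t \<omega>] g(4) less_imp_le[OF g(5)] less_imp_le[OF g(6)]
          by (intro bridge_max_before_1) auto
        then show ?thesis using False by (elim eventually_mono) simp
      qed
    qed
  qed (auto simp: emeasure_space_1)
  with 1 show ?thesis using LIMSEQ_unique by blast
qed

text \<open>The same limit without an intermediate time. Pinning gives
  \<open>heat 1 0 - heat 1 (2 * m)\<close>, and dividing by \<open>heat 1 0\<close> leaves the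
  Kolmogorov-type formula \<open>1 - exp (- 2 * m\<^sup>2)\<close>.\<close>

lemma bridge_max_cdf:
  assumes m: "0 < m"
  shows "(\<integral>\<^sup>+\<omega>. (if max_B 0 1 \<omega> \<le> m then 1 else 0) \<partial>M) = ennreal (1 - exp (- 2 * m\<^sup>2))" (is "?L = _")
proof -
  let ?r = "\<lambda>n. 1 - gap 0 n"
  have g: "0 < gap 0 n" "gap 0 n \<le> 1 / 2" "gap 0 \<longlonglongrightarrow> 0" "?r \<longlonglongrightarrow> 1" "0 < ?r n" "?r n < 1" for n
    using gap[of 0] by auto
  let ?J = "\<lambda>n. \<integral>\<^sup>+\<omega>. (if max_B 0 (?r n) \<omega> \<le> m then 1 else 0) \<partial>M"
  let ?K = "\<lambda>n. \<integral>\<^sup>+\<omega>. (if max_W 0 (?r n) \<omega> \<le> m then ennreal (heat (gap 0 n) (W (?r n) \<omega>)) else 0) \<partial>M"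
  have J: "?J n = ennreal (1 / heat 1 0) * ?K n" for n
  proof -
    have [measurable]: "W (?r n) \<in> borel_measurable M" using g(5)[of n] by (intro measurable_W) simp
    have [measurable]: "max_W 0 (?r n) \<in> borel_measurable M"
      using g(5)[of n] by (auto intro!: measurable_max)
    have "?J n = (\<integral>\<^sup>+\<omega>. (if max_W 0 (?r n) \<omega> \<le> m then 1 else 0) * weight (?r n) \<omega> \<partial>M)"
      using g by (intro bridge_max_law) auto
    also have "\<dots> = ennreal (1 / heat 1 0) * (\<integral>\<^sup>+\<omega>. (if max_W 0 (?r n) \<omega> \<le> m then 1 else 0)
        * ennreal (heat (1 - ?r n) (W (?r n) \<omega>)) \<partial>M)"
      using g(5)[of n] by (intro nn_integral_weight) simp_all
    also have "\<dots> = ennreal (1 / heat 1 0) * ?K n"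
      by (intro arg_cong2[where f = times] nn_integral_cong) auto
    finally show ?thesis .
  qed
  have "?K \<longlonglongrightarrow> ennreal (heat 1 0 - heat 1 (2 * m))"
    using g m by (intro pinned_max_limit) auto
  then have "(\<lambda>n. ennreal (1 / heat 1 0) * ?K n) \<longlonglongrightarrow> ennreal (1 / heat 1 0) * ennreal (heat 1 0 - heat 1 (2 * m))"
    by (rule ennreal_tendsto_cmult[rotated]) simp
  also have "ennreal (1 / heat 1 0) * ennreal (heat 1 0 - heat 1 (2 * m)) = ennreal (1 / heat 1 0 * (heat 1 0 - heat 1 (2 * m)))"
    using heat_1_0 heat_antimono[of 0 "2 * m" 1] by (intro ennreal_mult[symmetric]) auto
  also have "1 / heat 1 0 * (heat 1 0 - heat 1 (2 * m)) = 1 - exp (- 2 * m\<^sup>2)"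
  proof -
    have "heat 1 (2 * m) = exp (- 2 * m\<^sup>2) * heat 1 0"
      by (simp add: std_normal_density_def power_mult_distrib)
    then have "1 / heat 1 0 * (heat 1 0 - heat 1 (2 * m)) = 1 / heat 1 0 * (heat 1 0 - exp (- 2 * m\<^sup>2) * heat 1 0)"
      by (simp only:)
    also have "\<dots> = 1 - exp (- 2 * m\<^sup>2)"
    proof -
      have "1 / h * (h - e * h) = 1 - e" if "0 < h" for h e :: real
        using that by (simp add: field_simps)
      from this[OF heat_1_0] show ?thesis .
    qed
    finally show ?thesis .
  qed
  finally have 1: "?J \<longlonglongrightarrow> ennreal (1 - exp (- 2 * m\<^sup>2))" unfolding J .
  have "?J \<longlonglongrightarrow> ?L"
  proof (rule nn_integral_dominated_convergence[where w = "\<lambda>_. 1"])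
    have [measurable]: "max_B 0 1 \<in> borel_measurable M"
      by (auto intro!: measurable_max_B)
    show "(\<lambda>\<omega>. if max_B 0 1 \<omega> \<le> m then 1 else 0) \<in> borel_measurable M"
      by measurable
    fix n
    have [measurable]: "max_B 0 (?r n) \<in> borel_measurable M"
      using g(5,6)[of n] by (intro measurable_max_B) auto
    show "(\<lambda>\<omega>. if max_B 0 (?r n) \<omega> \<le> m then 1 else 0) \<in> borel_measurable M"
      by measurable
    show "AE \<omega> in M. (if max_B 0 (?r n) \<omega> \<le> m then 1 else 0) \<le> (1 :: ennreal)"
      by (rule AE_I2) simp
  next
    show "AE \<omega> in M. (\<lambda>n. if max_B 0 (?r n) \<omega> \<le> m then 1 else 0) \<longlonglongrightarrow> (if max_B 0 1 \<omega> \<le> m then 1 else 0 :: ennreal)"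
    proof (rule AE_I2, rule tendsto_eventually)
      fix \<omega>
      show "eventually (\<lambda>n. (if max_B 0 (?r n) \<omega> \<le> m then 1 else 0) = (if max_B 0 1 \<omega> \<le> m then 1 else 0 :: ennreal)) sequentially"
      proof (cases "max_B 0 1 \<omega> \<le> m")
        case True
        have "max_B 0 (?r n) \<omega> \<le> max_B 0 1 \<omega>" for n
          using g(5,6)[of n] by (intro running_max_subset continuous_bridge_path) auto
        then have "max_B 0 (?r n) \<omega> \<le> m" for n using True order_trans by blast
        then show ?thesis using True by (intro always_eventually allI) simp
      next
        case False
        have "eventually (\<lambda>n. m < max_B 0 (?r n) \<omega>) sequentially"
          using False m g(4) less_imp_le[OF g(5)] less_imp_le[OF g(6)]
          by (intro bridge_max_before_1) auto
        then show ?thesis using False by (elim eventually_mono) simp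
      qed
    qed
  qed (auto simp: emeasure_space_1)
  with 1 show ?thesis using LIMSEQ_unique by blast
qed

text \<open>Up to \<open>r < 1\<close> the law of the bridge maxima has a density relative to that
  of \<open>W\<close>, so null events carry over.\<close>

lemma AE_bridge_from_brownian:
  assumes t: "0 < t" "t < r" "r < 1" and P: "Measurable.pred (borel :: (real \<times> real) measure) P"
    and W: "AE \<omega> in M. P (max_W 0 t \<omega>, max_W t r \<omega>)"
  shows "AE \<omega> in M. P (max_B 0 t \<omega>, max_B t r \<omega>)"
proof -
  have f: "(\<lambda>p. if P p then 0 else 1 :: ennreal) \<in> borel_measurable (borel :: (real \<times> real) measure)"
    using P by measurable
  have X: "(\<lambda>\<omega>. (max_B 0 t \<omega>, max_B t r \<omega>)) \<in> borel_measurable M"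
  proof -
    have [measurable]: "max_B 0 t \<in> borel_measurable M" "max_B t r \<in> borel_measurable M"
      using t by (auto intro!: measurable_max_B)
    show ?thesis unfolding borel_prod[symmetric] by measurable
  qed
  have "(\<integral>\<^sup>+\<omega>. (if P (max_B 0 t \<omega>, max_B t r \<omega>) then 0 else 1) \<partial>M)
     = (\<integral>\<^sup>+\<omega>. (if P (max_W 0 t \<omega>, max_W t r \<omega>) then 0 else 1) * weight r \<omega> \<partial>M)"
    by (rule bridge_pair_law[OF t f])
  also have "\<dots> = (\<integral>\<^sup>+\<omega>. 0 \<partial>M)"
    using W by (intro nn_integral_cong_AE) (auto elim: eventually_mono)
  finally have "(\<integral>\<^sup>+\<omega>. (if P (max_B 0 t \<omega>, max_B t r \<omega>) then 0 else 1) \<partial>M) = (0::ennreal)" by simp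
  then have "AE \<omega> in M. (if P (max_B 0 t \<omega>, max_B t r \<omega>) then 0 else 1) = (0::ennreal)"
    by (subst (asm) nn_integral_0_iff_AE) (rule measurable_compose[OF X f])
  then show ?thesis by eventually_elim (auto split: if_splits)
qed

lemma AE_bridge_max_pos:
  assumes t: "0 < t" "t < 1"
  shows "AE \<omega> in M. 0 < max_B 0 t \<omega>"
proof -
  obtain r where r: "t < r" "r < 1" using t(2) dense by blast
  have P: "Measurable.pred (borel :: (real \<times> real) measure) (\<lambda>p. fst p \<noteq> 0)"
    unfolding borel_prod[symmetric] by measurable
  have "AE \<omega> in M. fst (max_B 0 t \<omega>, max_B t r \<omega>) \<noteq> 0"
    by (rule AE_bridge_from_brownian[OF t(1) r P]) (simp add: AE_max_neq[OF t(1)])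
  then show ?thesis
  proof eventually_elim
    case (elim \<omega>)
    then show ?case using max_B_nonneg[of t \<omega>] t by simp
  qed
qed

text \<open>The comparison with \<open>W\<close> stops short of time 1. Ties are therefore excluded
  at countably many truncation times at once, and a tie on the full interval would already occur at
  one of them.\<close>

lemma AE_bridge_early_late_neq:
  assumes t: "0 < t" "t < 1"
  shows "AE \<omega> in M. max_B 0 t \<omega> \<noteq> max_B t 1 \<omega>"
proof -
  note g = gap[OF t(2)]
  have P: "Measurable.pred (borel :: (real \<times> real) measure) (\<lambda>p. fst p \<noteq> snd p)"
    unfolding borel_prod[symmetric] by measurable
  have "AE \<omega> in M. fst (max_B 0 t \<omega>, max_B t (1 - gap t n) \<omega>) \<noteq> snd (max_B 0 t \<omega>, max_B t (1 - gap t n) \<omega>)" for n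
    by (rule AE_bridge_from_brownian[OF t(1) g(5,6) P]) (simp add: AE_early_late_max_neq[OF t(1) g(5)])
  then have "AE \<omega> in M. \<forall>n. max_B 0 t \<omega> \<noteq> max_B t (1 - gap t n) \<omega>"
    by (simp add: AE_all_countable)
  then show ?thesis
    using AE_bridge_max_pos[OF t]
  proof eventually_elim
    case (elim \<omega>)
    show ?case
    proof
      assume eq: "max_B 0 t \<omega> = max_B t 1 \<omega>"
      \<comment> \<open>In case of a tie the late maximum equals the early one, which is positive,
        so it is attained before time 1.\<close>
      have "eventually (\<lambda>n. max_B t (1 - gap t n) \<omega> = max_B t 1 \<omega>) sequentially"
        using eq elim t g(4) less_imp_le[OF g(5)] less_imp_le[OF g(6)]
        by (intro bridge_max_before_1(2)[where a = 0]) auto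
      then obtain n where "max_B t (1 - gap t n) \<omega> = max_B t 1 \<omega>"
        by (auto simp: eventually_sequentially)
      with eq elim show False by metis
    qed
  qed
qed

end

subsection \<open>The time of the combined maximum\<close>

context prob_space
begin

lemma indep_pair_sym:
  assumes "indep_pair S X T Y"
  shows "indep_pair T Y S X"
proof -
  from assms have [measurable]: "X \<in> measurable M S" "Y \<in> measurable M T"
    and eq: "distr M (S \<Otimes>\<^sub>M T) (\<lambda>\<omega>. (X \<omega>, Y \<omega>)) = distr M S X \<Otimes>\<^sub>M distr M T Y"
    by (auto simp: indep_pair_def)
  interpret X': prob_space "distr M S X" by (rule prob_space_distr) simp
  interpret Y': prob_space "distr M T Y" by (rule prob_space_distr) simp
  interpret pair_sigma_finite "distr M T Y" "distr M S X" ..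
  have "distr M T Y \<Otimes>\<^sub>M distr M S X
      = distr (distr M S X \<Otimes>\<^sub>M distr M T Y) (distr M T Y \<Otimes>\<^sub>M distr M S X) (\<lambda>(x, y). (y, x))"
    by (rule distr_pair_swap)
  also have "\<dots> = distr (distr M (S \<Otimes>\<^sub>M T) (\<lambda>\<omega>. (X \<omega>, Y \<omega>))) (T \<Otimes>\<^sub>M S) (\<lambda>(x, y). (y, x))"
    unfolding eq by (rule distr_cong) (auto cong: sets_pair_measure_cong)
  also have "\<dots> = distr M (T \<Otimes>\<^sub>M S) (\<lambda>\<omega>. (Y \<omega>, X \<omega>))"
    by (subst distr_distr) (auto simp: comp_def)
  finally show ?thesis by (simp add: indep_pair_def)
qed

end

definition rho :: "real \<Rightarrow> real" where
  "rho t = rho_W t + rho_B t"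

text \<open>Tonelli: the early law is written as a time integral of its derivative and the level is
  integrated first. Single levels do not matter, so the identity is needed only for
  \<open>a > 0\<close>.\<close>

lemma integral_over_early_times:
  fixes D :: "real \<Rightarrow> real \<Rightarrow> real" and k :: "real \<Rightarrow> ennreal"
  assumes D: "(\<lambda>p. D (fst p) (snd p)) \<in> borel_measurable (borel \<Otimes>\<^sub>M borel)"
    and k: "k \<in> borel_measurable borel"
    and E: "\<And>a. 0 < a \<Longrightarrow> (\<integral>\<^sup>+s. ennreal (D s a) * indicator {0<..<t} s \<partial>lborel) = ennreal (E a)"
  shows "(\<integral>\<^sup>+a. k a * ennreal (E a) * indicator {0..} a \<partial>lborel)
    = (\<integral>\<^sup>+s. (\<integral>\<^sup>+a. ennreal (D s a) * k a * indicator {0..} a \<partial>lborel) * indicator {0<..<t} s \<partial>lborel)"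
proof -
  note [measurable] = D k
  have [measurable]: "(\<lambda>s. D s a) \<in> borel_measurable borel" for a
    using measurable_compose[OF _ D, of "\<lambda>s. (s, a)" borel] by simp
  have [measurable]: "(\<lambda>p. D (snd p) (fst p)) \<in> borel_measurable (borel \<Otimes>\<^sub>M borel)"
    using measurable_compose[OF _ D, of "\<lambda>p. (snd p, fst p)" "borel \<Otimes>\<^sub>M borel"] by simp
  have [measurable]: "D s \<in> borel_measurable borel" for s
    using measurable_compose[OF _ D, of "\<lambda>a. (s, a)" borel] by simp
  have "(\<integral>\<^sup>+a. k a * ennreal (E a) * indicator {0..} a \<partial>lborel)
    = (\<integral>\<^sup>+a. \<integral>\<^sup>+s. ennreal (D s a) * k a * indicator {0..} a * indicator {0<..<t} s \<partial>lborel \<partial>lborel)"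
  proof (rule nn_integral_cong_AE)
    show "AE a in lborel. k a * ennreal (E a) * indicator {0..} a =
      (\<integral>\<^sup>+s. ennreal (D s a) * k a * indicator {0..} a * indicator {0<..<t} s \<partial>lborel)"
      using AE_lborel_singleton[of 0]
    proof eventually_elim
      case (elim a)
      show ?case
      proof (cases "0 < a")
        case True
        have "k a * ennreal (E a) = (\<integral>\<^sup>+s. k a * (ennreal (D s a) * indicator {0<..<t} s) \<partial>lborel)"
          unfolding E[OF True, symmetric] by (rule nn_integral_cmult[symmetric]) measurable
        then show ?thesis using True by (simp add: mult_ac)
      qed (use elim in auto)
    qed
  qed
  also have "\<dots> = (\<integral>\<^sup>+s. \<integral>\<^sup>+a. ennreal (D s a) * k a * indicator {0..} a * indicator {0<..<t} s \<partial>lborel \<partial>lborel)"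
    by (rule lborel_pair.Fubini'[symmetric]) (simp add: split_beta')
  also have "\<dots> = (\<integral>\<^sup>+s. (\<integral>\<^sup>+a. ennreal (D s a) * k a * indicator {0..} a \<partial>lborel) * indicator {0<..<t} s \<partial>lborel)"
    by (intro nn_integral_cong nn_integral_multc) measurable
  finally show ?thesis .
qed

lemma rho_nonneg: "0 < s \<Longrightarrow> s < 1 \<Longrightarrow> 0 \<le> rho_W s" "0 < s \<Longrightarrow> s < 1 \<Longrightarrow> 0 \<le> rho_B s"
proof -
  assume s: "0 < s" "s < 1"
  show "0 \<le> rho_W s" unfolding rho_W_def using s by (intro divide_nonneg_nonneg mult_nonneg_nonneg) auto
  have "s\<^sup>2 \<le> s * 1" unfolding power2_eq_square using s by (intro mult_left_mono) auto
  then have "0 \<le> 1 + s - s\<^sup>2" by simp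
  then show "0 \<le> rho_B s" unfolding rho_B_def using s
    by (intro mult_nonneg_nonneg add_nonneg_nonneg divide_nonneg_nonneg) auto
qed

lemma measurable_rho[measurable]: "rho_W \<in> borel_measurable borel" "rho_B \<in> borel_measurable borel"
proof -
  show "rho_W \<in> borel_measurable borel" unfolding rho_W_def[abs_def] by measurable
  have [measurable]: "arctan \<in> borel_measurable borel"
    by (intro borel_measurable_continuous_onI continuous_intros)
  show "rho_B \<in> borel_measurable borel" unfolding rho_B_def[abs_def] by measurable
qed

text \<open>Independence is recorded only for the maxima on both sides of one time; these pairs
  determine the events that decide whether \<open>T\<close> is at most \<open>t\<close>.\<close>

locale independent_brownian_and_bridge = brownian_and_bridge +
  assumes indep_max: "\<And>t. 0 < t \<Longrightarrow> t < 1 \<Longrightarrow>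
    indep_pair borel (\<lambda>\<omega>. (max_W 0 t \<omega>, max_W t 1 \<omega>)) borel (\<lambda>\<omega>. (max_B 0 t \<omega>, max_B t 1 \<omega>))"
begin

lemma total_max:
  assumes "0 < t" "t < 1"
  shows "max_W 0 1 \<omega> = max (max_W 0 t \<omega>) (max_W t 1 \<omega>)" "max_B 0 1 \<omega> = max (max_B 0 t \<omega>) (max_B t 1 \<omega>)"
  using assms by (auto intro!: running_max_split continuous_path continuous_bridge_path)

text \<open>With \<open>W\<close> frozen, the bridge contributes the distribution function of its
  maximum at the level \<open>max_W 0 t\<close>. This level is almost surely positive, where the
  explicit formula holds.\<close>

lemma early_W_prob:
  assumes t: "0 < t" "t < 1"
  shows "(\<integral>\<^sup>+\<omega>. (if max_W t 1 \<omega> \<le> max_W 0 t \<omega> \<and> max_B 0 1 \<omega> \<le> max_W 0 t \<omega> then 1 else 0) \<partial>M)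
    = (\<integral>\<^sup>+s. ennreal (rho_W s) * indicator {0<..<t} s \<partial>lborel)"
proof -
  let ?f = "\<lambda>a. ennreal (1 - exp (- 2 * a\<^sup>2))"
  let ?h = "\<lambda>p :: (real \<times> real) \<times> (real \<times> real). if snd (fst p) \<le> fst (fst p) \<and> max (fst (snd p)) (snd (snd p)) \<le> fst (fst p) then 1 else 0 :: ennreal"
  have h: "?h \<in> borel_measurable (borel \<Otimes>\<^sub>M borel)"
    unfolding borel_prod[symmetric] by measurable
  have "(\<integral>\<^sup>+\<omega>. (if max_W t 1 \<omega> \<le> max_W 0 t \<omega> \<and> max_B 0 1 \<omega> \<le> max_W 0 t \<omega> then 1 else 0) \<partial>M)
    = (\<integral>\<^sup>+\<omega>. \<integral>\<^sup>+\<omega>'. (if max_W t 1 \<omega> \<le> max_W 0 t \<omega> \<and> max_B 0 1 \<omega>' \<le> max_W 0 t \<omega> then 1 else 0) \<partial>M \<partial>M)"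
    using indep_pair_nn_integral[OF indep_max[OF t] h] unfolding total_max(2)[OF t] by (simp only: fst_conv snd_conv)
  also have "\<dots> = (\<integral>\<^sup>+\<omega>. (if max_W t 1 \<omega> \<le> max_W 0 t \<omega> then ?f (max_W 0 t \<omega>) else 0) \<partial>M)"
  proof (rule nn_integral_cong_AE)
    show "AE \<omega> in M. (\<integral>\<^sup>+\<omega>'. (if max_W t 1 \<omega> \<le> max_W 0 t \<omega> \<and> max_B 0 1 \<omega>' \<le> max_W 0 t \<omega> then 1 else 0) \<partial>M)
      = (if max_W t 1 \<omega> \<le> max_W 0 t \<omega> then ?f (max_W 0 t \<omega>) else 0)"
      using AE_max_neq[OF t(1), of 0]
    proof eventually_elim
      case (elim \<omega>)
      then have "0 < max_W 0 t \<omega>" using max_W_nonneg[of t \<omega>] t by simp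
      then show ?case using bridge_max_cdf[of "max_W 0 t \<omega>"] by simp
    qed
  qed
  also have "\<dots> = (\<integral>\<^sup>+a. ?f a * ennreal (early_max_W t a) * indicator {0..} a \<partial>lborel)"
    by (rule early_max_law[OF t]) simp
  also have "\<dots> = (\<integral>\<^sup>+s. (\<integral>\<^sup>+a. ennreal (W_density s a) * ?f a * indicator {0..} a \<partial>lborel) * indicator {0<..<t} s \<partial>lborel)"
    by (rule integral_over_early_times) (use t in \<open>auto intro: W_density_integral\<close>)
  also have "\<dots> = (\<integral>\<^sup>+s. ennreal (rho_W s) * indicator {0<..<t} s \<partial>lborel)"
  proof (rule nn_integral_cong)
    fix s :: real
    show "(\<integral>\<^sup>+a. ennreal (W_density s a) * ?f a * indicator {0..} a \<partial>lborel) * indicator {0<..<t} s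
      = ennreal (rho_W s) * indicator {0<..<t} s"
      using rho_W_integral[of s] t by (cases "s \<in> {0<..<t}") auto
  qed
  finally show ?thesis .
qed

text \<open>The roles are exchanged: with the bridge frozen, the motion contributes
  \<open>f\<close>, the distribution function of \<open>max_W 0 1\<close>. It is kept in integral
  form, as \<open>rho_B_integral\<close> expects.\<close>

lemma early_B_prob:
  assumes t: "0 < t" "t < 1"
  shows "(\<integral>\<^sup>+\<omega>. (if max_B t 1 \<omega> \<le> max_B 0 t \<omega> \<and> max_W 0 1 \<omega> \<le> max_B 0 t \<omega> then 1 else 0) \<partial>M)
    = (\<integral>\<^sup>+s. ennreal (rho_B s) * indicator {0<..<t} s \<partial>lborel)"
proof -
  define f where "f a = (\<integral>\<^sup>+v. ennreal (2 * heat 1 v) * indicator {0..a} v \<partial>lborel)" for a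
  have f_eq: "(\<integral>\<^sup>+\<omega>. (if max_W 0 1 \<omega> \<le> a then 1 else 0) \<partial>M) = f a" for a
  proof -
    have "(\<integral>\<^sup>+\<omega>. (if max_W 0 1 \<omega> \<le> a then 1 else 0) \<partial>M) = (\<integral>\<^sup>+\<omega>. indicator {..a} (max_W 0 1 \<omega>) \<partial>M)"
      by (intro nn_integral_cong) (auto simp: indicator_def)
    also have "\<dots> = (\<integral>\<^sup>+v. ennreal (2 * heat 1 v) * indicator {..a} v * indicator {0..} v \<partial>lborel)"
      by (rule nn_integral_max) auto
    also have "\<dots> = f a"
      unfolding f_def by (intro nn_integral_cong) (auto simp: indicator_def)
    finally show ?thesis .
  qed
  have f1: "f a \<le> 1" for a
  proof -
    have "(\<integral>\<^sup>+\<omega>. (if max_W 0 1 \<omega> \<le> a then 1 else 0) \<partial>M) \<le> (\<integral>\<^sup>+\<omega>. 1 \<partial>M)"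
      by (intro nn_integral_mono) auto
    then show ?thesis unfolding f_eq by (simp add: emeasure_space_1)
  qed
  have fm: "f \<in> borel_measurable borel"
  proof -
    have "(\<lambda>p. ennreal (2 * heat 1 (snd p)) * (if 0 \<le> snd p \<and> snd p \<le> fst p then 1 else 0)) \<in> borel_measurable (borel \<Otimes>\<^sub>M lborel)"
      by measurable
    from lborel.borel_measurable_nn_integral_fst[OF this]
    have "(\<lambda>a. \<integral>\<^sup>+v. ennreal (2 * heat 1 v) * (if 0 \<le> v \<and> v \<le> a then 1 else 0) \<partial>lborel) \<in> borel_measurable borel"
      by (simp only: fst_conv snd_conv)
    moreover have "f = (\<lambda>a. \<integral>\<^sup>+v. ennreal (2 * heat 1 v) * (if 0 \<le> v \<and> v \<le> a then 1 else 0) \<partial>lborel)"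
      unfolding f_def[abs_def] by (intro ext nn_integral_cong) (simp add: indicator_def)
    ultimately show ?thesis by (simp only:)
  qed
  let ?h = "\<lambda>p :: (real \<times> real) \<times> (real \<times> real). if snd (fst p) \<le> fst (fst p) \<and> max (fst (snd p)) (snd (snd p)) \<le> fst (fst p) then 1 else 0 :: ennreal"
  have h: "?h \<in> borel_measurable (borel \<Otimes>\<^sub>M borel)"
    unfolding borel_prod[symmetric] by measurable
  have "(\<integral>\<^sup>+\<omega>. (if max_B t 1 \<omega> \<le> max_B 0 t \<omega> \<and> max_W 0 1 \<omega> \<le> max_B 0 t \<omega> then 1 else 0) \<partial>M)
    = (\<integral>\<^sup>+\<omega>. \<integral>\<^sup>+\<omega>'. (if max_B t 1 \<omega> \<le> max_B 0 t \<omega> \<and> max_W 0 1 \<omega>' \<le> max_B 0 t \<omega> then 1 else 0) \<partial>M \<partial>M)"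
    using indep_pair_nn_integral[OF indep_pair_sym[OF indep_max[OF t]] h] unfolding total_max(1)[OF t] by (simp only: fst_conv snd_conv)
  also have "\<dots> = (\<integral>\<^sup>+\<omega>. (if max_B t 1 \<omega> \<le> max_B 0 t \<omega> then f (max_B 0 t \<omega>) else 0) \<partial>M)"
  proof (rule nn_integral_cong)
    fix \<omega>
    show "(\<integral>\<^sup>+\<omega>'. (if max_B t 1 \<omega> \<le> max_B 0 t \<omega> \<and> max_W 0 1 \<omega>' \<le> max_B 0 t \<omega> then 1 else 0) \<partial>M)
      = (if max_B t 1 \<omega> \<le> max_B 0 t \<omega> then f (max_B 0 t \<omega>) else 0)"
      using f_eq[of "max_B 0 t \<omega>"] by simp
  qed
  also have "\<dots> = (\<integral>\<^sup>+a. f a * ennreal (early_max_B t a) * indicator {0..} a \<partial>lborel)"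
    by (rule bridge_early_max_law[OF t fm f1])
  also have "\<dots> = (\<integral>\<^sup>+s. (\<integral>\<^sup>+a. ennreal (B_density s a) * f a * indicator {0..} a \<partial>lborel) * indicator {0<..<t} s \<partial>lborel)"
    by (rule integral_over_early_times[OF _ fm]) (use t in \<open>auto intro: B_density_integral\<close>)
  also have "\<dots> = (\<integral>\<^sup>+s. ennreal (rho_B s) * indicator {0<..<t} s \<partial>lborel)"
  proof (rule nn_integral_cong)
    fix s :: real
    show "(\<integral>\<^sup>+a. ennreal (B_density s a) * f a * indicator {0..} a \<partial>lborel) * indicator {0<..<t} s
      = ennreal (rho_B s) * indicator {0<..<t} s"
      using rho_B_integral[of s] t unfolding f_def[symmetric] by (cases "s \<in> {0<..<t}") auto
  qed
  finally show ?thesis .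
qed

lemma AE_total_max_neq: "AE \<omega> in M. max_W 0 1 \<omega> \<noteq> max_B 0 1 \<omega>"
proof -
  \<comment> \<open>Any interior time would do: the total maxima are recovered from the two pairs
    split there.\<close>
  have t: "0 < (1/2 :: real)" "(1/2 :: real) < 1" by auto
  let ?h = "\<lambda>p :: (real \<times> real) \<times> (real \<times> real). if max (fst (snd p)) (snd (snd p)) = max (fst (fst p)) (snd (fst p)) then 1 else 0 :: ennreal"
  have h: "?h \<in> borel_measurable (borel \<Otimes>\<^sub>M borel)"
    unfolding borel_prod[symmetric] by measurable
  have [measurable]: "max_B 0 1 \<in> borel_measurable M" "max_W 0 1 \<in> borel_measurable M"
    by (auto intro!: measurable_max measurable_max_B)
  have "(\<integral>\<^sup>+\<omega>. (if max_W 0 1 \<omega> = max_B 0 1 \<omega> then 1 else 0) \<partial>M)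
    = (\<integral>\<^sup>+\<omega>. \<integral>\<^sup>+\<omega>'. (if max_W 0 1 \<omega>' = max_B 0 1 \<omega> then 1 else 0) \<partial>M \<partial>M)"
    using indep_pair_nn_integral[OF indep_pair_sym[OF indep_max[OF t]] h] unfolding total_max[OF t] by (simp only: fst_conv snd_conv)
  also have "\<dots> = (\<integral>\<^sup>+\<omega>. \<integral>\<^sup>+\<omega>'. 0 \<partial>M \<partial>M)"
  proof (intro nn_integral_cong[OF nn_integral_cong_AE])
    fix \<omega>
    show "AE \<omega>' in M. (if max_W 0 1 \<omega>' = max_B 0 1 \<omega> then 1 else 0) = (0::ennreal)"
      using AE_max_neq[OF zero_less_one, of "max_B 0 1 \<omega>"] by eventually_elim simp
  qed
  finally have "(\<integral>\<^sup>+\<omega>. (if max_W 0 1 \<omega> = max_B 0 1 \<omega> then 1 else 0) \<partial>M) = (0::ennreal)" by simp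
  then have "AE \<omega> in M. (if max_W 0 1 \<omega> = max_B 0 1 \<omega> then 1 else 0) = (0::ennreal)"
    by (subst (asm) nn_integral_0_iff_AE) measurable
  then show ?thesis by eventually_elim (auto split: if_splits)
qed

section \<open>Distribution function and density of the maximizing time\<close>

context
  fixes T :: "'a \<Rightarrow> real"
  assumes measurable_T: "T \<in> borel_measurable M"
    and T_bounds: "\<And>\<omega>. \<omega> \<in> space M \<Longrightarrow> T \<omega> \<in> {0..1}"
    and T_argmax: "AE \<omega> in M. max (W (T \<omega>) \<omega>) (B (T \<omega>) \<omega>) = max (max_W 0 1 \<omega>) (max_B 0 1 \<omega>)"
begin

text \<open>\<open>T\<close> is any measurable maximizer. Once ties are excluded,
  \<open>T \<omega> \<le> t\<close> holds exactly when one of the two processes has its early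
  maximum as the overall maximum, and this cannot happen for both, so the indicator is a sum of two
  indicators.\<close>

lemma argmax_time_cdf:
  assumes t: "0 < t" "t < 1"
  shows "emeasure M {\<omega>\<in>space M. T \<omega> \<le> t} = (\<integral>\<^sup>+s. ennreal (rho s) * indicator {0<..<t} s \<partial>lborel)"
proof -
  note [measurable] = measurable_T
  have [measurable]: "max_B 0 1 \<in> borel_measurable M" "max_W 0 1 \<in> borel_measurable M"
    "max_B 0 t \<in> borel_measurable M" "max_W 0 t \<in> borel_measurable M"
    "max_B t 1 \<in> borel_measurable M" "max_W t 1 \<in> borel_measurable M"
    using t by (auto intro!: measurable_max measurable_max_B)
  let ?E1 = "\<lambda>\<omega>. max_W t 1 \<omega> \<le> max_W 0 t \<omega> \<and> max_B 0 1 \<omega> \<le> max_W 0 t \<omega>"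
  let ?E2 = "\<lambda>\<omega>. max_B t 1 \<omega> \<le> max_B 0 t \<omega> \<and> max_W 0 1 \<omega> \<le> max_B 0 t \<omega>"
  have "emeasure M {\<omega>\<in>space M. T \<omega> \<le> t} = (\<integral>\<^sup>+\<omega>. indicator {\<omega>\<in>space M. T \<omega> \<le> t} \<omega> \<partial>M)"
    by simp
  also have "\<dots> = (\<integral>\<^sup>+\<omega>. (if ?E1 \<omega> then 1 else 0) + (if ?E2 \<omega> then 1 else 0) \<partial>M)"
  proof (rule nn_integral_cong_AE)
    show "AE \<omega> in M. indicator {\<omega>\<in>space M. T \<omega> \<le> t} \<omega> = (if ?E1 \<omega> then 1 else 0) + (if ?E2 \<omega> then 1 else 0 :: ennreal)"
      using T_argmax AE_total_max_neq AE_bridge_early_late_neq[OF t] AE_early_late_max_neq[OF t] AE_space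
    proof eventually_elim
      case (elim \<omega>)
      have T: "0 \<le> T \<omega>" "T \<omega> \<le> 1" using T_bounds[of \<omega>] elim by auto
      have early: "W (T \<omega>) \<omega> \<le> max_W 0 t \<omega> \<and> B (T \<omega>) \<omega> \<le> max_B 0 t \<omega>" if "T \<omega> \<le> t"
        using T t that by (auto intro!: running_max_upper continuous_path continuous_bridge_path)
      have late: "W (T \<omega>) \<omega> \<le> max_W t 1 \<omega> \<and> B (T \<omega>) \<omega> \<le> max_B t 1 \<omega>" if "\<not> T \<omega> \<le> t"
        using T t that by (auto intro!: running_max_upper continuous_path continuous_bridge_path)
      show ?case
      proof (cases "T \<omega> \<le> t")
        case True
        with early have "(?E1 \<omega> \<and> \<not> ?E2 \<omega>) \<or> (?E2 \<omega> \<and> \<not> ?E1 \<omega>)"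
          using elim(1-4) unfolding total_max[OF t] by (auto simp: max_def split: if_splits)
        then show ?thesis using True elim(5) by auto
      next
        case False
        with late have "\<not> ?E1 \<omega> \<and> \<not> ?E2 \<omega>"
          using elim(1-4) unfolding total_max[OF t] by (auto simp: max_def split: if_splits)
        then show ?thesis using False by auto
      qed
    qed
  qed
  also have "\<dots> = (\<integral>\<^sup>+\<omega>. (if ?E1 \<omega> then 1 else 0) \<partial>M) + (\<integral>\<^sup>+\<omega>. (if ?E2 \<omega> then 1 else 0) \<partial>M)"
    by (rule nn_integral_add) measurable
  also have "\<dots> = (\<integral>\<^sup>+s. ennreal (rho_W s) * indicator {0<..<t} s \<partial>lborel) + (\<integral>\<^sup>+s. ennreal (rho_B s) * indicator {0<..<t} s \<partial>lborel)"
    unfolding early_W_prob[OF t] early_B_prob[OF t] ..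
  also have "\<dots> = (\<integral>\<^sup>+s. ennreal (rho_W s) * indicator {0<..<t} s + ennreal (rho_B s) * indicator {0<..<t} s \<partial>lborel)"
    by (rule nn_integral_add[symmetric]) measurable
  also have "\<dots> = (\<integral>\<^sup>+s. ennreal (rho s) * indicator {0<..<t} s \<partial>lborel)"
    using t by (intro nn_integral_cong) (auto simp: indicator_def rho_def rho_nonneg)
  finally show ?thesis .
qed

text \<open>Almost surely \<open>W 1\<close> lies strictly below its maximum, and so does
  \<open>B 1 = 0\<close> because that maximum is positive. Hence neither process reaches the
  combined maximum at time 1.\<close>

lemma AE_argmax_time_less_1: "AE \<omega> in M. T \<omega> < 1"
  using T_argmax AE_max_neq_end[OF zero_less_one] AE_max_neq[OF zero_less_one, of 0] AE_space
proof eventually_elim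
  case (elim \<omega>)
  have "W 1 \<omega> \<le> max_W 0 1 \<omega>" by (intro running_max_upper continuous_path) auto
  moreover have "0 \<le> max_W 0 1 \<omega>" by (rule max_W_nonneg) simp
  ultimately have "max (W 1 \<omega>) (B 1 \<omega>) < max_W 0 1 \<omega>" using elim by (simp add: B_1)
  then have "T \<omega> \<noteq> 1" using elim by auto
  then show ?case using T_bounds[of \<omega>] elim by auto
qed

text \<open>The distribution function is known only for \<open>0 < t < 1\<close>. Continuity of
  measures extends it: an atom at 0 is excluded by letting \<open>t\<close> decrease to 0, and at 1
  the whole mass is recovered because \<open>T < 1\<close> almost surely.\<close>

lemma argmax_time_distributed:
  "distributed M lborel T (\<lambda>t. ennreal (if 0 < t \<and> t < 1 then rho t else 0))"
proof -
  note [measurable] = measurable_T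
  define f where "f t = ennreal (if 0 < t \<and> t < 1 then rho t else 0)" for t
  have fm[measurable]: "f \<in> borel_measurable borel"
    unfolding f_def[abs_def] rho_def by measurable
  have cdf: "emeasure M {\<omega>\<in>space M. T \<omega> \<le> t} = emeasure (density lborel f) {..t}" if t: "0 < t" "t < 1" for t
  proof -
    have "(\<integral>\<^sup>+s. ennreal (rho s) * indicator {0<..<t} s \<partial>lborel) = (\<integral>\<^sup>+s. f s * indicator {..t} s \<partial>lborel)"
    proof (rule nn_integral_cong_AE)
      show "AE s in lborel. ennreal (rho s) * indicator {0<..<t} s = f s * indicator {..t} s"
        using AE_lborel_singleton[of t] by eventually_elim (use t in \<open>auto simp: f_def indicator_def\<close>)
    qed
    then show ?thesis by (simp add: argmax_time_cdf[OF t] emeasure_density)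
  qed
  have neg: "emeasure (density lborel f) {..t} = 0" if "t \<le> 0" for t
  proof -
    have "(\<lambda>s. f s * indicator {..t} s) = (\<lambda>s. 0)" using that by (auto simp: f_def indicator_def fun_eq_iff)
    then show ?thesis by (simp add: emeasure_density)
  qed
  have le1: "emeasure (density lborel f) {..t} \<le> 1" if "t < 1" for t
  proof (cases "0 < t")
    case True
    then show ?thesis using cdf[OF True that] emeasure_le_1 by metis
  next
    case False
    then show ?thesis using neg[of t] by simp
  qed
  have "distr M borel T = density lborel f"
  proof (rule finite_borel_measure_eqI_atMost)
    show "finite_measure (distr M borel T)" by (rule finite_measure_distr) simp
    fix t :: real
    have D: "emeasure (distr M borel T) {..t} = emeasure M {\<omega>\<in>space M. T \<omega> \<le> t}"
      by (subst emeasure_distr) (auto intro!: arg_cong[where f = "emeasure M"])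
    consider "t \<le> 0" | "0 < t" "t < 1" | "1 \<le> t" by linarith
    then show "emeasure (distr M borel T) {..t} = emeasure (density lborel f) {..t}"
    proof cases
      case 1
      \<comment> \<open>The shift by 2 keeps the endpoint strictly between 0 and 1, where the
        distribution function is known.\<close>
      let ?S = "\<lambda>n :: nat. {..1 / real (n + 2)}"
      have s: "0 < 1 / real (n + 2)" "1 / real (n + 2) < 1" for n by auto
      have dec: "decseq ?S" by (auto simp: decseq_def intro: order_trans divide_left_mono)
      have "(\<lambda>n. emeasure (density lborel f) (?S n)) \<longlonglongrightarrow> emeasure (density lborel f) (\<Inter>n. ?S n)"
      proof (intro Lim_emeasure_decseq dec)
        show "emeasure (density lborel f) (?S n) \<noteq> \<infinity>" for n
          using le_less_trans[OF le1[OF s(2)[of n]] ennreal_one_less_top] by simp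
      qed auto
      moreover have "(\<Inter>n. ?S n) = {..0}"
      proof safe
        fix x :: real assume x: "x \<in> (\<Inter>n. ?S n)"
        have "(\<lambda>n. 1 / real (n + 2)) \<longlonglongrightarrow> 0" by real_asymp
        from LIMSEQ_le_const[OF this] x show "x \<le> 0" by auto
      qed (auto intro: order_trans)
      ultimately have lim: "(\<lambda>n. emeasure (density lborel f) (?S n)) \<longlonglongrightarrow> 0"
        using neg[of 0] by simp
      have "emeasure M {\<omega>\<in>space M. T \<omega> \<le> t} \<le> emeasure (density lborel f) (?S n)" for n
      proof -
        have "t \<le> 1 / real (n + 2)" using 1 s(1)[of n] by linarith
        then have "emeasure M {\<omega>\<in>space M. T \<omega> \<le> t} \<le> emeasure M {\<omega>\<in>space M. T \<omega> \<le> 1 / real (n + 2)}"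
          by (intro emeasure_mono) (auto simp del: of_nat_add intro: order_trans)
        then show ?thesis using cdf[OF s] by simp
      qed
      then have "emeasure M {\<omega>\<in>space M. T \<omega> \<le> t} \<le> 0"
        by (intro LIMSEQ_le_const[OF lim]) auto
      then show ?thesis unfolding D using neg[OF 1] by simp
    next
      case 2
      then show ?thesis unfolding D by (rule cdf)
    next
      case 3
      \<comment> \<open>These half-lines exhaust only \<open>{..<1}\<close>; the remaining part up
        to \<open>t\<close> carries no mass on either side.\<close>
      let ?S = "\<lambda>n :: nat. {..1 - 1 / real (n + 2)}"
      have s: "0 < 1 - 1 / real (n + 2)" "1 - 1 / real (n + 2) < 1" for n by auto
      have inc: "incseq ?S" by (auto simp: incseq_def intro!: divide_left_mono)
      have U: "(\<Union>n. ?S n) = {..<1}"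
      proof safe
        fix x :: real assume "x < 1"
        moreover have "(\<lambda>n. 1 - 1 / real (n + 2)) \<longlonglongrightarrow> 1" by real_asymp
        ultimately have "eventually (\<lambda>n. x < 1 - 1 / real (n + 2)) sequentially"
          by (intro order_tendstoD(1))
        then obtain n where "x < 1 - 1 / real (n + 2)" by (auto simp: eventually_sequentially)
        then show "x \<in> (\<Union>n. ?S n)" by (auto intro!: exI[of _ n])
      qed (auto intro: le_less_trans)
      have "(\<lambda>n. emeasure (density lborel f) (?S n)) \<longlonglongrightarrow> emeasure (density lborel f) {..<1}"
        unfolding U[symmetric] by (intro Lim_emeasure_incseq inc) auto
      moreover have "(\<lambda>n. emeasure (distr M borel T) (?S n)) \<longlonglongrightarrow> emeasure (distr M borel T) {..<1}"
        unfolding U[symmetric] by (intro Lim_emeasure_incseq inc) auto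
      moreover have "emeasure (distr M borel T) (?S n) = emeasure (density lborel f) (?S n)" for n
        using cdf[OF s[of n]] by (subst emeasure_distr) (auto intro!: arg_cong[where f = "emeasure M"] simp: vimage_def Int_def conj_commute)
      ultimately have "emeasure (distr M borel T) {..<1} = emeasure (density lborel f) {..<1}"
        using LIMSEQ_unique by simp blast
      moreover have "emeasure (distr M borel T) {..<1} = emeasure (distr M borel T) {..t}"
      proof -
        have "emeasure M {\<omega>\<in>space M. T \<omega> < 1} = emeasure M {\<omega>\<in>space M. T \<omega> \<le> t}"
          using AE_argmax_time_less_1 3 by (intro emeasure_eq_AE) (auto elim: eventually_mono)
        then show ?thesis
          unfolding D by (subst emeasure_distr) (auto simp: vimage_def Int_def conj_commute)
      qed
      moreover have "emeasure (density lborel f) {..<1} = emeasure (density lborel f) {..t}"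
        using 3 by (simp add: emeasure_density) (intro nn_integral_cong, auto simp: f_def indicator_def)
      ultimately show ?thesis by simp
    qed
  qed auto
  moreover have "distr M lborel T = distr M borel T" by (rule distr_cong) auto
  ultimately have "distributed M lborel T f"
    by (simp add: distributed_def)
  then show ?thesis by (simp add: f_def[abs_def])
qed

end

end

subsection \<open>Passage to continuous modifications\<close>

text \<open>Independence is a statement about the joint law, the product of the marginal laws, and
  laws do not change under almost sure equality.\<close>

lemma (in prob_space) indep_vars_AE_cong:
  assumes X: "indep_vars M' X I" and I: "finite I"
    and Y: "\<And>i. i \<in> I \<Longrightarrow> random_variable (M' i) (Y i)"
    and eq: "\<And>i. i \<in> I \<Longrightarrow> AE \<omega> in M. X i \<omega> = Y i \<omega>"
  shows "indep_vars M' Y I"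
proof (cases "I = {}")
  case True
  then show ?thesis by (simp add: indep_vars_def indep_sets_def)
next
  case False
  have X': "random_variable (M' i) (X i)" if "i \<in> I" for i
    using X that by (simp add: indep_vars_def)
  have "AE \<omega> in M. \<forall>i\<in>I. X i \<omega> = Y i \<omega>"
    using I eq by (simp add: AE_finite_all)
  then have ae: "AE \<omega> in M. (\<lambda>i\<in>I. X i \<omega>) = (\<lambda>i\<in>I. Y i \<omega>)"
    by eventually_elim (auto simp: restrict_def)
  have "distr M (PiM I M') (\<lambda>\<omega>. \<lambda>i\<in>I. Y i \<omega>) = distr M (PiM I M') (\<lambda>\<omega>. \<lambda>i\<in>I. X i \<omega>)"
    using ae X' Y by (intro distr_cong_AE measurable_restrict) (auto elim: eventually_mono)
  also have "\<dots> = (\<Pi>\<^sub>M i\<in>I. distr M (M' i) (X i))"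
    using X by (simp add: indep_vars_iff_distr_eq_PiM'[OF False X'])
  also have "\<dots> = (\<Pi>\<^sub>M i\<in>I. distr M (M' i) (Y i))"
    using eq X' Y by (intro PiM_cong distr_cong_AE) auto
  finally show ?thesis
    by (simp add: indep_vars_iff_distr_eq_PiM'[OF False Y])
qed

lemma distributed_AE_cong:
  assumes X: "distributed M N X f" and Y: "Y \<in> measurable M N" and eq: "AE \<omega> in M. X \<omega> = Y \<omega>"
  shows "distributed M N Y f"
proof -
  have "distr M N Y = distr M N X"
    using X Y eq by (intro distr_cong_AE) (auto simp: distributed_def elim: eventually_mono)
  then show ?thesis using X Y by (simp add: distributed_def)
qed

lemma measurable_restrict_event:
  fixes X :: "'a \<Rightarrow> real"
  assumes "X \<in> borel_measurable M" "G \<in> sets M"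
  shows "(\<lambda>\<omega>. if \<omega> \<in> G then X \<omega> else 0) \<in> borel_measurable M"
  using assms by (intro measurable_If_set) (auto intro: sets.Int_space_eq2[THEN ssubst])

text \<open>Off \<open>G\<close> the path becomes the zero path, which is continuous and starts at
  0; on the full-measure set \<open>G\<close> nothing changes, so all laws persist.\<close>

lemma continuous_brownian_modification:
  assumes M: "prob_space M" and W: "standard_brownian_motion M W"
    and G: "G \<in> sets M" "AE \<omega> in M. \<omega> \<in> G"
    and zero: "\<And>\<omega>. \<omega> \<in> G \<Longrightarrow> W 0 \<omega> = 0" and cont: "\<And>\<omega>. \<omega> \<in> G \<Longrightarrow> continuous_on {0..} (\<lambda>t. W t \<omega>)"
  shows "continuous_brownian M (\<lambda>t \<omega>. if \<omega> \<in> G then W t \<omega> else 0)"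
proof -
  interpret prob_space M by fact
  let ?W = "\<lambda>t \<omega>. if \<omega> \<in> G then W t \<omega> else 0"
  have m: "?W t \<in> borel_measurable M" if "0 \<le> t" for t
    using W that G(1) by (intro measurable_restrict_event) (auto simp: standard_brownian_motion_def)
  have ae: "AE \<omega> in M. W t \<omega> - W s \<omega> = ?W t \<omega> - ?W s \<omega>" for s t
    using G(2) by eventually_elim simp
  show ?thesis
  proof unfold_locales
    show "?W t \<in> borel_measurable M" if "0 \<le> t" for t using that by (rule m)
    show "?W 0 \<omega> = 0" for \<omega> using zero by simp
    show "continuous_on {0..} (\<lambda>t. ?W t \<omega>)" for \<omega> using cont by (cases "\<omega> \<in> G") auto
  next
    fix n and t :: "nat \<Rightarrow> real" assume t: "0 \<le> t 0" "\<And>i. i < n \<Longrightarrow> t i \<le> t (Suc i)"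
    have t_nonneg: "0 \<le> t i" if "i \<le> n" for i
      using that by (induction i) (use t in \<open>auto intro: order_trans\<close>)
    have "indep_vars (\<lambda>_. borel) (\<lambda>i \<omega>. W (t (Suc i)) \<omega> - W (t i) \<omega>) {..<n}"
      using W t unfolding standard_brownian_motion_def by blast
    then show "indep_vars (\<lambda>_. borel) (\<lambda>i \<omega>. ?W (t (Suc i)) \<omega> - ?W (t i) \<omega>) {..<n}"
      by (rule indep_vars_AE_cong) (use t_nonneg ae in \<open>auto intro!: borel_measurable_diff m\<close>)
  next
    fix s t :: real assume st: "0 \<le> s" "s < t"
    have "distributed M lborel (\<lambda>\<omega>. W t \<omega> - W s \<omega>) (\<lambda>x. ennreal (heat (t - s) x))"
      using W st unfolding standard_brownian_motion_def by blast
    then show "distributed M lborel (\<lambda>\<omega>. ?W t \<omega> - ?W s \<omega>) (\<lambda>x. ennreal (heat (t - s) x))"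
      by (rule distributed_AE_cong) (use st ae m in auto)
  qed
qed

lemma continuous_bridge_modification:
  assumes M: "prob_space M" and B: "standard_brownian_bridge M B"
    and G: "G \<in> sets M" "AE \<omega> in M. \<omega> \<in> G"
    and zero: "\<And>\<omega>. \<omega> \<in> G \<Longrightarrow> B 0 \<omega> = 0" "\<And>\<omega>. \<omega> \<in> G \<Longrightarrow> B 1 \<omega> = 0"
    and cont: "\<And>\<omega>. \<omega> \<in> G \<Longrightarrow> continuous_on {0..1} (\<lambda>t. B t \<omega>)"
  shows "continuous_bridge M (\<lambda>t \<omega>. if \<omega> \<in> G then B t \<omega> else 0)"
proof -
  interpret prob_space M by fact
  let ?B = "\<lambda>t \<omega>. if \<omega> \<in> G then B t \<omega> else 0"
  have m: "?B t \<in> borel_measurable M" if "t \<in> {0..1}" for t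
    using B that G(1) by (intro measurable_restrict_event) (auto simp: standard_brownian_bridge_def)
  show ?thesis
  proof unfold_locales
    show "?B t \<in> borel_measurable M" if "t \<in> {0..1}" for t using that by (rule m)
    show "?B 0 \<omega> = 0" "?B 1 \<omega> = 0" for \<omega> using zero by simp_all
    show "continuous_on {0..1} (\<lambda>t. ?B t \<omega>)" for \<omega> using cont by (cases "\<omega> \<in> G") auto
  next
    fix n and t :: "nat \<Rightarrow> real" assume t: "t 0 = 0" "t (Suc n) = 1" "\<And>i. i \<le> n \<Longrightarrow> t i < t (Suc i)"
    have t_nonneg: "0 \<le> t i" if "i \<le> Suc n" for i
      using that by (induction i) (use t in \<open>auto intro: order_trans less_imp_le\<close>)
    have t_le: "t i \<le> 1" if "i \<le> Suc n" for i
      using that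
    proof (induction rule: inc_induct)
      case (step k)
      then show ?case using t(3)[of k] by simp
    qed (simp add: t)
    have "distributed M (\<Pi>\<^sub>M i\<in>{1..n}. lborel) (\<lambda>\<omega>. \<lambda>i\<in>{1..n}. B (t i) \<omega>)
          (\<lambda>x. ennreal (brownian_joint_density (Suc n) t (x(0 := 0, Suc n := 0)) / heat 1 0))"
      using B t unfolding standard_brownian_bridge_def by simp
    then show "distributed M (\<Pi>\<^sub>M i\<in>{1..n}. lborel) (\<lambda>\<omega>. \<lambda>i\<in>{1..n}. ?B (t i) \<omega>)
          (\<lambda>x. ennreal (brownian_joint_density (Suc n) t (x(0 := 0, Suc n := 0)) / heat 1 0))"
    proof (rule distributed_AE_cong)
      show "(\<lambda>\<omega>. \<lambda>i\<in>{1..n}. ?B (t i) \<omega>) \<in> measurable M (\<Pi>\<^sub>M i\<in>{1..n}. lborel)"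
        using t_nonneg t_le m by (intro measurable_restrict) auto
      show "AE \<omega> in M. (\<lambda>i\<in>{1..n}. B (t i) \<omega>) = (\<lambda>i\<in>{1..n}. ?B (t i) \<omega>)"
        using G(2) by eventually_elim simp
    qed
  qed
qed

text \<open>Independence is given for the original processes \<open>W'\<close> and \<open>B'\<close>
  as elements of a product space, where maxima over an interval need not be measurable. Orthant
  events of the maxima of the continuous versions agree almost surely with events at countably many
  times, and those are measurable there.\<close>

lemma (in brownian_and_bridge) indep_pair_maxima:
  assumes ind: "indep_var (\<Pi>\<^sub>M t\<in>{0..}. borel) (\<lambda>\<omega>. \<lambda>t\<in>{0..}. W' t \<omega>)
           (\<Pi>\<^sub>M t\<in>{0..1}. borel) (\<lambda>\<omega>. \<lambda>t\<in>{0..1}. B' t \<omega>)"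
    and W': "AE \<omega> in M. \<forall>t\<ge>0. W' t \<omega> = W t \<omega>" and B': "AE \<omega> in M. \<forall>t\<in>{0..1}. B' t \<omega> = B t \<omega>"
    and t: "0 < t" "t < 1"
  shows "indep_pair borel (\<lambda>\<omega>. (max_W 0 t \<omega>, max_W t 1 \<omega>)) borel (\<lambda>\<omega>. (max_B 0 t \<omega>, max_B t 1 \<omega>))"
    (is "indep_pair _ ?X _ ?Y")
proof -
  have [measurable]: "max_B 0 t \<in> borel_measurable M" "max_B t 1 \<in> borel_measurable M"
    "max_W 0 t \<in> borel_measurable M" "max_W t 1 \<in> borel_measurable M"
    using t by (auto intro!: measurable_max_B measurable_max)
  have X[measurable]: "?X \<in> borel_measurable M" and Y[measurable]: "?Y \<in> borel_measurable M"
    unfolding borel_prod[symmetric] by measurable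
  let ?Q = "\<rat> \<inter> {0<..<t} \<union> \<rat> \<inter> {t<..<1}"
  let ?c = "\<lambda>p q. if q < t then fst p else snd p"
  let ?SW = "\<Pi>\<^sub>M t\<in>{0..}. borel :: real measure" and ?SB = "\<Pi>\<^sub>M t\<in>{0..1}. borel :: real measure"
  let ?FW = "\<lambda>\<omega>. \<lambda>t\<in>{0..}. W' t \<omega>" and ?FB = "\<lambda>\<omega>. \<lambda>t\<in>{0..1}. B' t \<omega>"
  have Q: "countable ?Q" "?Q \<subseteq> {0..1}"
    using t countable_rat by (auto intro: countable_Int1)
  have XQ: "?X \<omega> \<le> p \<longleftrightarrow> (\<forall>q\<in>?Q. W q \<omega> \<le> ?c p q)" for \<omega> p
    using t by (intro running_max_pair_le_iff continuous_path) auto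
  have YQ: "?Y \<omega> \<le> p \<longleftrightarrow> (\<forall>q\<in>?Q. B q \<omega> \<le> ?c p q)" for \<omega> p
    using t by (intro running_max_pair_le_iff continuous_bridge_path) auto
  have boxes: "prob {\<omega>\<in>space M. ?X \<omega> \<le> p \<and> ?Y \<omega> \<le> q} = prob {\<omega>\<in>space M. ?X \<omega> \<le> p} * prob {\<omega>\<in>space M. ?Y \<omega> \<le> q}" for p q
  proof -
    let ?Z1 = "{x\<in>space ?SW. \<forall>s\<in>?Q. x s \<le> ?c p s}" and ?Z2 = "{x\<in>space ?SB. \<forall>s\<in>?Q. x s \<le> ?c q s}"
    have Z1: "?Z1 \<in> sets ?SW"
      using Q by (intro sets.sets_Collect_countable_All' borel_measurable_le measurable_component_singleton) auto
    have Z2: "?Z2 \<in> sets ?SB"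
      using Q by (intro sets.sets_Collect_countable_All' borel_measurable_le measurable_component_singleton) auto
    have mW: "?FW \<in> measurable M ?SW" and mB: "?FB \<in> measurable M ?SB"
      using ind by (auto dest: indep_var_rv1 indep_var_rv2)
    have inW: "AE \<omega> in M. ?X \<omega> \<le> p \<longleftrightarrow> ?FW \<omega> \<in> ?Z1"
      using W'
    proof eventually_elim
      case (elim \<omega>)
      have "?FW \<omega> \<in> ?Z1 \<longleftrightarrow> (\<forall>s\<in>?Q. ?FW \<omega> s \<le> ?c p s)" by (simp add: space_PiM)
      also have "\<dots> \<longleftrightarrow> (\<forall>s\<in>?Q. W s \<omega> \<le> ?c p s)"
        using Q(2) elim by (intro ball_cong refl) auto
      finally show ?case unfolding XQ by (rule sym)
    qed
    have inB: "AE \<omega> in M. ?Y \<omega> \<le> q \<longleftrightarrow> ?FB \<omega> \<in> ?Z2"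
      using B'
    proof eventually_elim
      case (elim \<omega>)
      have "?FB \<omega> \<in> ?Z2 \<longleftrightarrow> (\<forall>s\<in>?Q. ?FB \<omega> s \<le> ?c q s)" by (simp add: space_PiM)
      also have "\<dots> \<longleftrightarrow> (\<forall>s\<in>?Q. B s \<omega> \<le> ?c q s)"
        using Q(2) elim by (intro ball_cong refl) auto
      finally show ?case unfolding YQ by (rule sym)
    qed
    have taut1: "s \<and> P \<longleftrightarrow> a \<and> s" if "P \<longleftrightarrow> a" for P a s
      using that by blast
    have taut2: "s \<and> P \<and> Q \<longleftrightarrow> (a \<and> s) \<and> (b \<and> s)" if "P \<longleftrightarrow> a" "Q \<longleftrightarrow> b" for P Q a b s
      using that by blast
    have sX: "{\<omega>\<in>space M. ?X \<omega> \<le> p} \<in> events" and sY: "{\<omega>\<in>space M. ?Y \<omega> \<le> q} \<in> events"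
      by (simp_all add: less_eq_prod_def)
    have sXY: "{\<omega>\<in>space M. ?X \<omega> \<le> p \<and> ?Y \<omega> \<le> q} \<in> events"
    proof -
      have "{\<omega>\<in>space M. ?X \<omega> \<le> p \<and> ?Y \<omega> \<le> q} = {\<omega>\<in>space M. ?X \<omega> \<le> p} \<inter> {\<omega>\<in>space M. ?Y \<omega> \<le> q}"
        by blast
      then show ?thesis using sX sY by (simp only: sets.Int)
    qed
    have vW: "?FW -` ?Z1 \<inter> space M \<in> events" and vB: "?FB -` ?Z2 \<inter> space M \<in> events"
      using measurable_sets[OF mW Z1] measurable_sets[OF mB Z2] by auto
    have "(\<lambda>\<omega>. (f \<omega>, g \<omega>)) -` (A \<times> C) \<inter> S = (f -` A \<inter> S) \<inter> (g -` C \<inter> S)" for f g :: "'a \<Rightarrow> real \<Rightarrow> real" and A C S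
      by auto
    then have prod: "prob ((?FW -` ?Z1 \<inter> space M) \<inter> (?FB -` ?Z2 \<inter> space M)) = prob (?FW -` ?Z1 \<inter> space M) * prob (?FB -` ?Z2 \<inter> space M)"
      using indep_varD[OF ind Z1 Z2] by (simp only:)
    have "prob {\<omega>\<in>space M. ?X \<omega> \<le> p} = prob (?FW -` ?Z1 \<inter> space M)"
    proof (rule finite_measure_eq_AE[OF _ sX vW])
      show "AE \<omega> in M. \<omega> \<in> {\<omega>\<in>space M. ?X \<omega> \<le> p} \<longleftrightarrow> \<omega> \<in> ?FW -` ?Z1 \<inter> space M"
        using inW by eventually_elim (unfold mem_Collect_eq Int_iff vimage_eq, rule taut1)
    qed
    moreover have "prob {\<omega>\<in>space M. ?Y \<omega> \<le> q} = prob (?FB -` ?Z2 \<inter> space M)"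
    proof (rule finite_measure_eq_AE[OF _ sY vB])
      show "AE \<omega> in M. \<omega> \<in> {\<omega>\<in>space M. ?Y \<omega> \<le> q} \<longleftrightarrow> \<omega> \<in> ?FB -` ?Z2 \<inter> space M"
        using inB by eventually_elim (unfold mem_Collect_eq Int_iff vimage_eq, rule taut1)
    qed
    moreover have "prob {\<omega>\<in>space M. ?X \<omega> \<le> p \<and> ?Y \<omega> \<le> q} = prob ((?FW -` ?Z1 \<inter> space M) \<inter> (?FB -` ?Z2 \<inter> space M))"
    proof (rule finite_measure_eq_AE[OF _ sXY])
      show "AE \<omega> in M. \<omega> \<in> {\<omega>\<in>space M. ?X \<omega> \<le> p \<and> ?Y \<omega> \<le> q} \<longleftrightarrow> \<omega> \<in> (?FW -` ?Z1 \<inter> space M) \<inter> (?FB -` ?Z2 \<inter> space M)"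
        using inW inB by eventually_elim (unfold mem_Collect_eq Int_iff vimage_eq, rule taut2)
    qed (use vW vB in auto)
    ultimately show ?thesis using prod by (simp only:)
  qed
  show ?thesis by (rule indep_pair_atMostI[OF X Y boxes])
qed

text \<open>The locale results apply to versions of both processes set to zero off one common set of
  full measure; since \<open>T\<close> and the suprema are read off the same paths almost surely,
  the conclusion transfers back.\<close>

theorem theorem1p2:
  fixes M :: "'a measure"
    and W B :: "real \<Rightarrow> 'a \<Rightarrow> real"
    and T :: "'a \<Rightarrow> real"
  assumes "prob_space M"
    and "standard_brownian_motion M W"
    and "standard_brownian_bridge M B"
    and "prob_space.indep_var M
           (\<Pi>\<^sub>M t\<in>{0..}. borel) (\<lambda>\<omega>. \<lambda>t\<in>{0..}. W t \<omega>)
           (\<Pi>\<^sub>M t\<in>{0..1}. borel) (\<lambda>\<omega>. \<lambda>t\<in>{0..1}. B t \<omega>)"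
    and "T \<in> borel_measurable M"
    and "\<And>\<omega>. \<omega> \<in> space M \<Longrightarrow> T \<omega> \<in> {0..1}"
    and "AE \<omega> in M. max (W (T \<omega>) \<omega>) (B (T \<omega>) \<omega>)
           = max (SUP s\<in>{0..1}. W s \<omega>) (SUP s\<in>{0..1}. B s \<omega>)"
  shows "distributed M lborel T
           (\<lambda>t. ennreal (if 0 < t \<and> t < 1
              then 4 * sqrt t / (pi * (4 * t + 1) * sqrt (1 - t))
                   + 2 / pi * (sqrt (t * (1 - t)) / (1 + t - t\<^sup>2) + arctan (sqrt (t * (1 - t))))
              else 0))"
proof -
  interpret prob_space M by fact
  have "AE \<omega> in M. W 0 \<omega> = 0 \<and> continuous_on {0..} (\<lambda>t. W t \<omega>) \<and>
      B 0 \<omega> = 0 \<and> B 1 \<omega> = 0 \<and> continuous_on {0..1} (\<lambda>t. B t \<omega>)" (is "AE \<omega> in M. ?good \<omega>")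
    using assms(2,3) by (auto simp: standard_brownian_motion_def standard_brownian_bridge_def)
  \<comment> \<open>The set of good paths need not be measurable, so its complement is covered by a
    measurable null set.\<close>
  then obtain N where N: "{\<omega>\<in>space M. \<not> ?good \<omega>} \<subseteq> N" "N \<in> sets M" "emeasure M N = 0"
    by (rule AE_E)
  define G where "G = space M - N"
  have G: "G \<in> sets M" unfolding G_def using N by auto
  have "AE \<omega> in M. \<omega> \<notin> N" using N by (intro AE_not_in) (auto simp: null_sets_def)
  then have G_AE: "AE \<omega> in M. \<omega> \<in> G" using AE_space by eventually_elim (simp add: G_def)
  have good: "?good \<omega>" if "\<omega> \<in> G" for \<omega> using that N(1) by (auto simp: G_def)
  define W' where "W' t \<omega> = (if \<omega> \<in> G then W t \<omega> else 0)" for t \<omega>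
  define B' where "B' t \<omega> = (if \<omega> \<in> G then B t \<omega> else 0)" for t \<omega>
  have "continuous_brownian M W'"
    unfolding W'_def[abs_def] using assms(1,2) G G_AE good by (intro continuous_brownian_modification) auto
  moreover have "continuous_bridge M B'"
    unfolding B'_def[abs_def] using assms(1,3) G G_AE good by (intro continuous_bridge_modification) auto
  ultimately interpret brownian_and_bridge M W' B'
    by (rule brownian_and_bridge.intro)
  interpret independent_brownian_and_bridge M W' B'
  proof
    fix t :: real assume t: "0 < t" "t < 1"
    show "indep_pair borel (\<lambda>\<omega>. (max_W 0 t \<omega>, max_W t 1 \<omega>)) borel (\<lambda>\<omega>. (max_B 0 t \<omega>, max_B t 1 \<omega>))"
    proof (rule indep_pair_maxima[OF assms(4) _ _ t])
      show "AE \<omega> in M. \<forall>t\<ge>0. W t \<omega> = W' t \<omega>" "AE \<omega> in M. \<forall>t\<in>{0..1}. B t \<omega> = B' t \<omega>"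
        using G_AE by (auto simp: W'_def B'_def elim: eventually_mono)
    qed
  qed
  \<comment> \<open>On \<open>G\<close> the versions coincide with the original paths at all times,
    including the random time \<open>T \<omega>\<close> and throughout the suprema.\<close>
  have "AE \<omega> in M. max (W' (T \<omega>) \<omega>) (B' (T \<omega>) \<omega>) = max (max_W 0 1 \<omega>) (max_B 0 1 \<omega>)"
    using assms(7) G_AE by eventually_elim (simp add: W'_def B'_def running_max_def)
  from argmax_time_distributed[OF assms(5,6) this] show ?thesis
    unfolding rho_def rho_W_def rho_B_def .
qed

end
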